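(* Let $X$ be a flexible affine variety, let $f$ be a local slice of $X$, let $m,l\ge1$ and let $k_1,\dots,k_l>1$ be integers. Consider $$Y=\{u_1\cdots u_m v_1^{k_1}\cdots v_l^{k_l}-f(x)=0\}\subset X\times\mathbb{A}^m_u\times\mathbb{A}^l_v ,$$ assumed irreducible. Each of the following conditions is sufficient for the flexibility of $Y$. (1) $\mathcal{R}_f=\emptyset$. (2) $f$ is a slice of $X$, i.e. $\delta(f)=1$ for some locally nilpotent derivation $\delta$ of $\mathbb{K}[X]$. (3) $f=h\,g\,\delta_0(g)+c$ for some $c\in\mathbb{K}\setminus\{0\}$, $\delta_0\in\operatorname{LND}(X)$ and $h,g\in\mathbb{K}[X]$ with $\deg_{\delta_0}g=1$ and $h\in\operatorname{Ker}\delta_0$. Moreover, more generally, it suffices that $f=h\,g\,p+c$ for some $c\in\mathbb{K}\setminus\{0\}$, $\delta_0\in\operatorname{LND}(X)$, $h,g\in\mathbb{K}[X]$ with $\deg_{\delta_0}g=1$ and $h\in\operatorname{Ker}\delta_0$, and $p\in\mathbb{K}[X]$ such that $p^n=\delta_0(g)$ for some integer $n\ge1$.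
   Context: $\mathbb{K}$ is an algebraically closed field of characteristic zero; $X\subseteq\mathbb{A}^N$ is an irreducible affine variety over $\mathbb{K}$. $Z_{\mathrm{reg}}$ denotes the smooth locus of $Z$. $\operatorname{LND}(X)$ is the set of locally nilpotent derivations of $\mathbb{K}[X]$. A $\mathbb{G}_a$-subgroup of $\operatorname{Aut}(Z)$ is an algebraic subgroup isomorphic to the additive group $(\mathbb{K},+)$; these are exactly the groups $\{\exp(s\delta):s\in\mathbb{K}\}$ for nonzero $\delta\in\operatorname{LND}(Z)$. An irreducible affine variety $Z$ is flexible if for every $p\in Z_{\mathrm{reg}}$ the tangent space $T_pZ$ is spanned by tangent vectors to orbits through $p$ of $\mathbb{G}_a$-subgroups of $\operatorname{Aut}(Z)$. $f\in\mathbb{K}[X]$ is a local slice of $X$ if some $\delta\in\operatorname{LND}(X)$ satisfies $\delta(f)\ne0$, $\delta^2(f)=0$. For nonzero $a$, $\deg_\delta a=\min\{n\ge0:\delta^{n+1}(a)=0\}$. $\mathcal{N}^{(1)}_f=\{\delta\in\operatorname{LND}(X):\deg_\delta f=1\}\cup\{0\}$. $\mathcal{D}_f\subset X$ is the zero locus of the ideal generated by $\{f\}\cup\{\delta f:\delta\in\mathcal{N}^{(1)}_f\}$. $\operatorname{Reg}_X\mathbb{V}(f)$ is the set of points $p\in X$ with $f(p)=0$ at which the matrix obtained from the Jacobian matrix of generators of the ideal of $X\subseteq\mathbb{A}^N$ by adjoining the row of partial derivatives of (a lift of) $f$ has rank $N-\dim X+1$. $\mathcal{R}_f=\mathcal{D}_f\cap\operatorname{Reg}_X\mathbb{V}(f)$.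 *)

theory Defs
  imports "HOL-Analysis.Analysis" "HOL-Library.Poly_Mapping"
begin

text \<open>
  A polynomial over \<open>'k\<close> in the variables \<open>'v\<close> is a finitely supported map from monomials to
  coefficients, a monomial being a finitely supported map from variables to exponents. The ring
  structure is the one of \<^theory>\<open>HOL-Library.Poly_Mapping\<close>.
\<close>

type_synonym ('v, 'k) mpoly = "('v \<Rightarrow>\<^sub>0 nat) \<Rightarrow>\<^sub>0 'k"

definition mp_eval :: "('v \<Rightarrow> 'k::comm_ring_1) \<Rightarrow> ('v, 'k) mpoly \<Rightarrow> 'k" where
  "mp_eval x p = (\<Sum>m\<in>Poly_Mapping.keys p. Poly_Mapping.lookup p m *
                    (\<Prod>i\<in>Poly_Mapping.keys m. x i ^ Poly_Mapping.lookup m i))"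

definition mp_vars :: "('v, 'k::zero) mpoly \<Rightarrow> 'v set" where
  "mp_vars p = (\<Union>m\<in>Poly_Mapping.keys p. Poly_Mapping.keys m)"

text \<open>
  The formal partial derivative. The subtraction of exponents is truncated only for monomials
  not containing the variable \<open>i\<close>, and those get the coefficient \<open>0\<close>.
\<close>

definition mp_pderiv :: "'v \<Rightarrow> ('v, 'k::comm_ring_1) mpoly \<Rightarrow> ('v, 'k) mpoly" where
  "mp_pderiv i p = (\<Sum>m\<in>Poly_Mapping.keys p.
     Poly_Mapping.single (m - Poly_Mapping.single i 1)
       (of_nat (Poly_Mapping.lookup m i) * Poly_Mapping.lookup p m))"

definition gradient :: "('n::finite, 'k::comm_ring_1) mpoly \<Rightarrow> 'k^'n \<Rightarrow> 'k^'n" where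
  "gradient p x = (\<chi> i. mp_eval (($) x) (mp_pderiv i p))"

text \<open>The affine space of dimension \<open>CARD('n)\<close> is the type \<open>'k^'n\<close>.\<close>

definition zariski_closed :: "('k::field^'n) set \<Rightarrow> bool" where
  "zariski_closed X \<longleftrightarrow> (\<exists>S. X = {x. \<forall>p\<in>S. mp_eval (($) x) p = 0})"

definition zariski_irreducible :: "('k::field^'n) set \<Rightarrow> bool" where
  "zariski_irreducible X \<longleftrightarrow> X \<noteq> {} \<and>
     (\<forall>A B. zariski_closed A \<and> zariski_closed B \<and> X \<subseteq> A \<union> B \<longrightarrow> X \<subseteq> A \<or> X \<subseteq> B)"

definition irreducible_affine_variety :: "('k::field^'n) set \<Rightarrow> bool" where
  "irreducible_affine_variety X \<longleftrightarrow> zariski_closed X \<and> zariski_irreducible X"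

definition vanishing_ideal :: "('k::field^'n) set \<Rightarrow> ('n, 'k) mpoly set" where
  "vanishing_ideal X = {p. \<forall>x\<in>X. mp_eval (($) x) p = 0}"

text \<open>
  Elements of the coordinate ring of \<open>X\<close> are represented by functions on the whole affine space
  that are polynomial on \<open>X\<close> and \<open>0\<close> outside \<open>X\<close>; two of them are equal iff they agree on \<open>X\<close>.
\<close>

definition regular_function :: "('k::field^'n) set \<Rightarrow> ('n, 'k) mpoly \<Rightarrow> ('k^'n \<Rightarrow> 'k)" where
  "regular_function X p = (\<lambda>x. if x \<in> X then mp_eval (($) x) p else 0)"

definition coord_ring :: "('k::field^'n) set \<Rightarrow> ('k^'n \<Rightarrow> 'k) set" where
  "coord_ring X = range (regular_function X)"

definition coord_ring_ideal ::
    "('k::field^'n) set \<Rightarrow> ('k^'n \<Rightarrow> 'k) set \<Rightarrow> ('k^'n \<Rightarrow> 'k) set" where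
  "coord_ring_ideal X S = {(\<lambda>x. \<Sum>a\<in>F. c a x * a x) | F c.
     finite F \<and> F \<subseteq> S \<and> (\<forall>a\<in>F. c a \<in> coord_ring X)}"

definition zero_locus :: "('k::field^'n) set \<Rightarrow> ('k^'n \<Rightarrow> 'k) set \<Rightarrow> ('k^'n) set" where
  "zero_locus X S = {x\<in>X. \<forall>a\<in>S. a x = 0}"

definition algebraically_independent ::
    "('k::field^'n) set \<Rightarrow> nat \<Rightarrow> (nat \<Rightarrow> 'k^'n \<Rightarrow> 'k) \<Rightarrow> bool" where
  "algebraically_independent X d a \<longleftrightarrow>
     (\<forall>P :: (nat, 'k) mpoly. mp_vars P \<subseteq> {..<d} \<and> (\<forall>x\<in>X. mp_eval (\<lambda>i. a i x) P = 0) \<longrightarrow> P = 0)"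

text \<open>
  The dimension of an irreducible affine variety is the transcendence degree of its function field.
  As that field is the fraction field of the coordinate ring, this is the largest number of
  algebraically independent elements of the coordinate ring; it is at most \<open>CARD('n)\<close>.
\<close>

definition var_dim :: "('k::field^'n) set \<Rightarrow> nat" where
  "var_dim X = (GREATEST d. \<exists>a. (\<forall>i<d. a i \<in> coord_ring X) \<and> algebraically_independent X d a)"

definition tangent_space :: "('k::field^'n) set \<Rightarrow> 'k^'n \<Rightarrow> ('k^'n) set" where
  "tangent_space X p = {v. \<forall>g\<in>vanishing_ideal X. (\<Sum>i\<in>UNIV. gradient g p $ i * v $ i) = 0}"

definition smooth_locus :: "('k::field^'n) set \<Rightarrow> ('k^'n) set" where
  "smooth_locus X = {p\<in>X. vec.dim (tangent_space X p) = var_dim X}"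

definition variety_morphism ::
    "('k::field^'n) set \<Rightarrow> ('k^'m) set \<Rightarrow> ('k^'n \<Rightarrow> 'k^'m) \<Rightarrow> bool" where
  "variety_morphism X Y \<phi> \<longleftrightarrow> \<phi> ` X \<subseteq> Y \<and>
     (\<forall>i. \<exists>p. \<forall>x\<in>X. \<phi> x $ i = mp_eval (($) x) p)"

definition vjoin :: "'k^'n \<Rightarrow> 'k^'m \<Rightarrow> 'k^('n::finite + 'm::finite)" where
  "vjoin x y = (\<chi> i. case i of Inl j \<Rightarrow> x $ j | Inr j \<Rightarrow> y $ j)"

definition vfst :: "'k^('n::finite + 'm::finite) \<Rightarrow> 'k^'n" where
  "vfst z = (\<chi> i. z $ Inl i)"

definition vsnd :: "'k^('n::finite + 'm::finite) \<Rightarrow> 'k^'m" where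
  "vsnd z = (\<chi> i. z $ Inr i)"

definition var_prod :: "('k^'n) set \<Rightarrow> ('k^'m) set \<Rightarrow> ('k^('n::finite + 'm::finite)) set" where
  "var_prod X Y = {vjoin x y | x y. x \<in> X \<and> y \<in> Y}"

text \<open>Automorphisms are extensional, so that they are determined by their values on \<open>Z\<close>.\<close>

definition variety_aut :: "('k::field^'n) set \<Rightarrow> ('k^'n \<Rightarrow> 'k^'n) set" where
  "variety_aut Z = {\<phi> \<in> extensional Z. bij_betw \<phi> Z Z \<and>
     variety_morphism Z Z \<phi> \<and> variety_morphism Z Z (inv_into Z \<phi>)}"

text \<open>
  The last conjunct makes \<open>H\<close> an algebraic subgroup: \<open>\<phi>\<close> transports the algebraic structure of the
  affine line \<open>'k^1\<close> to \<open>H\<close>, and the action of \<open>H\<close> on \<open>Z\<close> is then a morphism.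
\<close>

definition Ga_subgroup :: "('k::field^'n) set \<Rightarrow> ('k^'n \<Rightarrow> 'k^'n) set \<Rightarrow> bool" where
  "Ga_subgroup Z H \<longleftrightarrow> (\<exists>\<phi> :: 'k \<Rightarrow> 'k^'n \<Rightarrow> 'k^'n.
     H = range \<phi> \<and> inj \<phi> \<and> H \<subseteq> variety_aut Z \<and>
     (\<forall>s t. \<phi> (s + t) = compose Z (\<phi> s) (\<phi> t)) \<and>
     variety_morphism (var_prod (UNIV :: ('k^1) set) Z) Z (\<lambda>y. \<phi> (vfst y $ 1) (vsnd y)))"

definition orbit :: "('k^'n \<Rightarrow> 'k^'n) set \<Rightarrow> 'k^'n \<Rightarrow> ('k^'n) set" where
  "orbit H p = {h p | h. h \<in> H}"

text \<open>
  The tangent space of an orbit at \<open>p\<close> is that of its Zariski closure, since it is defined by the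
  polynomials vanishing on the orbit (orbits of \<open>G_a\<close>-subgroups on affine varieties are closed anyway).
\<close>

definition flexible :: "('k::field^'n) set \<Rightarrow> bool" where
  "flexible Z \<longleftrightarrow> irreducible_affine_variety Z \<and>
     (\<forall>p\<in>smooth_locus Z.
        vec.span (\<Union>H\<in>{H. Ga_subgroup Z H}. tangent_space (orbit H p) p) = tangent_space Z p)"

text \<open>
  Only the values of a derivation on the coordinate ring matter; its values on other functions are
  unconstrained.
\<close>

definition derivation ::
    "('k::field^'n) set \<Rightarrow> (('k^'n \<Rightarrow> 'k) \<Rightarrow> ('k^'n \<Rightarrow> 'k)) \<Rightarrow> bool" where
  "derivation X \<delta> \<longleftrightarrow>
     (\<forall>a\<in>coord_ring X. \<delta> a \<in> coord_ring X) \<and>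
     (\<forall>a\<in>coord_ring X. \<forall>b\<in>coord_ring X. \<delta> (\<lambda>x. a x + b x) = (\<lambda>x. \<delta> a x + \<delta> b x)) \<and>
     (\<forall>c. \<forall>a\<in>coord_ring X. \<delta> (\<lambda>x. c * a x) = (\<lambda>x. c * \<delta> a x)) \<and>
     (\<forall>a\<in>coord_ring X. \<forall>b\<in>coord_ring X. \<delta> (\<lambda>x. a x * b x) = (\<lambda>x. \<delta> a x * b x + a x * \<delta> b x))"

definition LND :: "('k::field^'n) set \<Rightarrow> (('k^'n \<Rightarrow> 'k) \<Rightarrow> ('k^'n \<Rightarrow> 'k)) set" where
  "LND X = {\<delta>. derivation X \<delta> \<and> (\<forall>a\<in>coord_ring X. \<exists>n. (\<delta> ^^ n) a = (\<lambda>_. 0))}"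

text \<open>Meaningful for nonzero \<open>a\<close>; for \<open>a = 0\<close> and \<open>\<delta>\<close> in \<open>LND X\<close> the value is \<open>0\<close>.\<close>

definition lnd_deg :: "(('k^'n \<Rightarrow> 'k::field) \<Rightarrow> ('k^'n \<Rightarrow> 'k)) \<Rightarrow> ('k^'n \<Rightarrow> 'k) \<Rightarrow> nat" where
  "lnd_deg \<delta> a = (LEAST n. (\<delta> ^^ (n + 1)) a = (\<lambda>_. 0))"

definition local_slice :: "('k::field^'n) set \<Rightarrow> ('k^'n \<Rightarrow> 'k) \<Rightarrow> bool" where
  "local_slice X f \<longleftrightarrow> f \<in> coord_ring X \<and>
     (\<exists>\<delta>\<in>LND X. \<delta> f \<noteq> (\<lambda>_. 0) \<and> \<delta> (\<delta> f) = (\<lambda>_. 0))"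

definition slice :: "('k::field^'n) set \<Rightarrow> ('k^'n \<Rightarrow> 'k) \<Rightarrow> bool" where
  "slice X f \<longleftrightarrow> f \<in> coord_ring X \<and> (\<exists>\<delta>\<in>LND X. \<forall>x\<in>X. \<delta> f x = 1)"

definition N1 ::
    "('k::field^'n) set \<Rightarrow> ('k^'n \<Rightarrow> 'k) \<Rightarrow> (('k^'n \<Rightarrow> 'k) \<Rightarrow> ('k^'n \<Rightarrow> 'k)) set" where
  "N1 X f = {\<delta>\<in>LND X. lnd_deg \<delta> f = 1} \<union> {\<lambda>_ _. 0}"

definition D_locus :: "('k::field^'n) set \<Rightarrow> ('k^'n \<Rightarrow> 'k) \<Rightarrow> ('k^'n) set" where
  "D_locus X f = zero_locus X (coord_ring_ideal X ({f} \<union> {\<delta> f | \<delta>. \<delta> \<in> N1 X f}))"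

text \<open>
  \<open>G\<close> generates the ideal of \<open>X\<close> (\<open>module.span (*)\<close> is the generated ideal) and \<open>F\<close> is a lift
  of \<open>f\<close>. The rank of the extended Jacobian matrix is the dimension of the span of its rows, which
  at a zero of \<open>f\<close> on \<open>X\<close> depends neither on \<open>G\<close> nor on \<open>F\<close>; so \<open>G\<close> need not be required finite.
\<close>

definition Reg_zero_locus :: "('k::field^'n) set \<Rightarrow> ('k^'n \<Rightarrow> 'k) \<Rightarrow> ('k^'n) set" where
  "Reg_zero_locus X f = {p\<in>X. f p = 0 \<and>
     (\<exists>G F. module.span (*) G = vanishing_ideal X \<and> regular_function X F = f \<and>
        vec.dim (insert (gradient F p) ((\<lambda>g. gradient g p) ` G)) = CARD('n) - var_dim X + 1)}"

definition R_locus :: "('k::field^'n) set \<Rightarrow> ('k^'n \<Rightarrow> 'k) \<Rightarrow> ('k^'n) set" where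
  "R_locus X f = D_locus X f \<inter> Reg_zero_locus X f"

definition Y_variety ::
    "('k::field^'n) set \<Rightarrow> ('k^'n \<Rightarrow> 'k) \<Rightarrow> ('l \<Rightarrow> nat) \<Rightarrow> ('k^('n::finite + ('m::finite + 'l::finite))) set" where
  "Y_variety X f k = {vjoin x (vjoin u v) | x (u :: 'k^'m) (v :: 'k^'l).
     x \<in> X \<and> (\<Prod>i\<in>UNIV. u $ i) * (\<Prod>j\<in>UNIV. v $ j ^ k j) - f x = 0}"

end

theory Submission
  imports Defs "HOL-Library.Function_Algebras" "HOL-Library.Multiset"
    "HOL-Computational_Algebra.Polynomial"
begin

text \<open>
  Collect the variables \<open>u\<close> and \<open>v\<close> into one vector \<open>w\<close>, with exponents \<open>\<kappa>\<close> equal to \<open>1\<close> on the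
  \<open>u\<close>-part. Then \<open>Y\<close> is the set of all \<open>(x, w)\<close> with \<open>x \<in> X\<close> and \<open>\<Prod>\<^sub>i w\<^sub>i\<^sup>\<kappa>\<^sup>i = F x\<close>, where \<open>F\<close> is a
  polynomial lift of \<open>f\<close>; write \<open>U\<^sub>i\<close> for the product of all factors but the \<open>i\<close>-th. The
  conditions other than the emptiness of \<open>R_locus X f\<close> exhibit a derivation \<open>\<delta>\<close> with \<open>\<delta>\<^sup>2f = 0\<close> such that \<open>\<delta> f\<close> has no zero
  in common with \<open>f\<close>, so they imply that emptiness (\<open>R_locus_empty_if_slice\<close>, \<open>R_locus_empty_if_product\<close>).

  One-parameter subgroups are the same as nontrivial polynomial flows, and the tangent space to an
  orbit is spanned by the velocity of the flow (\<open>span_orbit_tangents\<close>). If the velocities at a point span the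
  tangent space, then they do so at every point that flows carry to it (\<open>reach_flexible_at\<close>). Hence
  it is enough to move every smooth point of \<open>Y\<close> to a convenient one. Two kinds of flows on \<open>Y\<close> serve for
  this. If \<open>\<kappa>\<^sub>i = 1\<close>, any flow of \<open>X\<close>, slowed down by the factor \<open>U\<^sub>i\<close>, lifts by solving
  for \<open>w\<^sub>i\<close> (\<open>unit_lift\<close>). If \<open>\<delta>\<^sup>2f = 0\<close>, then \<open>f\<close> is linear in time along \<open>exp(s\<delta>)\<close>, and moving an arbitrary
  \<open>w\<^sub>i\<close> linearly can be compensated by moving \<open>x\<close> (\<open>linear_lift\<close>). Where \<open>f\<close> and \<open>\<delta> f\<close> are nonzero, these
  velocities span (\<open>flexible_at_general_point\<close>).

  Let \<open>(x, w)\<close> be a smooth point of \<open>Y\<close>. If \<open>U\<^sub>i \<noteq> 0\<close> for some \<open>i\<close> with \<open>\<kappa>\<^sub>i = 1\<close>, then \<open>x\<close> is smooth, and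
  since its orbit is dense in \<open>X\<close> (\<open>orbit_dense\<close>), lifted flows reach a point with \<open>f \<cdot> \<delta> f \<noteq> 0\<close>. Otherwise
  the monomial vanishes at \<open>w\<close> together with its differential, because the
  other exponents are greater than \<open>1\<close>; in particular \<open>f x = 0\<close>. Smoothness of \<open>Y\<close> then makes \<open>x\<close> a smooth point of \<open>X\<close> at which the differential of \<open>f\<close> is nonzero
  (\<open>smooth_Y_if_cofactors_zero\<close>), that is, \<open>x\<close> lies in \<open>Reg_zero_locus X f\<close>. As \<open>R_locus X f\<close> is empty, some derivation with \<open>\<delta>\<^sup>2f = 0\<close>
  satisfies \<open>\<delta> f x \<noteq> 0\<close>; its linear lifts fix \<open>x\<close> and move the \<open>w\<^sub>i\<close> freely, one at a time, to a point
  where the first case applies (\<open>reach_cofactor_nz\<close>).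

  Smooth points are defined by the transcendence degree, so all this needs two foundations.
  The transcendence degree is the minimal dimension of a tangent space
  (\<open>var_dim_le_dim_tangent_space\<close>, \<open>ex_point_with_dim_tangent_space_eq\<close>): one inequality extends
  point derivations from a polynomial algebra to the coordinate ring
  (\<open>extend_point_derivation\<close>), the other differentiates an algebraic relation of minimal degree.
  And the tangent spaces of \<open>Y\<close> are those of its defining equation (\<open>tangent_Y_sufficient\<close>),
  which follows from the same division argument as the extension of derivations.
\<close>

section \<open>Polynomial functions and point derivations\<close>

lemma monomial_eval_superset:
  fixes x :: "'v \<Rightarrow> 'k::comm_ring_1"
  assumes "finite S" "Poly_Mapping.keys m \<subseteq> S"
  shows "(\<Prod>i\<in>Poly_Mapping.keys m. x i ^ Poly_Mapping.lookup m i) = (\<Prod>i\<in>S. x i ^ Poly_Mapping.lookup m i)"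
  by (rule prod.mono_neutral_left) (use assms in \<open>auto simp: in_keys_iff\<close>)

lemma monomial_eval_add:
  fixes x :: "'v \<Rightarrow> 'k::comm_ring_1"
  shows "(\<Prod>i\<in>Poly_Mapping.keys (m + n). x i ^ Poly_Mapping.lookup (m + n) i) =
    (\<Prod>i\<in>Poly_Mapping.keys m. x i ^ Poly_Mapping.lookup m i) *
    (\<Prod>i\<in>Poly_Mapping.keys n. x i ^ Poly_Mapping.lookup n i)"
proof -
  let ?S = "Poly_Mapping.keys m \<union> Poly_Mapping.keys n"
  have "Poly_Mapping.keys (m + n) \<subseteq> ?S"
    by (rule Poly_Mapping.keys_add)
  then have "(\<Prod>i\<in>Poly_Mapping.keys (m + n). x i ^ Poly_Mapping.lookup (m + n) i) =
      (\<Prod>i\<in>?S. x i ^ Poly_Mapping.lookup (m + n) i)"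
    by (intro monomial_eval_superset) auto
  moreover have "(\<Prod>i\<in>Poly_Mapping.keys k. x i ^ Poly_Mapping.lookup k i) =
      (\<Prod>i\<in>?S. x i ^ Poly_Mapping.lookup k i)" if "k = m \<or> k = n" for k
    using that by (intro monomial_eval_superset) auto
  ultimately show ?thesis
    by (simp add: lookup_add power_add prod.distrib)
qed

lemma mp_eval_superset:
  assumes "finite S" "Poly_Mapping.keys p \<subseteq> S"
  shows "mp_eval x p = (\<Sum>m\<in>S. Poly_Mapping.lookup p m *
    (\<Prod>i\<in>Poly_Mapping.keys m. x i ^ Poly_Mapping.lookup m i))"
  unfolding mp_eval_def
  by (rule sum.mono_neutral_left) (use assms in \<open>auto simp: in_keys_iff\<close>)

lemma mp_eval_zero [simp]: "mp_eval x 0 = 0"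
  by (simp add: mp_eval_def)

lemma mp_eval_add: "mp_eval x (p + q) = mp_eval x p + mp_eval x q"
proof -
  let ?S = "Poly_Mapping.keys p \<union> Poly_Mapping.keys q"
  have "Poly_Mapping.keys (p + q) \<subseteq> ?S"
    by (rule Poly_Mapping.keys_add)
  then show ?thesis
    by (simp add: mp_eval_superset[of ?S] lookup_add distrib_right sum.distrib)
qed

lemma mp_eval_sum: "mp_eval x (sum g S) = (\<Sum>a\<in>S. mp_eval x (g a))"
  by (induction S rule: infinite_finite_induct) (simp_all add: mp_eval_add)

lemma mp_eval_single:
  "mp_eval x (Poly_Mapping.single m c) = c * (\<Prod>i\<in>Poly_Mapping.keys m. x i ^ Poly_Mapping.lookup m i)"
  by (simp add: mp_eval_superset[of "{m}"])

lemma poly_mapping_sum_singles: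
  "p = (\<Sum>m\<in>Poly_Mapping.keys p. Poly_Mapping.single m (Poly_Mapping.lookup p m))"
proof (rule poly_mapping_eqI)
  fix k
  show "Poly_Mapping.lookup p k =
    Poly_Mapping.lookup (\<Sum>m\<in>Poly_Mapping.keys p. Poly_Mapping.single m (Poly_Mapping.lookup p m)) k"
    by (auto simp: lookup_sum lookup_single when_def in_keys_iff)
qed

lemma mp_eval_mult: "mp_eval x (p * q) = mp_eval x p * mp_eval x q"
proof -
  let ?s = "\<lambda>p m. Poly_Mapping.single m (Poly_Mapping.lookup p m)"
  have "p * q = (\<Sum>m\<in>Poly_Mapping.keys p. ?s p m) * (\<Sum>n\<in>Poly_Mapping.keys q. ?s q n)"
    using poly_mapping_sum_singles[of p] poly_mapping_sum_singles[of q] by simp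
  also have "\<dots> = (\<Sum>m\<in>Poly_Mapping.keys p. \<Sum>n\<in>Poly_Mapping.keys q.
      Poly_Mapping.single (m + n) (Poly_Mapping.lookup p m * Poly_Mapping.lookup q n))"
    by (simp add: sum_product mult_single)
  finally have "mp_eval x (p * q) = (\<Sum>m\<in>Poly_Mapping.keys p. \<Sum>n\<in>Poly_Mapping.keys q.
      Poly_Mapping.lookup p m * Poly_Mapping.lookup q n *
      (\<Prod>i\<in>Poly_Mapping.keys (m + n). x i ^ Poly_Mapping.lookup (m + n) i))"
    by (simp add: mp_eval_sum mp_eval_single)
  also have "\<dots> = mp_eval x p * mp_eval x q"
    unfolding mp_eval_def sum_product monomial_eval_add
    by (intro sum.cong refl) (simp add: algebra_simps)
  finally show ?thesis .
qed

definition subalg :: "('x \<Rightarrow> 'k::comm_ring_1) set \<Rightarrow> bool" where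
  "subalg A \<longleftrightarrow> (\<forall>c. (\<lambda>_. c) \<in> A) \<and>
     (\<forall>F\<in>A. \<forall>G\<in>A. (\<lambda>x. F x + G x) \<in> A \<and> (\<lambda>x. F x * G x) \<in> A)"

definition point_derivation ::
    "('x \<Rightarrow> 'k::comm_ring_1) set \<Rightarrow> 'x \<Rightarrow> (('x \<Rightarrow> 'k) \<Rightarrow> 'k) \<Rightarrow> bool" where
  "point_derivation A x D \<longleftrightarrow> (\<forall>c. D (\<lambda>_. c) = 0) \<and>
     (\<forall>F\<in>A. \<forall>G\<in>A. D (\<lambda>y. F y + G y) = D F + D G \<and>
        D (\<lambda>y. F y * G y) = F x * D G + G x * D F)"

lemma subalg_const: "subalg A \<Longrightarrow> (\<lambda>_. c) \<in> A"
  and subalg_add: "subalg A \<Longrightarrow> F \<in> A \<Longrightarrow> G \<in> A \<Longrightarrow> (\<lambda>x. F x + G x) \<in> A"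
  and subalg_mult: "subalg A \<Longrightarrow> F \<in> A \<Longrightarrow> G \<in> A \<Longrightarrow> (\<lambda>x. F x * G x) \<in> A"
  by (auto simp: subalg_def)

lemma subalg_uminus: "subalg A \<Longrightarrow> F \<in> A \<Longrightarrow> (\<lambda>x. - F x) \<in> A"
  using subalg_mult[of A "\<lambda>_. -1" F] subalg_const[of A "-1"] by simp

lemma subalg_diff: "subalg A \<Longrightarrow> F \<in> A \<Longrightarrow> G \<in> A \<Longrightarrow> (\<lambda>x. F x - G x) \<in> A"
  using subalg_add[of A F "\<lambda>x. - G x"] subalg_uminus[of A G] by simp

lemma subalg_sum:
  assumes "subalg A" "\<And>i. i \<in> S \<Longrightarrow> F i \<in> A"
  shows "(\<lambda>x. \<Sum>i\<in>S. F i x) \<in> A"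
  using assms(2)
  by (induction S rule: infinite_finite_induct)
    (simp_all add: subalg_const[OF assms(1)] subalg_add[OF assms(1)])

lemma subalg_prod:
  assumes "subalg A" "\<And>i. i \<in> S \<Longrightarrow> F i \<in> A"
  shows "(\<lambda>x. \<Prod>i\<in>S. F i x) \<in> A"
  using assms(2)
  by (induction S rule: infinite_finite_induct)
    (simp_all add: subalg_const[OF assms(1)] subalg_mult[OF assms(1)])

lemma subalg_power: "subalg A \<Longrightarrow> F \<in> A \<Longrightarrow> (\<lambda>x. F x ^ n) \<in> A"
  by (induction n) (simp_all add: subalg_const subalg_mult)

lemma subalg_mp_eval:
  assumes "subalg A" "\<And>i. i \<in> mp_vars P \<Longrightarrow> a i \<in> A"
  shows "(\<lambda>y. mp_eval (\<lambda>i. a i y) P) \<in> A"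
  unfolding mp_eval_def
  by (intro subalg_sum subalg_mult subalg_const subalg_prod subalg_power assms)
    (auto simp: mp_vars_def)

lemma
  assumes "point_derivation A x D"
  shows pd_const: "D (\<lambda>_. c) = 0"
    and pd_add: "F \<in> A \<Longrightarrow> G \<in> A \<Longrightarrow> D (\<lambda>y. F y + G y) = D F + D G"
    and pd_mult: "F \<in> A \<Longrightarrow> G \<in> A \<Longrightarrow> D (\<lambda>y. F y * G y) = F x * D G + G x * D F"
  using assms by (auto simp: point_derivation_def)

lemma pd_cmult:
  assumes "subalg A" "point_derivation A x D" "F \<in> A"
  shows "D (\<lambda>y. c * F y) = c * D F"
  using pd_mult[OF assms(2) subalg_const[OF assms(1), of c] assms(3)] pd_const[OF assms(2)] by simp

lemma pd_sum:
  assumes "subalg A" "point_derivation A x D" "\<And>i. i \<in> S \<Longrightarrow> F i \<in> A"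
  shows "D (\<lambda>y. \<Sum>i\<in>S. F i y) = (\<Sum>i\<in>S. D (F i))"
  using assms(3)
  by (induction S rule: infinite_finite_induct)
    (simp_all add: pd_const[OF assms(2)] pd_add[OF assms(2)] subalg_sum[OF assms(1)])

lemma pd_power:
  assumes "subalg A" "point_derivation A x D" "F \<in> A"
  shows "D (\<lambda>y. F y ^ n) = of_nat n * F x ^ (n - 1) * D F"
proof (induction n)
  case 0
  then show ?case by (simp add: pd_const[OF assms(2)])
next
  case (Suc n)
  have "D (\<lambda>y. F y * F y ^ n) = F x * D (\<lambda>y. F y ^ n) + F x ^ n * D F"
    by (rule pd_mult[OF assms(2,3)]) (rule subalg_power[OF assms(1,3)])
  also have "\<dots> = of_nat (Suc n) * F x ^ n * D F"
    unfolding Suc by (cases n) (simp_all add: algebra_simps)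
  finally show ?case by simp
qed

lemma pd_monomial:
  assumes "subalg A" "point_derivation A x D" "finite S" "\<And>i. i \<in> S \<Longrightarrow> a i \<in> A"
  shows "D (\<lambda>y. \<Prod>i\<in>S. a i y ^ e i) =
    (\<Sum>j\<in>S. of_nat (e j) * (\<Prod>i\<in>S. a i x ^ (e i - (if i = j then 1 else 0))) * D (a j))"
  using assms(3,4)
proof (induction S rule: finite_induct)
  case empty
  then show ?case by (simp add: pd_const[OF assms(2)])
next
  case (insert k S)
  have eq: "(\<Prod>i\<in>S. a i x ^ (e i - (if i = k then 1 else 0))) = (\<Prod>i\<in>S. a i x ^ e i)"
    by (rule prod.cong) (use insert.hyps in auto)
  have "D (\<lambda>y. a k y ^ e k * (\<Prod>i\<in>S. a i y ^ e i)) =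
      a k x ^ e k * D (\<lambda>y. \<Prod>i\<in>S. a i y ^ e i) + (\<Prod>i\<in>S. a i x ^ e i) * D (\<lambda>y. a k y ^ e k)"
    by (rule pd_mult[OF assms(2)])
      (use insert.prems in \<open>auto intro!: subalg_power subalg_prod assms(1)\<close>)
  also have "\<dots> = (\<Sum>j\<in>S. of_nat (e j) * (a k x ^ e k * (\<Prod>i\<in>S. a i x ^ (e i - (if i = j then 1 else 0)))) * D (a j))
     + of_nat (e k) * (a k x ^ (e k - 1) * (\<Prod>i\<in>S. a i x ^ e i)) * D (a k)"
    using insert pd_power[OF assms(1,2), of "a k" "e k"]
    by (simp add: sum_distrib_left algebra_simps)
  also have "(\<Sum>j\<in>S. of_nat (e j) * (a k x ^ e k * (\<Prod>i\<in>S. a i x ^ (e i - (if i = j then 1 else 0)))) * D (a j))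
     = (\<Sum>j\<in>S. of_nat (e j) * (\<Prod>i\<in>insert k S. a i x ^ (e i - (if i = j then 1 else 0))) * D (a j))"
    by (rule sum.cong) (use insert.hyps in auto)
  finally show ?case
    using insert.hyps by (simp add: eq add.commute)
qed

lemma mp_eval_pderiv:
  "mp_eval t (mp_pderiv j P) = (\<Sum>m\<in>Poly_Mapping.keys P. of_nat (Poly_Mapping.lookup m j) * Poly_Mapping.lookup P m *
     (\<Prod>i\<in>Poly_Mapping.keys (m - Poly_Mapping.single j 1). t i ^ Poly_Mapping.lookup (m - Poly_Mapping.single j 1) i))"
  unfolding mp_pderiv_def by (simp add: mp_eval_sum mp_eval_single)

lemma pd_mp_eval:
  assumes A: "subalg A" and D: "point_derivation A x D"
    and S: "finite S" "mp_vars P \<subseteq> S" and a: "\<And>i. i \<in> S \<Longrightarrow> a i \<in> A"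
  shows "D (\<lambda>y. mp_eval (\<lambda>i. a i y) P) = (\<Sum>j\<in>S. mp_eval (\<lambda>i. a i x) (mp_pderiv j P) * D (a j))"
proof -
  let ?K = "Poly_Mapping.keys P" and ?c = "Poly_Mapping.lookup P" and ?l = "Poly_Mapping.lookup"
  have keys: "Poly_Mapping.keys m \<subseteq> S" if "m \<in> ?K" for m
    using S(2) that by (auto simp: mp_vars_def)
  have keys': "Poly_Mapping.keys (m - Poly_Mapping.single j 1) \<subseteq> S" if "m \<in> ?K" for m j
    using keys[OF that] by (auto simp: in_keys_iff lookup_minus)
  have mon: "(\<lambda>y. \<Prod>i\<in>S. a i y ^ ?l m i) \<in> A" for m
    by (intro subalg_prod subalg_power A a)
  have "D (\<lambda>y. mp_eval (\<lambda>i. a i y) P) = D (\<lambda>y. \<Sum>m\<in>?K. ?c m * (\<Prod>i\<in>S. a i y ^ ?l m i))"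
    unfolding mp_eval_def by (simp add: monomial_eval_superset[OF S(1)] keys)
  also have "\<dots> = (\<Sum>m\<in>?K. D (\<lambda>y. ?c m * (\<Prod>i\<in>S. a i y ^ ?l m i)))"
    by (rule pd_sum[OF A D]) (intro subalg_mult[OF A] subalg_const[OF A] mon)
  also have "\<dots> = (\<Sum>m\<in>?K. ?c m * (\<Sum>j\<in>S. of_nat (?l m j) *
      (\<Prod>i\<in>S. a i x ^ (?l m i - (if i = j then 1 else 0))) * D (a j)))"
    by (simp add: pd_cmult[OF A D mon] pd_monomial[OF A D S(1) a])
  also have "\<dots> = (\<Sum>j\<in>S. \<Sum>m\<in>?K. of_nat (?l m j) * ?c m *
      (\<Prod>i\<in>S. a i x ^ (?l m i - (if i = j then 1 else 0))) * D (a j))"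
    unfolding sum_distrib_left by (subst sum.swap) (simp add: algebra_simps)
  also have "\<dots> = (\<Sum>j\<in>S. mp_eval (\<lambda>i. a i x) (mp_pderiv j P) * D (a j))"
  proof (rule sum.cong[OF refl])
    fix j assume "j \<in> S"
    have "(\<Prod>i\<in>S. a i x ^ (?l m i - (if i = j then 1 else 0))) =
      (\<Prod>i\<in>Poly_Mapping.keys (m - Poly_Mapping.single j 1). a i x ^ ?l (m - Poly_Mapping.single j 1) i)"
      if "m \<in> ?K" for m
      unfolding monomial_eval_superset[OF S(1) keys'[OF that]]
      by (rule prod.cong) (auto simp: lookup_minus lookup_single when_def)
    then show "(\<Sum>m\<in>?K. of_nat (?l m j) * ?c m *
      (\<Prod>i\<in>S. a i x ^ (?l m i - (if i = j then 1 else 0))) * D (a j)) =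
      mp_eval (\<lambda>i. a i x) (mp_pderiv j P) * D (a j)"
      unfolding mp_eval_pderiv sum_distrib_right by (intro sum.cong) auto
  qed
  finally show ?thesis .
qed

inductive_set polyfun :: "('k::comm_ring_1^'n \<Rightarrow> 'k) set" where
  polyfun_const: "(\<lambda>_. c) \<in> polyfun"
| polyfun_coord: "(\<lambda>x. x $ i) \<in> polyfun"
| polyfun_add: "F \<in> polyfun \<Longrightarrow> G \<in> polyfun \<Longrightarrow> (\<lambda>x. F x + G x) \<in> polyfun"
| polyfun_mult: "F \<in> polyfun \<Longrightarrow> G \<in> polyfun \<Longrightarrow> (\<lambda>x. F x * G x) \<in> polyfun"

lemma subalg_polyfun: "subalg polyfun"
  by (auto simp: subalg_def intro: polyfun.intros)

lemmas polyfun_uminus = subalg_uminus[OF subalg_polyfun]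
  and polyfun_diff = subalg_diff[OF subalg_polyfun]
  and polyfun_sum = subalg_sum[OF subalg_polyfun]
  and polyfun_prod = subalg_prod[OF subalg_polyfun]
  and polyfun_power = subalg_power[OF subalg_polyfun]

lemmas polyfun_intros = polyfun.intros polyfun_uminus polyfun_diff polyfun_sum polyfun_prod polyfun_power

lemma polyfun_mp_eval: "(\<lambda>x. mp_eval (($) x) P) \<in> polyfun"
  using subalg_mp_eval[OF subalg_polyfun, of P "\<lambda>i x. x $ i"] by (simp add: polyfun_coord)

lemma polyfunE:
  fixes F :: "'k::comm_ring_1^'n \<Rightarrow> 'k"
  assumes "F \<in> polyfun"
  obtains P where "\<And>x. F x = mp_eval (($) x) P"
proof -
  from assms have "\<exists>P. \<forall>x. F x = mp_eval (($) x) P"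
  proof induction
    case (polyfun_const c)
    show ?case by (rule exI[of _ "Poly_Mapping.single 0 c"]) (simp add: mp_eval_single)
  next
    case (polyfun_coord i)
    show ?case
      by (rule exI[of _ "Poly_Mapping.single (Poly_Mapping.single i 1) 1"]) (simp add: mp_eval_single)
  next
    case (polyfun_add F G)
    then show ?case by (metis mp_eval_add)
  next
    case (polyfun_mult F G)
    then show ?case by (metis mp_eval_mult)
  qed
  then show thesis using that by auto
qed

lemma polyfun_eq_range: "polyfun = range (\<lambda>P x. mp_eval (($) x) P)"
  by (auto simp: polyfun_mp_eval image_iff fun_eq_iff elim!: polyfunE)

lemma polyfun_compose:
  assumes "F \<in> polyfun" "\<And>i. (\<lambda>x. \<phi> x $ i) \<in> polyfun"
  shows "(\<lambda>x. F (\<phi> x)) \<in> polyfun"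
  using assms(1) by induction (auto intro: polyfun.intros assms(2))

lemma polyfun_poly:
  assumes "F \<in> polyfun" shows "(\<lambda>x. poly q (F x)) \<in> polyfun"
  unfolding poly_altdef by (intro polyfun_intros assms)

subsection \<open>Directional derivatives\<close>

definition pcurve :: "('k::comm_ring_1 \<Rightarrow> 'k) \<Rightarrow> bool" where
  "pcurve c \<longleftrightarrow> (\<exists>r. \<forall>s. c s = poly r s)"

text \<open>
  The derivative at \<open>0\<close>. Velocities of flows and directional derivatives are both of this kind,
  which reduces the calculus of flows to univariate polynomials.
\<close>

definition deriv_at_0 :: "('k::comm_ring_1 \<Rightarrow> 'k) \<Rightarrow> 'k" where
  "deriv_at_0 c = coeff (SOME r. \<forall>s. c s = poly r s) 1"

definition dd :: "('k::field_char_0^'n \<Rightarrow> 'k) \<Rightarrow> 'k^'n \<Rightarrow> 'k^'n \<Rightarrow> 'k" where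
  "dd F p v = deriv_at_0 (\<lambda>s. F (p + s *s v))"

lemma deriv_at_0_eq:
  fixes c :: "'k::field_char_0 \<Rightarrow> 'k"
  assumes "\<And>s. c s = poly r s"
  shows "deriv_at_0 c = coeff r 1"
proof -
  have "\<forall>s. c s = poly (SOME r. \<forall>s. c s = poly r s) s"
    by (rule someI_ex) (use assms in auto)
  then have "(SOME r. \<forall>s. c s = poly r s) = r"
    using assms by (metis poly_eq_poly_eq_iff ext)
  then show ?thesis by (simp add: deriv_at_0_def)
qed

lemma pcurve_const: "pcurve (\<lambda>_. c)"
  unfolding pcurve_def by (rule exI[of _ "[:c:]"]) simp

lemma pcurve_id: "pcurve (\<lambda>s. s)"
  unfolding pcurve_def by (rule exI[of _ "[:0, 1:]"]) simp

lemma pcurve_add: "pcurve c \<Longrightarrow> pcurve d \<Longrightarrow> pcurve (\<lambda>s. c s + d s)"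
  unfolding pcurve_def by (metis poly_add)

lemma pcurve_mult: "pcurve c \<Longrightarrow> pcurve d \<Longrightarrow> pcurve (\<lambda>s. c s * d s)"
  unfolding pcurve_def by (metis poly_mult)

lemma deriv_at_0_const [simp]: "deriv_at_0 (\<lambda>_. c :: 'k::field_char_0) = 0"
  by (subst deriv_at_0_eq[of _ "[:c:]"]) simp_all

lemma deriv_at_0_id [simp]: "deriv_at_0 (\<lambda>s. s :: 'k::field_char_0) = 1"
  by (subst deriv_at_0_eq[of _ "[:0, 1:]"]) simp_all

lemma deriv_at_0_add:
  fixes c d :: "'k::field_char_0 \<Rightarrow> 'k"
  assumes "pcurve c" "pcurve d"
  shows "deriv_at_0 (\<lambda>s. c s + d s) = deriv_at_0 c + deriv_at_0 d"
proof -
  obtain r q where r: "\<And>s. c s = poly r s" and q: "\<And>s. d s = poly q s"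
    using assms by (auto simp: pcurve_def)
  have "deriv_at_0 (\<lambda>s. c s + d s) = coeff (r + q) 1"
    by (rule deriv_at_0_eq) (simp add: r q)
  then show ?thesis using deriv_at_0_eq[OF r] deriv_at_0_eq[OF q] by simp
qed

lemma deriv_at_0_mult:
  fixes c d :: "'k::field_char_0 \<Rightarrow> 'k"
  assumes "pcurve c" "pcurve d"
  shows "deriv_at_0 (\<lambda>s. c s * d s) = c 0 * deriv_at_0 d + d 0 * deriv_at_0 c"
proof -
  obtain r q where r: "\<And>s. c s = poly r s" and q: "\<And>s. d s = poly q s"
    using assms by (auto simp: pcurve_def)
  have "deriv_at_0 (\<lambda>s. c s * d s) = coeff (r * q) 1"
    by (rule deriv_at_0_eq) (simp add: r q)
  then show ?thesis using deriv_at_0_eq[of c r] deriv_at_0_eq[of d q]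
    by (simp add: r q coeff_mult poly_0_coeff_0)
qed

lemma pcurve_polyfun:
  assumes "F \<in> polyfun" "\<And>i. pcurve (\<lambda>s. \<gamma> s $ i)"
  shows "pcurve (\<lambda>s. F (\<gamma> s))"
  using assms(1) by induction (simp_all add: pcurve_const pcurve_add pcurve_mult assms(2))

lemma pcurve_line: "pcurve (\<lambda>s. (p + s *s v) $ i)"
proof -
  have "pcurve (\<lambda>s. p $ i + s * v $ i)"
    by (intro pcurve_add pcurve_mult pcurve_const pcurve_id)
  then show ?thesis by simp
qed

lemma pcurve_polyfun_line:
  assumes "F \<in> polyfun" shows "pcurve (\<lambda>s. F (p + s *s v))"
  using assms pcurve_line by (rule pcurve_polyfun)

lemma dd_const [simp]: "dd (\<lambda>_. c) p v = 0"
  by (simp add: dd_def)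

lemma dd_coord [simp]: "dd (\<lambda>x. x $ i) p v = v $ i"
  by (simp add: dd_def, subst deriv_at_0_eq[of _ "[:p $ i, v $ i:]"]) simp_all

lemma dd_add:
  assumes "F \<in> polyfun" "G \<in> polyfun"
  shows "dd (\<lambda>x. F x + G x) p v = dd F p v + dd G p v"
  unfolding dd_def by (intro deriv_at_0_add pcurve_polyfun_line assms)

lemma dd_mult:
  assumes "F \<in> polyfun" "G \<in> polyfun"
  shows "dd (\<lambda>x. F x * G x) p v = F p * dd G p v + G p * dd F p v"
  unfolding dd_def
  using deriv_at_0_mult[OF pcurve_polyfun_line[OF assms(1)] pcurve_polyfun_line[OF assms(2)]] by simp

lemma point_derivation_dd: "point_derivation polyfun p (\<lambda>F. dd F p v)"
  by (auto simp: point_derivation_def dd_add dd_mult)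

lemmas dd_cmult = pd_cmult[OF subalg_polyfun point_derivation_dd]

lemma dd_diff:
  assumes "F \<in> polyfun" "G \<in> polyfun"
  shows "dd (\<lambda>x. F x - G x) p v = dd F p v - dd G p v"
  using dd_add[of F "\<lambda>x. (-1) * G x"] dd_cmult[where F = G and c = "-1"] assms
  by (simp add: polyfun_uminus)

text \<open>
  A point derivation is determined by its values on the coordinates; those are the components of the
  corresponding vector.
\<close>

lemma point_derivation_polyfun:
  assumes "point_derivation polyfun p D" "F \<in> polyfun"
  shows "D F = dd F p (\<chi> i. D (\<lambda>x. x $ i))"
  using assms(2)
proof induction
  case (polyfun_const c)
  then show ?case by (simp add: pd_const[OF assms(1)])
next
  case (polyfun_coord i)
  then show ?case by simp
next
  case (polyfun_add F G)
  then show ?case by (simp add: pd_add[OF assms(1)] dd_add)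
next
  case (polyfun_mult F G)
  then show ?case by (simp add: pd_mult[OF assms(1)] dd_mult)
qed

lemma deriv_at_0_polyfun:
  assumes "F \<in> polyfun" "\<And>i. pcurve (\<lambda>s. \<gamma> s $ i)"
  shows "deriv_at_0 (\<lambda>s. F (\<gamma> s)) = dd F (\<gamma> 0) (\<chi> i. deriv_at_0 (\<lambda>s. \<gamma> s $ i))"
  using assms(1)
proof induction
  case (polyfun_add F G)
  then show ?case
    using deriv_at_0_add[OF pcurve_polyfun[OF polyfun_add(1) assms(2)] pcurve_polyfun[OF polyfun_add(2) assms(2)]]
    by (simp add: dd_add)
next
  case (polyfun_mult F G)
  then show ?case
    using deriv_at_0_mult[OF pcurve_polyfun[OF polyfun_mult(1) assms(2)] pcurve_polyfun[OF polyfun_mult(2) assms(2)]]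
    by (simp add: dd_mult)
qed simp_all

lemma dd_compose:
  assumes "F \<in> polyfun" "\<And>i. (\<lambda>x. \<phi> x $ i) \<in> polyfun"
  shows "dd (\<lambda>x. F (\<phi> x)) p v = dd F (\<phi> p) (\<chi> i. dd (\<lambda>x. \<phi> x $ i) p v)"
  using deriv_at_0_polyfun[OF assms(1), of "\<lambda>s. \<phi> (p + s *s v)"] pcurve_polyfun_line[OF assms(2), of p v]
  by (simp add: dd_def)

lemma dd_eq_coords:
  assumes "F \<in> polyfun"
  shows "dd F p v = (\<Sum>i\<in>UNIV. dd F p (axis i 1) * v $ i)"
  using assms
proof induction
  case (polyfun_coord i)
  have "(\<Sum>j\<in>UNIV. (axis j 1 :: 'a^'b) $ i * v $ j) = (\<Sum>j\<in>UNIV. if j = i then v $ j else 0)"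
    by (rule sum.cong) (auto simp: axis_def)
  then show ?case by simp
next
  case (polyfun_add F G)
  then show ?case by (simp add: dd_add distrib_right sum.distrib)
next
  case (polyfun_mult F G)
  then show ?case by (simp add: dd_mult distrib_right sum.distrib sum_distrib_left mult.assoc)
qed simp_all

lemma dd_add_vec: "F \<in> polyfun \<Longrightarrow> dd F p (v + w) = dd F p v + dd F p w"
  unfolding dd_eq_coords[of F p "v + w"] dd_eq_coords[of F p v] dd_eq_coords[of F p w]
  by (simp add: distrib_left sum.distrib)

lemma dd_scale_vec: "F \<in> polyfun \<Longrightarrow> dd F p (c *s v) = c * dd F p v"
  unfolding dd_eq_coords[of F p "c *s v"] dd_eq_coords[of F p v]
  by (simp add: sum_distrib_left algebra_simps)

lemma dd_zero_vec [simp]: "dd F p 0 = 0"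
  by (simp add: dd_def)

lemma dd_sum_vec: "F \<in> polyfun \<Longrightarrow> dd F p (\<Sum>i\<in>S. v i) = (\<Sum>i\<in>S. dd F p (v i))"
  by (induction S rule: infinite_finite_induct) (simp_all add: dd_add_vec)

lemma dd_polyfun_point:
  assumes "F \<in> polyfun" shows "(\<lambda>p. dd F p v) \<in> polyfun"
  using assms by induction (auto simp: dd_add dd_mult intro: polyfun_intros)

lemma gradient_dd:
  fixes p :: "'k::field_char_0^'n"
  shows "(\<Sum>i\<in>UNIV. gradient g p $ i * v $ i) = dd (\<lambda>x. mp_eval (($) x) g) p v"
  using pd_mp_eval[OF subalg_polyfun point_derivation_dd, of UNIV g "\<lambda>i x. x $ i" p v]
  by (simp add: polyfun_coord gradient_def)

lemma gradient_nth: "gradient g p $ i = dd (\<lambda>x. mp_eval (($) x) g) p (axis i 1)"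
  unfolding gradient_dd[symmetric]
  by (subst sum.cong[OF refl, of _ _ "\<lambda>j. if j = i then gradient g p $ j else 0"])
    (auto simp: axis_def)

lemma tangent_space_iff:
  fixes p :: "'k::field_char_0^'n"
  shows "v \<in> tangent_space Z p \<longleftrightarrow> (\<forall>F\<in>polyfun. (\<forall>x\<in>Z. F x = 0) \<longrightarrow> dd F p v = 0)"
  by (auto simp: tangent_space_def gradient_dd vanishing_ideal_def polyfun_eq_range)

lemma subspace_tangent_space:
  fixes p :: "'k::field_char_0^'n"
  shows "vec.subspace (tangent_space Z p)"
  by (auto simp: vec.subspace_def tangent_space_iff dd_add_vec dd_scale_vec)

lemma tangent_space_mono:
  fixes p :: "'k::field_char_0^'n"
  shows "Z \<subseteq> W \<Longrightarrow> tangent_space Z p \<subseteq> tangent_space W p"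
  unfolding subset_iff tangent_space_iff by blast

section \<open>Extending point derivations\<close>

definition coeffs_in :: "'a::zero set \<Rightarrow> 'a poly set" where
  "coeffs_in A = {P. \<forall>i. coeff P i \<in> A}"

text \<open>
  Used over the ring of functions, which has zero divisors and so is excluded by \<^const>\<open>pderiv\<close>.
\<close>

definition formal_deriv :: "'a::comm_semiring_1 poly \<Rightarrow> 'a poly" where
  "formal_deriv P = (\<Sum>i\<le>degree P. monom (of_nat i * coeff P i) (i - 1))"

lemma coeff_formal_deriv: "coeff (formal_deriv P) n = of_nat (Suc n) * coeff P (Suc n)"
proof -
  have "coeff (formal_deriv P) n = (\<Sum>i\<le>degree P. if i = Suc n then of_nat i * coeff P i else 0)"
    unfolding formal_deriv_def coeff_sum
  proof (rule sum.cong)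
    fix i show "coeff (monom (of_nat i * coeff P i) (i - 1)) n = (if i = Suc n then of_nat i * coeff P i else 0)"
      by (cases i) auto
  qed simp
  then show ?thesis
    by (auto simp: not_le coeff_eq_0)
qed

lemma formal_deriv_add: "formal_deriv (P + Q) = formal_deriv P + formal_deriv Q"
  by (rule poly_eqI) (simp add: coeff_formal_deriv distrib_left del: of_nat_Suc)

lemma formal_deriv_smult: "formal_deriv (smult c P) = smult c (formal_deriv P)"
  by (rule poly_eqI) (simp add: coeff_formal_deriv mult.left_commute del: of_nat_Suc)

lemma formal_deriv_pCons: "formal_deriv (pCons a P) = P + pCons 0 (formal_deriv P)"
  by (rule poly_eqI) (simp add: coeff_formal_deriv coeff_pCons distrib_right split: nat.splits)

lemma formal_deriv_zero: "formal_deriv 0 = 0"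
  by (simp add: formal_deriv_def)

definition vanishes_on :: "('x \<Rightarrow> 'k::zero) \<Rightarrow> 'x set \<Rightarrow> bool" where
  "vanishes_on F X \<longleftrightarrow> (\<forall>x\<in>X. F x = 0)"

lemma subalg_zero: "subalg A \<Longrightarrow> 0 \<in> A"
  and subalg_one: "subalg A \<Longrightarrow> 1 \<in> A"
  and subalg_plus: "subalg A \<Longrightarrow> F \<in> A \<Longrightarrow> G \<in> A \<Longrightarrow> F + G \<in> A"
  and subalg_times: "subalg A \<Longrightarrow> F \<in> A \<Longrightarrow> G \<in> A \<Longrightarrow> F * G \<in> A"
  by (simp_all add: zero_fun_def one_fun_def plus_fun_def times_fun_def subalg_const subalg_add subalg_mult)

lemma sum_fun_apply: "(\<Sum>i\<in>S. F i) x = (\<Sum>i\<in>S. F i x :: 'k::comm_monoid_add)"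
  by (induction S rule: infinite_finite_induct) simp_all

lemma power_fun_apply: "(F ^ n) x = (F x ^ n :: 'k::comm_ring_1)"
  by (induction n) simp_all

lemma subalg_of_nat: "subalg A \<Longrightarrow> of_nat n \<in> A"
  by (simp add: of_nat_fun subalg_const)

lemma subalg_sum_fun: "subalg A \<Longrightarrow> (\<And>i. i \<in> S \<Longrightarrow> F i \<in> A) \<Longrightarrow> (\<Sum>i\<in>S. F i) \<in> A"
  by (induction S rule: infinite_finite_induct) (simp_all add: subalg_zero subalg_plus)

context
  fixes A :: "('x \<Rightarrow> 'k::comm_ring_1) set"
  assumes A: "subalg A"
begin

lemma coeffs_in_add: "P \<in> coeffs_in A \<Longrightarrow> Q \<in> coeffs_in A \<Longrightarrow> P + Q \<in> coeffs_in A"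
  by (simp add: coeffs_in_def subalg_plus[OF A])

lemma coeffs_in_mult: "P \<in> coeffs_in A \<Longrightarrow> Q \<in> coeffs_in A \<Longrightarrow> P * Q \<in> coeffs_in A"
  by (simp add: coeffs_in_def coeff_mult subalg_sum_fun[OF A] subalg_times[OF A])

lemma coeffs_in_smult: "c \<in> A \<Longrightarrow> P \<in> coeffs_in A \<Longrightarrow> smult c P \<in> coeffs_in A"
  by (simp add: coeffs_in_def subalg_times[OF A])

lemma coeffs_in_diff: "P \<in> coeffs_in A \<Longrightarrow> Q \<in> coeffs_in A \<Longrightarrow> P - Q \<in> coeffs_in A"
  using subalg_diff[OF A] by (simp add: coeffs_in_def fun_diff_def)

lemma coeffs_in_monom: "c \<in> A \<Longrightarrow> monom c n \<in> coeffs_in A"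
  by (simp add: coeffs_in_def subalg_zero[OF A])

lemma coeffs_in_pCons: "pCons c P \<in> coeffs_in A \<longleftrightarrow> c \<in> A \<and> P \<in> coeffs_in A"
  by (auto simp: coeffs_in_def coeff_pCons split: nat.splits)

lemma coeffs_in_zero: "0 \<in> coeffs_in A"
  by (simp add: coeffs_in_def subalg_zero[OF A])

lemma coeffs_in_formal_deriv: "P \<in> coeffs_in A \<Longrightarrow> formal_deriv P \<in> coeffs_in A"
  using subalg_plus[OF A] subalg_one[OF A] subalg_times[OF A] subalg_of_nat[OF A]
  by (simp add: coeffs_in_def coeff_formal_deriv del: of_nat_Suc)

lemma poly_in_subalg:
  assumes "P \<in> coeffs_in A" "z \<in> A" shows "poly P z \<in> A"
  using assms(1)
  by (induction P) (simp_all add: coeffs_in_pCons subalg_zero[OF A] subalg_plus[OF A] subalg_times[OF A] assms(2))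

lemma subalg_adjoin: "subalg ((\<lambda>P. poly P z) ` coeffs_in A)"
  unfolding subalg_def
proof (intro conjI allI ballI)
  fix c
  have "[:\<lambda>_. c:] \<in> coeffs_in A"
    by (simp add: coeffs_in_pCons coeffs_in_zero subalg_const[OF A])
  then show "(\<lambda>_. c) \<in> (\<lambda>P. poly P z) ` coeffs_in A"
    by (rule rev_image_eqI) simp
next
  fix F G assume "F \<in> (\<lambda>P. poly P z) ` coeffs_in A" "G \<in> (\<lambda>P. poly P z) ` coeffs_in A"
  then obtain P Q where PQ: "P \<in> coeffs_in A" "Q \<in> coeffs_in A" "F = poly P z" "G = poly Q z" by auto
  show "(\<lambda>x. F x + G x) \<in> (\<lambda>P. poly P z) ` coeffs_in A"
    by (rule image_eqI[where x = "P + Q"]) (simp_all add: PQ coeffs_in_add plus_fun_def)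
  show "(\<lambda>x. F x * G x) \<in> (\<lambda>P. poly P z) ` coeffs_in A"
    by (rule image_eqI[where x = "P * Q"]) (simp_all add: PQ coeffs_in_mult times_fun_def)
qed

lemma adjoin_generator: "z \<in> (\<lambda>P. poly P z) ` coeffs_in A"
  by (rule image_eqI[where x = "[:0, 1:]"])
    (simp_all add: coeffs_in_pCons coeffs_in_zero subalg_zero[OF A] subalg_one[OF A])

lemma adjoin_superset: "A \<subseteq> (\<lambda>P. poly P z) ` coeffs_in A"
proof
  fix F assume "F \<in> A"
  then show "F \<in> (\<lambda>P. poly P z) ` coeffs_in A"
    by (intro image_eqI[where x = "[:F:]"]) (simp_all add: coeffs_in_pCons coeffs_in_zero)
qed

text \<open>
  The only candidate for an extension of \<open>D\<close> to \<open>A[z]\<close> sending \<open>z\<close> to \<open>v\<close>, on the level of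
  polynomials in a formal variable instead of \<open>z\<close>.
\<close>

definition extend_pd :: "(('x \<Rightarrow> 'k) \<Rightarrow> 'k) \<Rightarrow> 'x \<Rightarrow> ('x \<Rightarrow> 'k) \<Rightarrow> 'k \<Rightarrow> ('x \<Rightarrow> 'k) poly \<Rightarrow> 'k" where
  "extend_pd D x z v P = (\<Sum>i\<le>degree P. D (coeff P i) * z x ^ i) + poly (formal_deriv P) z x * v"

context
  fixes D :: "('x \<Rightarrow> 'k) \<Rightarrow> 'k" and x :: 'x
  assumes D: "point_derivation A x D"
begin

lemma pd_zero_fun: "D 0 = 0"
  using pd_const[OF D] by (simp add: zero_fun_def)

lemma pd_plus: "F \<in> A \<Longrightarrow> G \<in> A \<Longrightarrow> D (F + G) = D F + D G"
  using pd_add[OF D] by (simp add: plus_fun_def)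

lemma pd_times: "F \<in> A \<Longrightarrow> G \<in> A \<Longrightarrow> D (F * G) = F x * D G + G x * D F"
  using pd_mult[OF D] by (simp add: times_fun_def)

lemma extend_pd_bound:
  assumes "degree P \<le> n"
  shows "extend_pd D x z v P = (\<Sum>i\<le>n. D (coeff P i) * z x ^ i) + poly (formal_deriv P) z x * v"
  unfolding extend_pd_def
  by (simp, rule sum.mono_neutral_left) (use assms in \<open>auto simp: coeff_eq_0 pd_zero_fun\<close>)

lemma extend_pd_zero: "extend_pd D x z v 0 = 0"
  by (simp add: extend_pd_def pd_zero_fun formal_deriv_zero)

lemma extend_pd_add:
  assumes "P \<in> coeffs_in A" "Q \<in> coeffs_in A"
  shows "extend_pd D x z v (P + Q) = extend_pd D x z v P + extend_pd D x z v Q"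
proof -
  let ?n = "max (degree P) (degree Q)"
  have "degree (P + Q) \<le> ?n" by (rule degree_add_le_max)
  then show ?thesis
    using assms
    by (simp add: extend_pd_bound[of _ ?n] formal_deriv_add pd_plus coeffs_in_def distrib_right sum.distrib)
qed

lemma extend_pd_smult:
  assumes "c \<in> A" "P \<in> coeffs_in A"
  shows "extend_pd D x z v (smult c P) = c x * extend_pd D x z v P + D c * poly P z x"
proof -
  have *: "poly P z x = (\<Sum>i\<le>degree P. coeff P i x * z x ^ i)"
    by (simp add: poly_altdef sum_fun_apply power_fun_apply)
  have "degree (smult c P) \<le> degree P" by (rule degree_smult_le)
  then have "extend_pd D x z v (smult c P) = (\<Sum>i\<le>degree P. D (c * coeff P i) * z x ^ i) +
      c x * poly (formal_deriv P) z x * v"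
    by (simp add: extend_pd_bound[of _ "degree P"] formal_deriv_smult)
  also have "(\<Sum>i\<le>degree P. D (c * coeff P i) * z x ^ i) =
     c x * (\<Sum>i\<le>degree P. D (coeff P i) * z x ^ i) + D c * poly P z x"
    using assms by (simp add: pd_times coeffs_in_def * sum_distrib_left sum.distrib algebra_simps)
  finally show ?thesis by (simp add: extend_pd_def algebra_simps)
qed

lemma extend_pd_const:
  "extend_pd D x z v [:a:] = D a"
  by (simp add: extend_pd_def formal_deriv_def)

lemma extend_pd_diff:
  assumes "P \<in> coeffs_in A" "Q \<in> coeffs_in A"
  shows "extend_pd D x z v (P - Q) = extend_pd D x z v P - extend_pd D x z v Q"
  using extend_pd_add[OF coeffs_in_diff[OF assms] assms(2), of z v] by simp

lemma extend_pd_pCons: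
  "extend_pd D x z v (pCons a P) = D a + z x * extend_pd D x z v P + v * poly P z x"
proof -
  have "degree (pCons a P) \<le> Suc (degree P)" by (rule degree_pCons_le)
  then have "extend_pd D x z v (pCons a P) =
      (\<Sum>i\<le>Suc (degree P). D (coeff (pCons a P) i) * z x ^ i) + poly (formal_deriv (pCons a P)) z x * v"
    by (rule extend_pd_bound)
  also have "(\<Sum>i\<le>Suc (degree P). D (coeff (pCons a P) i) * z x ^ i) =
      D a + z x * (\<Sum>i\<le>degree P. D (coeff P i) * z x ^ i)"
    by (subst sum.atMost_Suc_shift) (simp add: sum_distrib_left algebra_simps)
  finally show ?thesis
    by (simp add: extend_pd_def formal_deriv_pCons algebra_simps)
qed

lemma extend_pd_mult:
  assumes "P \<in> coeffs_in A" "Q \<in> coeffs_in A"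
  shows "extend_pd D x z v (P * Q) = poly P z x * extend_pd D x z v Q + poly Q z x * extend_pd D x z v P"
  using assms(1)
proof (induction P)
  case 0
  then show ?case by (simp add: extend_pd_zero)
next
  case (pCons a P)
  then have a: "a \<in> A" and P: "P \<in> coeffs_in A" by (auto simp: coeffs_in_pCons)
  have "pCons 0 (P * Q) \<in> coeffs_in A"
    by (simp add: coeffs_in_pCons subalg_zero[OF A] coeffs_in_mult P assms(2))
  then have "extend_pd D x z v (smult a Q + pCons 0 (P * Q)) =
      a x * extend_pd D x z v Q + D a * poly Q z x + (z x * extend_pd D x z v (P * Q) + v * poly (P * Q) z x)"
    by (simp add: extend_pd_add coeffs_in_smult a assms(2) extend_pd_smult extend_pd_pCons pd_zero_fun del: poly_mult)
  then show ?case
    using pCons.IH[OF P] by (simp add: extend_pd_pCons algebra_simps)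
qed

text \<open>
  Division with remainder: if a relation over \<open>A\<close> with a leading coefficient not vanishing on \<open>X\<close>
  can always be shortened by a multiple of some relation that the extended derivation respects,
  then the extended derivation respects all relations.
\<close>

lemma extend_pd_respects_relations:
  assumes X: "x \<in> X"
    and kills: "\<And>F. F \<in> A \<Longrightarrow> vanishes_on F X \<Longrightarrow> D F = 0"
    and reduce: "\<And>P. P \<in> coeffs_in A \<Longrightarrow> vanishes_on (poly P z) X \<Longrightarrow> \<not> vanishes_on (lead_coeff P) X \<Longrightarrow>
      \<exists>c\<in>A. \<exists>Q\<in>coeffs_in A. c x * r = 1 \<and> degree Q \<le> degree P \<and> coeff Q (degree P) = c * lead_coeff P \<and>
        vanishes_on (poly Q z) X \<and> extend_pd D x z v Q = 0"
    and P: "P \<in> coeffs_in A" "vanishes_on (poly P z) X"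
  shows "extend_pd D x z v P = 0"
  using P
proof (induction "length (coeffs P)" arbitrary: P rule: less_induct)
  case less
  define \<gamma> where "\<gamma> = lead_coeff P"
  have \<gamma>A: "\<gamma> \<in> A" using less.prems by (simp add: \<gamma>_def coeffs_in_def)
  show ?case
  proof (cases "P = 0")
    case True
    then show ?thesis by (simp add: extend_pd_zero)
  next
    case nz: False
    have shorter: "extend_pd D x z v R = 0"
      if "degree R \<le> degree P" "coeff R (degree P) = 0" "R \<in> coeffs_in A" "vanishes_on (poly R z) X" for R
      using eq_zero_or_degree_less[OF that(1,2)]
    proof
      assume "R = 0"
      then show ?thesis by (simp add: extend_pd_zero)
    next
      assume "degree R < degree P"
      then have "length (coeffs R) < length (coeffs P)"
        using nz by (cases "R = 0") (auto simp: length_coeffs)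
      then show ?thesis using less.hyps that by blast
    qed
    show ?thesis
    proof (cases "vanishes_on \<gamma> X")
      case True
      define M where "M = monom \<gamma> (degree P)"
      have M: "M \<in> coeffs_in A" by (simp add: M_def coeffs_in_monom \<gamma>A)
      have M1: "monom 1 (degree P) \<in> coeffs_in A" by (simp add: coeffs_in_monom subalg_one[OF A])
      have "M = smult \<gamma> (monom 1 (degree P))" by (simp add: M_def smult_monom)
      then have "extend_pd D x z v M = 0"
        using kills[OF \<gamma>A True] True X by (simp add: extend_pd_smult[OF \<gamma>A M1] vanishes_on_def)
      moreover have "extend_pd D x z v (P - M) = 0"
      proof (rule shorter)
        show "degree (P - M) \<le> degree P"
          by (rule degree_diff_le) (auto simp: M_def degree_monom_le)
        show "vanishes_on (poly (P - M) z) X"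
          using less.prems True by (simp add: vanishes_on_def M_def poly_monom)
      qed (auto simp: M_def \<gamma>_def coeffs_in_diff less.prems M[unfolded M_def \<gamma>_def])
      ultimately show ?thesis by (simp add: extend_pd_diff less.prems M)
    next
      case False
      then obtain c Q where c: "c \<in> A" "c x * r = 1" and Q: "Q \<in> coeffs_in A" "degree Q \<le> degree P"
        "coeff Q (degree P) = c * lead_coeff P" "vanishes_on (poly Q z) X" "extend_pd D x z v Q = 0"
        using reduce[OF less.prems] by (auto simp: \<gamma>_def)
      have cP: "smult c P \<in> coeffs_in A" by (simp add: coeffs_in_smult c less.prems)
      have "extend_pd D x z v (smult c P - Q) = 0"
      proof (rule shorter)
        show "degree (smult c P - Q) \<le> degree P"
          by (rule degree_diff_le) (auto simp: Q degree_smult_le)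
        show "vanishes_on (poly (smult c P - Q) z) X"
          using less.prems Q by (simp add: vanishes_on_def)
      qed (simp_all add: Q coeffs_in_diff cP)
      then have "c x * extend_pd D x z v P + D c * poly P z x = 0"
        by (simp add: extend_pd_diff cP Q extend_pd_smult c less.prems)
      then have "c x * extend_pd D x z v P = 0"
        using less.prems X by (simp add: vanishes_on_def)
      then have "r * (c x * extend_pd D x z v P) = 0" by simp
      then show ?thesis
        using c(2) by (metis mult.assoc mult.commute mult.left_neutral)
    qed
  qed
qed

lemma point_derivation_adjoin:
  assumes X: "x \<in> X"
    and resp: "\<And>P. P \<in> coeffs_in A \<Longrightarrow> vanishes_on (poly P z) X \<Longrightarrow> extend_pd D x z v P = 0"
  shows "\<exists>D'. point_derivation ((\<lambda>P. poly P z) ` coeffs_in A) x D' \<and>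
    (\<forall>F\<in>(\<lambda>P. poly P z) ` coeffs_in A. vanishes_on F X \<longrightarrow> D' F = 0) \<and> (\<forall>F\<in>A. D' F = D F)"
proof -
  define D' where "D' F = extend_pd D x z v (SOME P. P \<in> coeffs_in A \<and> poly P z = F)" for F
  have D': "D' (poly P z) = extend_pd D x z v P" if "P \<in> coeffs_in A" for P
  proof -
    let ?Q = "SOME Q. Q \<in> coeffs_in A \<and> poly Q z = poly P z"
    have Q: "?Q \<in> coeffs_in A \<and> poly ?Q z = poly P z"
      by (rule someI_ex) (use that in auto)
    then have "extend_pd D x z v (?Q - P) = 0"
      using that by (intro resp) (auto simp: coeffs_in_diff vanishes_on_def)
    then show ?thesis using that Q by (simp add: extend_pd_diff D'_def)
  qed
  have const: "[:\<lambda>_. c:] \<in> coeffs_in A" for c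
    by (simp add: coeffs_in_pCons coeffs_in_zero subalg_const[OF A])
  have base: "D' F = D F" if "F \<in> A" for F
    using D'[of "[:F:]"] that by (simp add: coeffs_in_pCons coeffs_in_zero extend_pd_const)
  show ?thesis
  proof (intro exI[of _ D'] conjI ballI impI)
    show "point_derivation ((\<lambda>P. poly P z) ` coeffs_in A) x D'"
      unfolding point_derivation_def
    proof (intro conjI allI ballI)
      fix c show "D' (\<lambda>_. c) = 0"
        using base[of "\<lambda>_. c"] pd_const[OF D] subalg_const[OF A] by simp
    next
      fix F G assume "F \<in> (\<lambda>P. poly P z) ` coeffs_in A" "G \<in> (\<lambda>P. poly P z) ` coeffs_in A"
      then obtain P Q where PQ: "P \<in> coeffs_in A" "Q \<in> coeffs_in A" "F = poly P z" "G = poly Q z" by auto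
      show "D' (\<lambda>y. F y + G y) = D' F + D' G"
        using D'[OF coeffs_in_add[OF PQ(1,2)]] D'[OF PQ(1)] D'[OF PQ(2)] extend_pd_add[OF PQ(1,2), of z v]
        by (simp add: PQ plus_fun_def)
      show "D' (\<lambda>y. F y * G y) = F x * D' G + G x * D' F"
        using D'[OF coeffs_in_mult[OF PQ(1,2)]] D'[OF PQ(1)] D'[OF PQ(2)] extend_pd_mult[OF PQ(1,2), of z v]
        by (simp add: PQ times_fun_def)
    qed
  qed (auto simp: D' resp base)
qed

end

end

text \<open>
  If \<open>z\<close> is transcendental over \<open>A\<close>, its image under the extension may be chosen at will. Otherwise a
  relation of minimal degree prescribes the image, by a linear equation whose coefficient is the derivative
  of the relation at \<open>z\<close>; being a shorter polynomial with nonzero leading coefficient, in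
  characteristic zero, this derivative is no relation and hence invertible at a general point.
\<close>

lemma extend_point_derivation:
  fixes A :: "('x \<Rightarrow> 'k::field_char_0) set"
  assumes A: "subalg A" and B: "subalg B" "A \<subseteq> B" "z \<in> B"
    and prime: "\<And>F G. F \<in> B \<Longrightarrow> G \<in> B \<Longrightarrow> vanishes_on (\<lambda>x. F x * G x) X \<Longrightarrow> vanishes_on F X \<or> vanishes_on G X"
    and X: "X \<noteq> {}"
  shows "\<exists>s\<in>B. \<not> vanishes_on s X \<and> (\<forall>x\<in>X. s x \<noteq> 0 \<longrightarrow> (\<forall>D. point_derivation A x D \<and>
      (\<forall>F\<in>A. vanishes_on F X \<longrightarrow> D F = 0) \<longrightarrow>
    (\<exists>D'. point_derivation ((\<lambda>P. poly P z) ` coeffs_in A) x D' \<and>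
      (\<forall>F\<in>(\<lambda>P. poly P z) ` coeffs_in A. vanishes_on F X \<longrightarrow> D' F = 0) \<and> (\<forall>F\<in>A. D' F = D F))))"
proof -
  define rel where "rel P \<longleftrightarrow> P \<in> coeffs_in A \<and> vanishes_on (poly P z) X \<and> \<not> vanishes_on (lead_coeff P) X" for P
  have coB: "P \<in> coeffs_in A \<Longrightarrow> P \<in> coeffs_in B" for P
    using B(2) by (auto simp: coeffs_in_def)
  show ?thesis
  proof (cases "\<exists>P. rel P")
    case False
    show ?thesis
    proof (intro bexI[of _ "\<lambda>_. 1"] conjI ballI impI allI)
      show "\<not> vanishes_on (\<lambda>_. 1 :: 'k) X" using X by (auto simp: vanishes_on_def)
      show "(\<lambda>_. 1) \<in> B" by (rule subalg_const[OF B(1)])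
      fix x D assume x: "x \<in> X" and D: "point_derivation A x D \<and> (\<forall>F\<in>A. vanishes_on F X \<longrightarrow> D F = 0)"
      then show "\<exists>D'. point_derivation ((\<lambda>P. poly P z) ` coeffs_in A) x D' \<and>
        (\<forall>F\<in>(\<lambda>P. poly P z) ` coeffs_in A. vanishes_on F X \<longrightarrow> D' F = 0) \<and> (\<forall>F\<in>A. D' F = D F)"
        using False
        by (intro point_derivation_adjoin[OF A _ x, where v = 0]
            extend_pd_respects_relations[OF A _ x, where v = 0 and r = 0]) (auto simp: rel_def)
    qed
  next
    case True
    define p where "p = (ARG_MIN degree P. rel P)"
    have p: "rel p" and p_min: "\<And>P. rel P \<Longrightarrow> degree p \<le> degree P"
      using True arg_min_nat_lemma[of rel _ degree] by (auto simp: p_def)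
    define n where "n = degree p"
    have n: "n \<noteq> 0"
    proof
      assume "n = 0"
      then obtain a where "p = [:a:]" by (metis n_def degree_eq_zeroE)
      then show False using p by (simp add: rel_def)
    qed
    let ?p' = "formal_deriv p"
    have co: "coeff ?p' (n - 1) = of_nat n * lead_coeff p"
      using n by (simp add: coeff_formal_deriv n_def del: of_nat_Suc)
    have nv: "\<not> vanishes_on (coeff ?p' (n - 1)) X"
      unfolding co using p n by (auto simp: rel_def vanishes_on_def)
    have "degree ?p' \<le> n - 1"
      by (rule degree_le) (use n in \<open>auto simp: coeff_formal_deriv n_def coeff_eq_0\<close>)
    moreover have "degree ?p' \<ge> n - 1"
      by (rule le_degree) (use nv in \<open>auto simp: vanishes_on_def\<close>)
    ultimately have deg: "degree ?p' = n - 1" by simp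
    have p'A: "?p' \<in> coeffs_in A" using p by (simp add: rel_def coeffs_in_formal_deriv[OF A])
    have p'nv: "\<not> vanishes_on (poly ?p' z) X"
      using p_min[of ?p'] nv deg n p'A by (auto simp: rel_def n_def[symmetric])
    define s where "s x = lead_coeff p x * poly ?p' z x" for x
    have lB: "lead_coeff p \<in> B" using p B(2) by (auto simp: rel_def coeffs_in_def)
    have p'B: "poly ?p' z \<in> B" by (intro poly_in_subalg[OF B(1)] coB p'A B(3))
    show ?thesis
    proof (intro bexI[of _ s] conjI ballI impI allI)
      show "s \<in> B" unfolding s_def by (rule subalg_mult[OF B(1) lB p'B])
      show "\<not> vanishes_on s X"
        unfolding s_def using prime[OF lB p'B] p'nv p by (auto simp: rel_def)
      fix x D assume x: "x \<in> X" "s x \<noteq> 0"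
        and D: "point_derivation A x D \<and> (\<forall>F\<in>A. vanishes_on F X \<longrightarrow> D F = 0)"
      define v where "v = - (\<Sum>i\<le>degree p. D (coeff p i) * z x ^ i) / poly ?p' z x"
      have pA: "p \<in> coeffs_in A" using p by (simp add: rel_def)
      have Ep: "extend_pd D x z v p = 0"
        using x by (simp add: extend_pd_def[OF A] v_def s_def)
      show "\<exists>D'. point_derivation ((\<lambda>P. poly P z) ` coeffs_in A) x D' \<and>
        (\<forall>F\<in>(\<lambda>P. poly P z) ` coeffs_in A. vanishes_on F X \<longrightarrow> D' F = 0) \<and> (\<forall>F\<in>A. D' F = D F)"
      proof (rule point_derivation_adjoin[OF A conjunct1[OF D] x(1), where v = v])
        fix P assume P: "P \<in> coeffs_in A" "vanishes_on (poly P z) X"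
        show "extend_pd D x z v P = 0"
        proof (rule extend_pd_respects_relations[OF A conjunct1[OF D] x(1) _ _ P, where r = "1 / lead_coeff p x"])
          fix F assume "F \<in> A" "vanishes_on F X"
          then show "D F = 0" using D by blast
        next
          fix P assume P: "P \<in> coeffs_in A" "vanishes_on (poly P z) X" "\<not> vanishes_on (lead_coeff P) X"
          then have le: "degree p \<le> degree P" using p_min by (simp add: rel_def)
          have lA: "lead_coeff P \<in> A" using P by (simp add: coeffs_in_def)
          let ?m = "monom (lead_coeff P) (degree P - degree p)"
          have mA: "?m \<in> coeffs_in A" by (rule coeffs_in_monom[OF A lA])
          have "degree (?m * p) \<le> degree ?m + degree p" by (rule degree_mult_le)
          also have "\<dots> \<le> degree P" using le degree_monom_le[of "lead_coeff P" "degree P - degree p"] by simp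
          finally have d: "degree (?m * p) \<le> degree P" .
          have c: "coeff (?m * p) (degree P) = lead_coeff p * lead_coeff P"
            by (subst coeff_monom_mult) (use le in \<open>simp add: mult.commute\<close>)
          have "extend_pd D x z v (?m * p) = 0"
            using x p Ep by (simp add: extend_pd_mult[OF A conjunct1[OF D] mA pA] rel_def vanishes_on_def)
          moreover have "vanishes_on (poly (?m * p) z) X" using p by (simp add: rel_def vanishes_on_def)
          moreover have "lead_coeff p \<in> A" using pA by (simp add: coeffs_in_def)
          moreover have "lead_coeff p x * (1 / lead_coeff p x) = 1" using x by (simp add: s_def)
          ultimately show "\<exists>c\<in>A. \<exists>Q\<in>coeffs_in A. c x * (1 / lead_coeff p x) = 1 \<and> degree Q \<le> degree P \<and>
            coeff Q (degree P) = c * lead_coeff P \<and> vanishes_on (poly Q z) X \<and> extend_pd D x z v Q = 0"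
            using d c coeffs_in_mult[OF A mA pA] by blast
        qed
      qed
    qed
  qed
qed

section \<open>Dimension and tangent spaces\<close>

subsection \<open>Polynomials\<close>

lemma mp_vars_add: "mp_vars (P + Q) \<subseteq> mp_vars P \<union> mp_vars Q"
  using Poly_Mapping.keys_add[of P Q] by (auto simp: mp_vars_def)

lemma mp_vars_mult: "mp_vars (P * Q) \<subseteq> mp_vars P \<union> mp_vars Q"
proof
  fix i assume "i \<in> mp_vars (P * Q)"
  then obtain m where m: "m \<in> Poly_Mapping.keys (P * Q)" "i \<in> Poly_Mapping.keys m"
    by (auto simp: mp_vars_def)
  then obtain a b where ab: "m = a + b" "a \<in> Poly_Mapping.keys P" "b \<in> Poly_Mapping.keys Q"
    using keys_mult[of P Q] by blast
  then have "i \<in> Poly_Mapping.keys a \<union> Poly_Mapping.keys b"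
    using m Poly_Mapping.keys_add[of a b] by auto
  then show "i \<in> mp_vars P \<union> mp_vars Q" using ab by (auto simp: mp_vars_def)
qed

lemma mp_vars_single: "mp_vars (Poly_Mapping.single m c) \<subseteq> Poly_Mapping.keys m"
  by (auto simp: mp_vars_def split: if_splits)

lemma mp_vars_sum: "mp_vars (\<Sum>a\<in>S. g a) \<subseteq> (\<Union>a\<in>S. mp_vars (g a))"
proof (induction S rule: infinite_finite_induct)
  case (insert x F)
  then show ?case using mp_vars_add[of "g x" "sum g F"] by auto
qed (auto simp: mp_vars_def)

lemma mp_eval_diff: "mp_eval x (p - q) = mp_eval x p - mp_eval x q"
  using mp_eval_add[of x "p - q" q] by simp

lemma lookup_mp_pderiv:
  "Poly_Mapping.lookup (mp_pderiv j P) n =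
    of_nat (Suc (Poly_Mapping.lookup n j)) * Poly_Mapping.lookup P (n + Poly_Mapping.single j 1)"
proof -
  let ?e = "Poly_Mapping.single j (1::nat)"
  have iff: "m - ?e = n \<longleftrightarrow> m = n + ?e" if "Poly_Mapping.lookup m j \<noteq> 0" for m
  proof
    assume n: "m - ?e = n"
    have "Poly_Mapping.lookup m i = Poly_Mapping.lookup (n + ?e) i" for i
      using arg_cong[OF n, of "\<lambda>k. Poly_Mapping.lookup k i"] that
      by (cases "i = j") (simp_all add: lookup_add lookup_minus lookup_single)
    then show "m = n + ?e" by (rule poly_mapping_eqI)
  qed simp
  have "Poly_Mapping.lookup (mp_pderiv j P) n =
    (\<Sum>m\<in>Poly_Mapping.keys P. if m = n + ?e then of_nat (Poly_Mapping.lookup m j) * Poly_Mapping.lookup P m else 0)"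
    unfolding mp_pderiv_def lookup_sum
  proof (rule sum.cong[OF refl])
    fix m
    show "Poly_Mapping.lookup (Poly_Mapping.single (m - ?e) (of_nat (Poly_Mapping.lookup m j) * Poly_Mapping.lookup P m)) n =
      (if m = n + ?e then of_nat (Poly_Mapping.lookup m j) * Poly_Mapping.lookup P m else 0)"
      using iff[of m] by (cases "Poly_Mapping.lookup m j = 0") (auto simp: lookup_single when_def lookup_add)
  qed
  then show ?thesis
    by (auto simp: lookup_add not_in_keys_iff_lookup_eq_zero)
qed

text \<open>
  Lowering the degree by differentiation: in characteristic zero a polynomial of positive degree has
  a nonzero partial derivative, so a relation of minimal degree would be a nonzero constant.
\<close>

lemma no_relation_if_closed_under_pderiv:
  fixes a :: "nat \<Rightarrow> 'x \<Rightarrow> 'k::field_char_0"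
  assumes ne: "Z \<noteq> {}"
    and closed: "\<And>P j. mp_vars P \<subseteq> {..<t} \<Longrightarrow> vanishes_on (\<lambda>x. mp_eval (\<lambda>i. a i x) P) Z \<Longrightarrow> j < t \<Longrightarrow>
      vanishes_on (\<lambda>x. mp_eval (\<lambda>i. a i x) (mp_pderiv j P)) Z"
    and P: "mp_vars P \<subseteq> {..<t}" "vanishes_on (\<lambda>x. mp_eval (\<lambda>i. a i x) P) Z"
  shows "P = 0"
proof -
  have const: "P = 0" if vars: "mp_vars P \<subseteq> {..<t}" and van: "vanishes_on (\<lambda>x. mp_eval (\<lambda>i. a i x) P) Z"
    and zero: "\<And>m j. m \<in> Poly_Mapping.keys P \<Longrightarrow> j < t \<Longrightarrow> Poly_Mapping.lookup m j = 0" for P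
  proof -
    have "Poly_Mapping.keys P \<subseteq> {0}"
    proof
      fix m assume m: "m \<in> Poly_Mapping.keys P"
      then have "Poly_Mapping.keys m \<subseteq> {..<t}" using vars by (auto simp: mp_vars_def)
      then have "m = 0" using zero[OF m]
        by (intro poly_mapping_eqI) (auto simp: not_in_keys_iff_lookup_eq_zero[symmetric])
      then show "m \<in> {0}" by simp
    qed
    then have ev: "mp_eval y P = Poly_Mapping.lookup P 0" for y :: "nat \<Rightarrow> 'k"
      by (simp add: mp_eval_superset[of "{0}"])
    obtain x where "x \<in> Z" using ne by auto
    then have "Poly_Mapping.lookup P 0 = 0" using van ev by (auto simp: vanishes_on_def)
    then show ?thesis
      using \<open>Poly_Mapping.keys P \<subseteq> {0}\<close>
      by (intro poly_mapping_eqI) (metis in_keys_iff lookup_zero singletonD subsetD)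
  qed
  have "P = 0" if "\<forall>m\<in>Poly_Mapping.keys P. (\<Sum>i<t. Poly_Mapping.lookup m i) \<le> n" "mp_vars P \<subseteq> {..<t}"
    "vanishes_on (\<lambda>x. mp_eval (\<lambda>i. a i x) P) Z" for n P
    using that
  proof (induction n arbitrary: P)
    case 0
    show ?case by (rule const) (use 0 in auto)
  next
    case (Suc n)
    have lookup0: "Poly_Mapping.lookup m j = 0" if m: "m \<in> Poly_Mapping.keys P" and j: "j < t" for m j
    proof (rule ccontr)
      assume nz: "Poly_Mapping.lookup m j \<noteq> 0"
      let ?e = "Poly_Mapping.single j (1::nat)"
      have keys: "k + ?e \<in> Poly_Mapping.keys P" if "k \<in> Poly_Mapping.keys (mp_pderiv j P)" for k
        using that by (auto simp: in_keys_iff lookup_mp_pderiv)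
      have "mp_pderiv j P = 0"
      proof (rule Suc.IH)
        show "\<forall>k\<in>Poly_Mapping.keys (mp_pderiv j P). (\<Sum>i<t. Poly_Mapping.lookup k i) \<le> n"
        proof
          fix k assume "k \<in> Poly_Mapping.keys (mp_pderiv j P)"
          then have "(\<Sum>i<t. Poly_Mapping.lookup (k + ?e) i) \<le> Suc n" using keys Suc.prems by blast
          moreover have "(\<Sum>i<t. Poly_Mapping.lookup (k + ?e) i) = Suc (\<Sum>i<t. Poly_Mapping.lookup k i)"
            using j by (simp add: lookup_add sum.distrib lookup_single when_def)
          ultimately show "(\<Sum>i<t. Poly_Mapping.lookup k i) \<le> n" by simp
        qed
        show "mp_vars (mp_pderiv j P) \<subseteq> {..<t}"
        proof
          fix i assume "i \<in> mp_vars (mp_pderiv j P)"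
          then obtain k where "k \<in> Poly_Mapping.keys (mp_pderiv j P)" "i \<in> Poly_Mapping.keys k"
            by (auto simp: mp_vars_def)
          then have "i \<in> mp_vars P" using keys[of k]
            by (auto simp: mp_vars_def in_keys_iff lookup_add intro!: bexI[of _ "k + ?e"])
          then show "i \<in> {..<t}" using Suc.prems by blast
        qed
        show "vanishes_on (\<lambda>x. mp_eval (\<lambda>i. a i x) (mp_pderiv j P)) Z"
          by (rule closed) (use Suc.prems j in auto)
      qed
      moreover have "m - ?e + ?e = m"
        using nz by (auto simp: poly_mapping_eq_iff fun_eq_iff lookup_add lookup_minus lookup_single when_def)
      then have "Poly_Mapping.lookup (mp_pderiv j P) (m - ?e) \<noteq> 0"
        using m by (simp add: lookup_mp_pderiv in_keys_iff del: of_nat_Suc)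
      ultimately show False by simp
    qed
    show ?case by (rule const) (use Suc.prems lookup0 in auto)
  qed
  moreover have "\<forall>m\<in>Poly_Mapping.keys P. (\<Sum>i<t. Poly_Mapping.lookup m i) \<le>
      Max ((\<lambda>m. \<Sum>i<t. Poly_Mapping.lookup m i) ` Poly_Mapping.keys P)"
    by simp
  ultimately show ?thesis using P by blast
qed

text \<open>
  The last variable can be cancelled from the relation until some monomials do not contain it; these
  form the relation that remains where \<open>a\<^sub>t\<close> vanishes.
\<close>

lemma relation_on_zero_set:
  fixes a :: "nat \<Rightarrow> 'x \<Rightarrow> 'k::field_char_0"
  assumes P: "P \<noteq> 0" "mp_vars P \<subseteq> {..<Suc t}" "vanishes_on (\<lambda>x. mp_eval (\<lambda>i. a i x) P) X"
    and cancel: "\<And>Q. vanishes_on (\<lambda>x. a t x * mp_eval (\<lambda>i. a i x) Q) X \<Longrightarrow> vanishes_on (\<lambda>x. mp_eval (\<lambda>i. a i x) Q) X"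
    and Z: "Z \<subseteq> X" "vanishes_on (a t) Z"
  shows "\<exists>R. R \<noteq> 0 \<and> mp_vars R \<subseteq> {..<t} \<and> vanishes_on (\<lambda>x. mp_eval (\<lambda>i. a i x) R) Z"
proof -
  have "\<exists>R. R \<noteq> 0 \<and> mp_vars R \<subseteq> {..<t} \<and> vanishes_on (\<lambda>x. mp_eval (\<lambda>i. a i x) R) Z"
    if "\<forall>m\<in>Poly_Mapping.keys P. Poly_Mapping.lookup m t \<le> n" "P \<noteq> 0" "mp_vars P \<subseteq> {..<Suc t}"
      "vanishes_on (\<lambda>x. mp_eval (\<lambda>i. a i x) P) X" for n P
    using that
  proof (induction n arbitrary: P)
    case 0
    have "mp_vars P \<subseteq> {..<t}"
    proof
      fix i assume i: "i \<in> mp_vars P"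
      then have "i \<noteq> t" using 0(1) by (auto simp: mp_vars_def in_keys_iff)
      then show "i \<in> {..<t}" using i 0(3) by auto
    qed
    then show ?case using 0 Z by (intro exI[of _ P]) (auto simp: vanishes_on_def)
  next
    case (Suc n)
    let ?e = "Poly_Mapping.single t (1::nat)"
    let ?s = "\<lambda>m. Poly_Mapping.single m (Poly_Mapping.lookup P m)"
    define K where "K = {m \<in> Poly_Mapping.keys P. Poly_Mapping.lookup m t = 0}"
    define L where "L = {m \<in> Poly_Mapping.keys P. Poly_Mapping.lookup m t \<noteq> 0}"
    define P0 where "P0 = (\<Sum>m\<in>K. ?s m)"
    define P1 where "P1 = (\<Sum>m\<in>L. Poly_Mapping.single (m - ?e) (Poly_Mapping.lookup P m))"
    have undo: "?e + (m - ?e) = m" if "m \<in> L" for m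
      using that by (auto simp: L_def poly_mapping_eq_iff fun_eq_iff lookup_add lookup_minus lookup_single when_def)
    have KL: "K \<union> L = Poly_Mapping.keys P" by (auto simp: K_def L_def)
    have "P = sum ?s (K \<union> L)"
      unfolding KL by (rule poly_mapping_sum_singles)
    also have "\<dots> = sum ?s K + sum ?s L"
      by (rule sum.union_disjoint) (auto simp: K_def L_def)
    also have "sum ?s L = Poly_Mapping.single ?e 1 * P1"
      by (simp add: P1_def sum_distrib_left mult_single undo[simplified])
    finally have split: "P = P0 + Poly_Mapping.single ?e 1 * P1" by (simp add: P0_def)
    have ev: "mp_eval y P = mp_eval y P0 + y t * mp_eval y P1" for y
      by (subst split) (simp add: mp_eval_add mp_eval_mult mp_eval_single)
    have keys_vars: "Poly_Mapping.keys m \<subseteq> {..<Suc t}" if "m \<in> Poly_Mapping.keys P" for m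
      using Suc.prems that by (auto simp: mp_vars_def)
    show ?case
    proof (cases "P0 = 0")
      case False
      have "mp_vars P0 \<subseteq> (\<Union>m\<in>K. Poly_Mapping.keys m)"
        unfolding P0_def by (rule order.trans[OF mp_vars_sum]) (intro UN_mono mp_vars_single order.refl)
      also have "\<dots> \<subseteq> {..<t}"
      proof
        fix i assume "i \<in> (\<Union>m\<in>K. Poly_Mapping.keys m)"
        then obtain m where m: "m \<in> K" "i \<in> Poly_Mapping.keys m" by auto
        then have "i \<noteq> t" by (auto simp: K_def in_keys_iff)
        moreover have "i < Suc t" using m keys_vars[of m] by (auto simp: K_def)
        ultimately show "i \<in> {..<t}" by auto
      qed
      finally have "mp_vars P0 \<subseteq> {..<t}" .
      moreover have "vanishes_on (\<lambda>x. mp_eval (\<lambda>i. a i x) P0) Z"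
        unfolding vanishes_on_def
      proof
        fix x assume "x \<in> Z"
        then show "mp_eval (\<lambda>i. a i x) P0 = 0"
          using ev[of "\<lambda>i. a i x"] Suc.prems(4) Z by (auto simp: vanishes_on_def)
      qed
      ultimately show ?thesis using False by blast
    next
      case True
      show ?thesis
      proof (rule Suc.IH)
        show "P1 \<noteq> 0" using split True Suc.prems by auto
        have keys1: "\<exists>m\<in>L. k = m - ?e" if "k \<in> Poly_Mapping.keys P1" for k
        proof -
          have "Poly_Mapping.keys P1 \<subseteq> (\<Union>m\<in>L. Poly_Mapping.keys (Poly_Mapping.single (m - ?e) (Poly_Mapping.lookup P m)))"
            unfolding P1_def by (rule Poly_Mapping.keys_sum)
          then show ?thesis using that by (auto split: if_splits)
        qed
        show "\<forall>m\<in>Poly_Mapping.keys P1. Poly_Mapping.lookup m t \<le> n"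
        proof
          fix k assume "k \<in> Poly_Mapping.keys P1"
          then obtain m where "m \<in> L" "k = m - ?e" using keys1 by blast
          then show "Poly_Mapping.lookup k t \<le> n"
            using Suc.prems(1) by (auto simp: L_def lookup_minus)
        qed
        show "mp_vars P1 \<subseteq> {..<Suc t}"
        proof
          fix i assume "i \<in> mp_vars P1"
          then obtain m where "m \<in> L" "i \<in> Poly_Mapping.keys (m - ?e)"
            using keys1 unfolding mp_vars_def by blast
          then have "i \<in> Poly_Mapping.keys m" "m \<in> Poly_Mapping.keys P"
            by (auto simp: L_def in_keys_iff lookup_minus)
          then show "i \<in> {..<Suc t}" using keys_vars by blast
        qed
        show "vanishes_on (\<lambda>x. mp_eval (\<lambda>i. a i x) P1) X"
          by (rule cancel) (use Suc.prems(4) ev True in \<open>simp add: vanishes_on_def\<close>)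
      qed
    qed
  qed
  moreover have "\<forall>m\<in>Poly_Mapping.keys P. Poly_Mapping.lookup m t \<le> Max ((\<lambda>m. Poly_Mapping.lookup m t) ` Poly_Mapping.keys P)"
    by simp
  ultimately show ?thesis using P by blast
qed

subsection \<open>Tangent spaces in a family\<close>

text \<open>
  The counterpart of \<^const>\<open>gradient\<close> for functions, which need not be given by a formal polynomial.
\<close>

definition grd :: "('k::field_char_0^'n \<Rightarrow> 'k) \<Rightarrow> 'k^'n \<Rightarrow> 'k^'n" where
  "grd F x = (\<chi> i. dd F x (axis i 1))"

lemma dd_grd: "F \<in> polyfun \<Longrightarrow> dd F x v = (\<Sum>i\<in>UNIV. grd F x $ i * v $ i)"
  by (subst dd_eq_coords) (simp_all add: grd_def)

lemma sum_axis: "(\<Sum>j\<in>UNIV. axis i 1 $ j * v $ j) = (v $ i :: 'k::comm_ring_1)"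
proof -
  have "(\<Sum>j\<in>UNIV. axis i 1 $ j * v $ j) = (\<Sum>j\<in>UNIV. if j = i then v $ j else 0)"
    by (rule sum.cong) (auto simp: axis_def)
  then show ?thesis by simp
qed

lemma polyfun_det:
  fixes M :: "'k::comm_ring_1^'n \<Rightarrow> 'k^'m^'m"
  assumes "\<And>i j. (\<lambda>x. M x $ i $ j) \<in> polyfun"
  shows "(\<lambda>x. det (M x)) \<in> polyfun"
  unfolding det_def by (intro polyfun_intros assms)

text \<open>
  Some Jacobian minor of maximal size does not vanish at \<open>x\<^sub>0\<close>; where it does not vanish, the
  coordinates in \<open>I\<close>, complementary to that minor, determine tangent vectors.
\<close>

lemma tangent_chart_rank:
  fixes X :: "('k::field_char_0^'n) set" and x\<^sub>0 :: "'k^'n"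
  obtains \<Delta> and I :: "'n set" where "\<Delta> \<in> polyfun" "\<Delta> x\<^sub>0 \<noteq> 0" "card I = vec.dim (tangent_space X x\<^sub>0)"
    "\<And>x v. \<Delta> x \<noteq> 0 \<Longrightarrow> v \<in> tangent_space X x \<Longrightarrow> (\<And>i. i \<in> I \<Longrightarrow> v $ i = 0) \<Longrightarrow> v = 0"
    "card I + vec.dim {grd F x\<^sub>0 | F. F \<in> polyfun \<and> vanishes_on F X} = CARD('n)"
proof -
  define V where "V = {grd F x\<^sub>0 | F. F \<in> polyfun \<and> vanishes_on F X}"
  obtain B where B: "B \<subseteq> V" "vec.independent B" "V \<subseteq> vec.span B" "card B = vec.dim V"
    using vec.basis_exists[of V] by metis
  define W where "W = B \<union> range (\<lambda>i::'n. axis i (1::'k))"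
  obtain C where C: "B \<subseteq> C" "C \<subseteq> W" "vec.independent C" "W \<subseteq> vec.span C"
    using vec.maximal_independent_subset_extend[of B W] B(2) by (auto simp: W_def)
  have "cart_basis \<subseteq> vec.span C"
    using C(4) by (auto simp: W_def cart_basis_def)
  then have spanC: "vec.span C = UNIV"
    by (metis vec.span_Basis vec.span_minimal vec.subspace_span top.extremum_uniqueI)
  have finC: "finite C" using C(3) by (rule vec.finiteI_independent)
  have "card C = vec.dim (vec.span C)" using C(3) by (simp add: vec.dim_eq_card_independent)
  then have "card C = CARD('n)" unfolding spanC vec_dim_card .
  then obtain e :: "'n \<Rightarrow> 'k^'n" where e: "bij_betw e UNIV C"
    using finC by (metis bij_betw_iff_card finite_class.finite_UNIV)
  define G where "G b = (SOME F. F \<in> polyfun \<and> vanishes_on F X \<and> grd F x\<^sub>0 = b)" for b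
  have G: "G b \<in> polyfun \<and> vanishes_on (G b) X \<and> grd (G b) x\<^sub>0 = b" if "b \<in> B" for b
  proof -
    have "\<exists>F. F \<in> polyfun \<and> vanishes_on F X \<and> grd F x\<^sub>0 = b"
      using that B(1) unfolding V_def by blast
    then show ?thesis unfolding G_def by (rule someI_ex)
  qed
  define M where "M x = (\<chi> j. if e j \<in> B then grd (G (e j)) x else e j)" for x
  define J where "J = {j. e j \<notin> B}"
  have ax: "\<exists>i. e j = axis i 1" if "j \<in> J" for j
    using that C(2) bij_betwE[OF e] by (auto simp: J_def W_def)
  define ix where "ix j = (SOME i. e j = axis i 1)" for j
  have ix: "e j = axis (ix j) 1" if "j \<in> J" for j
    unfolding ix_def by (rule someI_ex) (rule ax[OF that])
  define I where "I = ix ` J"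
  have "inj_on ix J"
    using e ix by (metis bij_betw_def inj_onI inj_onD UNIV_I)
  then have cardI: "card I = card J" by (simp add: I_def card_image)
  have "bij_betw e {j. e j \<in> B} B"
    using e C(1) by (auto simp: bij_betw_def inj_on_def)
  then have "card {j. e j \<in> B} = vec.dim V"
    using B(4) by (simp add: bij_betw_same_card)
  moreover have "card (J \<union> {j. e j \<in> B}) = card J + card {j. e j \<in> B}"
    by (rule card_Un_disjoint) (auto simp: J_def)
  moreover have "J \<union> {j. e j \<in> B} = UNIV" by (auto simp: J_def)
  ultimately have cardIV: "card I + vec.dim V = CARD('n)" by (simp add: cardI)
  have Mv: "(M x *v v) $ j = (if e j \<in> B then dd (G (e j)) x v else v $ ix j)" for x v j
  proof (cases "e j \<in> B")
    case True
    then show ?thesis using G[of "e j"] by (simp add: matrix_vector_mult_def M_def dd_grd)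
  next
    case False
    then have "(M x *v v) $ j = (\<Sum>i\<in>UNIV. axis (ix j) 1 $ i * v $ i)"
      using ix[of j] by (simp add: matrix_vector_mult_def M_def J_def)
    then show ?thesis using False by (simp add: sum_axis)
  qed
  have M0: "M x\<^sub>0 $ j = e j" for j using G[of "e j"] by (simp add: M_def)
  have "rows (M x\<^sub>0) = C"
    using e by (auto simp: rows_def row_def M0 bij_betw_def vec_lambda_eta)
  then have "\<exists>N. N ** M x\<^sub>0 = mat 1"
    using matrix_left_invertible_span_rows_gen[of "M x\<^sub>0"] spanC by simp
  then have inv0: "invertible (M x\<^sub>0)" by (simp add: invertible_left_inverse)
  have inj: "v = 0" if "det (M x) \<noteq> 0" "M x *v v = 0" for x v
    using that by (metis invertible_det_nz invertible_left_inverse matrix_left_invertible_ker)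
  show thesis
  proof
    show "card I + vec.dim {grd F x\<^sub>0 | F. F \<in> polyfun \<and> vanishes_on F X} = CARD('n)"
      using cardIV by (simp add: V_def)
    show "(\<lambda>x. det (M x)) \<in> polyfun"
    proof (rule polyfun_det)
      fix i j show "(\<lambda>x. M x $ i $ j) \<in> polyfun"
        using G[of "e i"]
        by (cases "e i \<in> B") (simp_all add: M_def polyfun_const grd_def dd_polyfun_point)
    qed
    show "det (M x\<^sub>0) \<noteq> 0" using inv0 by (simp add: invertible_det_nz)
    show "v = 0" if "det (M x) \<noteq> 0" "v \<in> tangent_space X x" "\<And>i. i \<in> I \<Longrightarrow> v $ i = 0" for x v
    proof (rule inj[OF that(1)])
      have "(M x *v v) $ j = 0" for j
        using that(2,3) G[of "e j"] by (auto simp: Mv tangent_space_iff vanishes_on_def I_def J_def)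
      then show "M x *v v = 0" by (simp add: vec_eq_iff)
    qed
    have "(*v) (M x\<^sub>0) ` tangent_space X x\<^sub>0 = {y. \<forall>i. i \<notin> J \<longrightarrow> y $ i = 0}"
    proof (intro equalityI subsetI)
      fix y assume "y \<in> (*v) (M x\<^sub>0) ` tangent_space X x\<^sub>0"
      then show "y \<in> {y. \<forall>i. i \<notin> J \<longrightarrow> y $ i = 0}"
        using G by (auto simp: Mv J_def tangent_space_iff vanishes_on_def)
    next
      fix y :: "'k^'n" assume y: "y \<in> {y. \<forall>i. i \<notin> J \<longrightarrow> y $ i = 0}"
      obtain N where N: "M x\<^sub>0 ** N = mat 1"
        using inv0 by (auto simp: invertible_right_inverse)
      define v where "v = N *v y"
      have Mvy: "M x\<^sub>0 *v v = y" by (simp add: v_def matrix_vector_mul_assoc N)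
      have perpB: "(\<Sum>i\<in>UNIV. b $ i * v $ i) = 0" if b: "b \<in> B" for b
      proof -
        obtain j where j: "b = e j" using b C(1) e by (auto simp: bij_betw_def)
        then have "(M x\<^sub>0 *v v) $ j = 0" using y b by (simp add: Mvy J_def)
        then have "dd (G b) x\<^sub>0 v = 0" using b by (simp add: Mv j)
        then show ?thesis using G[OF b] by (simp add: dd_grd)
      qed
      have perp: "(\<Sum>i\<in>UNIV. b $ i * v $ i) = 0" if "b \<in> vec.span B" for b
        using that
        by (induction rule: vec.span_induct_alt)
          (simp_all add: distrib_right sum.distrib perpB mult.assoc flip: sum_distrib_left)
      have "v \<in> tangent_space X x\<^sub>0"
        unfolding tangent_space_iff
      proof (intro ballI impI)
        fix F assume "F \<in> polyfun" "\<forall>x\<in>X. F x = 0"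
        then have "grd F x\<^sub>0 \<in> vec.span B" using B(3) by (auto simp: V_def vanishes_on_def)
        then show "dd F x\<^sub>0 v = 0" using perp \<open>F \<in> polyfun\<close> by (simp add: dd_grd)
      qed
      then show "y \<in> (*v) (M x\<^sub>0) ` tangent_space X x\<^sub>0" using Mvy by blast
    qed
    then have "vec.dim ((*v) (M x\<^sub>0) ` tangent_space X x\<^sub>0) = card J"
      by (simp add: dim_substandard_cart)
    moreover have "vec.dim ((*v) (M x\<^sub>0) ` tangent_space X x\<^sub>0) = vec.dim (tangent_space X x\<^sub>0)"
    proof (rule vec.dim_image_eq)
      show "Vector_Spaces.linear (*s) (*s) ((*v) (M x\<^sub>0))" by (rule matrix_vector_mul_linear_gen)
      show "inj_on ((*v) (M x\<^sub>0)) (vec.span (tangent_space X x\<^sub>0))"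
        using inv0 by (metis inj_on_subset invertible_left_inverse matrix_left_invertible_injective subset_UNIV)
    qed
    ultimately show "card I = vec.dim (tangent_space X x\<^sub>0)" using cardI by simp
  qed
qed

lemma tangent_chart:
  fixes X :: "('k::field_char_0^'n) set" and x\<^sub>0 :: "'k^'n"
  obtains \<Delta> and I :: "'n set" where "\<Delta> \<in> polyfun" "\<Delta> x\<^sub>0 \<noteq> 0" "card I = vec.dim (tangent_space X x\<^sub>0)"
    "\<And>x v. \<Delta> x \<noteq> 0 \<Longrightarrow> v \<in> tangent_space X x \<Longrightarrow> (\<And>i. i \<in> I \<Longrightarrow> v $ i = 0) \<Longrightarrow> v = 0"
proof -
  obtain \<Delta> and I :: "'n set" where A: "\<Delta> \<in> polyfun" "\<Delta> x\<^sub>0 \<noteq> 0" "card I = vec.dim (tangent_space X x\<^sub>0)"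
    and inj: "\<And>x v. \<Delta> x \<noteq> 0 \<Longrightarrow> v \<in> tangent_space X x \<Longrightarrow> (\<And>i. i \<in> I \<Longrightarrow> v $ i = 0) \<Longrightarrow> v = 0"
    and "card I + vec.dim {grd F x\<^sub>0 | F. F \<in> polyfun \<and> vanishes_on F X} = CARD('n)"
    using tangent_chart_rank[of x\<^sub>0 X] by blast
  show thesis by (rule that[OF A inj])
qed

lemma
  fixes T :: "('k::field^'n) set" and I :: "'n set"
  assumes T: "vec.subspace T" and inj: "\<And>v. v \<in> T \<Longrightarrow> (\<And>i. i \<in> I \<Longrightarrow> v $ i = 0) \<Longrightarrow> v = 0"
  shows dim_le_card_if_coords_inj: "vec.dim T \<le> card I"
    and coords_surj_if_dim_eq: "card I \<le> vec.dim T \<Longrightarrow> \<exists>v\<in>T. \<forall>i\<in>I. v $ i = y i"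
proof -
  define \<pi> :: "'k^'n \<Rightarrow> 'k^'n" where "\<pi> v = (\<chi> i. if i \<in> I then v $ i else 0)" for v
  have lin: "Vector_Spaces.linear (*s) (*s) \<pi>"
    by unfold_locales (auto simp: \<pi>_def vec_eq_iff algebra_simps)
  interpret lin: Vector_Spaces.linear "(*s)" "(*s)" \<pi> by (rule lin)
  let ?S = "{y :: 'k^'n. \<forall>i. i \<notin> I \<longrightarrow> y $ i = 0}"
  have sub: "\<pi> ` T \<subseteq> ?S" by (auto simp: \<pi>_def)
  have "inj_on \<pi> T"
  proof (rule inj_onI)
    fix v w assume vw: "v \<in> T" "w \<in> T" "\<pi> v = \<pi> w"
    have "v - w = 0"
      by (rule inj) (use vw vec.subspace_diff[OF T] in \<open>auto simp: \<pi>_def vec_eq_iff split: if_splits\<close>)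
    then show "v = w" by simp
  qed
  then have dim: "vec.dim (\<pi> ` T) = vec.dim T"
    by (intro vec.dim_image_eq lin) (simp add: vec.span_eq_iff[THEN iffD2, OF T])
  have dS: "vec.dim ?S = card I" by (rule dim_substandard_cart)
  show "vec.dim T \<le> card I"
    using vec.dim_subset[OF sub] by (simp add: dim dS)
  show "\<exists>v\<in>T. \<forall>i\<in>I. v $ i = y i" if "card I \<le> vec.dim T"
  proof -
    have "\<pi> ` T = ?S"
    proof (rule vec.subspace_dim_equal)
      show "vec.subspace (\<pi> ` T)" by (rule lin.subspace_image[OF T])
      show "vec.subspace ?S" by (auto simp: vec.subspace_def)
    qed (use sub that dim dS in auto)
    moreover have "(\<chi> i. if i \<in> I then y i else 0) \<in> ?S" by simp
    ultimately obtain v where v: "v \<in> T" "(\<chi> i. if i \<in> I then y i else 0) = \<pi> v" by blast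
    then have "v $ i = y i" if "i \<in> I" for i
      using that by (auto simp: \<pi>_def vec_eq_iff split: if_splits)
    then show ?thesis using v by blast
  qed
qed

lemma card_le_dim_if_coords_surj:
  fixes T :: "('k::field^'n) set" and I :: "'n set"
  assumes "\<And>y. \<exists>v\<in>T. \<forall>i\<in>I. v $ i = y i"
  shows "card I \<le> vec.dim T"
proof -
  define \<pi> :: "'k^'n \<Rightarrow> 'k^'n" where "\<pi> v = (\<chi> i. if i \<in> I then v $ i else 0)" for v
  have lin: "Vector_Spaces.linear (*s) (*s) \<pi>"
    by unfold_locales (auto simp: \<pi>_def vec_eq_iff algebra_simps)
  have "{y :: 'k^'n. \<forall>i. i \<notin> I \<longrightarrow> y $ i = 0} \<subseteq> \<pi> ` T"
  proof
    fix y :: "'k^'n" assume y: "y \<in> {y. \<forall>i. i \<notin> I \<longrightarrow> y $ i = 0}"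
    obtain v where "v \<in> T" "\<forall>i\<in>I. v $ i = y $ i" using assms[of "($) y"] by blast
    then show "y \<in> \<pi> ` T" using y by (intro image_eqI[of _ _ v]) (auto simp: \<pi>_def vec_eq_iff)
  qed
  then have "vec.dim {y :: 'k^'n. \<forall>i. i \<notin> I \<longrightarrow> y $ i = 0} \<le> vec.dim (\<pi> ` T)"
    by (rule vec.dim_subset)
  then have "card I \<le> vec.dim (\<pi> ` T)" by (simp add: dim_substandard_cart)
  also have "\<dots> \<le> vec.dim T" by (rule vec.dim_image_le[OF lin])
  finally show ?thesis .
qed

subsection \<open>Generic tangent vectors\<close>

lemma zariski_closed_zero_set: "F \<in> polyfun \<Longrightarrow> zariski_closed {x. F x = 0}"
  unfolding zariski_closed_def by (erule polyfunE) (rule exI[of _ "{_}"], auto)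

lemma irreducible_prime:
  assumes "zariski_irreducible X" "F \<in> polyfun" "G \<in> polyfun" "vanishes_on (\<lambda>x. F x * G x) X"
  shows "vanishes_on F X \<or> vanishes_on G X"
proof -
  have "X \<subseteq> {x. F x = 0} \<union> {x. G x = 0}" using assms(4) by (auto simp: vanishes_on_def)
  then have "X \<subseteq> {x. F x = 0} \<or> X \<subseteq> {x. G x = 0}"
    using assms(1) zariski_closed_zero_set[OF assms(2)] zariski_closed_zero_set[OF assms(3)]
    unfolding zariski_irreducible_def by blast
  then show ?thesis by (auto simp: vanishes_on_def)
qed

lemma coord_ring_lift:
  assumes "a \<in> coord_ring X"
  obtains F where "F \<in> polyfun" "\<And>x. x \<in> X \<Longrightarrow> a x = F x"
proof -
  obtain P where "a = regular_function X P" using assms by (auto simp: coord_ring_def)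
  then show thesis by (intro that[OF polyfun_mp_eval[of P]]) (simp add: regular_function_def)
qed

lemma coord_ring_restrict:
  "F \<in> polyfun \<Longrightarrow> (\<lambda>x. if x \<in> X then F x else 0) \<in> coord_ring X"
  unfolding coord_ring_def by (erule polyfunE) (auto simp: regular_function_def fun_eq_iff)

lemma coord_ring_outside: "a \<in> coord_ring X \<Longrightarrow> x \<notin> X \<Longrightarrow> a x = 0"
  by (auto simp: coord_ring_def regular_function_def)

lemma mp_vars_diff: "mp_vars (P - Q) \<subseteq> mp_vars P \<union> mp_vars Q"
proof -
  have "Poly_Mapping.keys (P - Q) \<subseteq> Poly_Mapping.keys P \<union> Poly_Mapping.keys Q"
    by (auto simp: in_keys_iff lookup_minus)
  then show ?thesis by (auto simp: mp_vars_def)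
qed

lemma subalg_pcurve: "subalg {c. pcurve c}"
  by (auto simp: subalg_def pcurve_const pcurve_add pcurve_mult)

lemma mp_eval_cong: "(\<And>i. i \<in> mp_vars P \<Longrightarrow> x i = y i) \<Longrightarrow> mp_eval x P = mp_eval y P"
  unfolding mp_eval_def mp_vars_def
  by (intro sum.cong refl arg_cong2[where f = "(*)"] arg_cong2[where f = "(^)"] prod.cong) auto

text \<open>
  The differentials of algebraically independent functions are linearly independent at a general
  point. Prescribe the values of a derivation on the \<open>a\<^sub>i\<close>, and extend it from the algebra they
  generate by adjoining the coordinates one by one; on all polynomials, a point derivation that
  respects the equations of \<open>X\<close> is a tangent vector.
\<close>

lemma generic_tangent_vectors:
  fixes X :: "('k::field_char_0^'n) set" and a :: "nat \<Rightarrow> 'k^'n \<Rightarrow> 'k"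
  assumes X: "zariski_irreducible X" and a: "\<And>i. i < d \<Longrightarrow> a i \<in> polyfun"
    and indep: "\<And>P. mp_vars P \<subseteq> {..<d} \<Longrightarrow> vanishes_on (\<lambda>x. mp_eval (\<lambda>i. a i x) P) X \<Longrightarrow> P = 0"
  shows "\<exists>s\<in>polyfun. \<not> vanishes_on s X \<and>
    (\<forall>x\<in>X. s x \<noteq> 0 \<longrightarrow> (\<forall>w. \<exists>v\<in>tangent_space X x. \<forall>i<d. dd (a i) x v = w i))"
proof -
  have X0: "X \<noteq> {}" using X by (simp add: zariski_irreducible_def)
  define fn where "fn P x = mp_eval (\<lambda>i. a i x) P" for P x
  define A0 where "A0 = fn ` {P. mp_vars P \<subseteq> {..<d}}"
  have A0: "subalg A0"
    unfolding subalg_def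
  proof (intro conjI allI ballI)
    fix c show "(\<lambda>_. c) \<in> A0"
      unfolding A0_def by (rule image_eqI[of _ _ "Poly_Mapping.single 0 c"])
        (use mp_vars_single[of 0 c] in \<open>auto simp: fn_def mp_eval_single\<close>)
  next
    fix F G assume "F \<in> A0" "G \<in> A0"
    then obtain P Q where PQ: "mp_vars P \<subseteq> {..<d}" "mp_vars Q \<subseteq> {..<d}" "F = fn P" "G = fn Q"
      by (auto simp: A0_def)
    show "(\<lambda>x. F x + G x) \<in> A0"
      unfolding A0_def by (rule image_eqI[of _ _ "P + Q"])
        (use PQ mp_vars_add[of P Q] in \<open>auto simp: fn_def mp_eval_add fun_eq_iff\<close>)
    show "(\<lambda>x. F x * G x) \<in> A0"
      unfolding A0_def by (rule image_eqI[of _ _ "P * Q"])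
        (use PQ mp_vars_mult[of P Q] in \<open>auto simp: fn_def mp_eval_mult fun_eq_iff\<close>)
  qed
  have A0_poly: "A0 \<subseteq> polyfun"
    unfolding A0_def fn_def using subalg_mp_eval[OF subalg_polyfun, of _ a] a by blast
  have aA0: "a i \<in> A0" if "i < d" for i
    unfolding A0_def by (rule image_eqI[of _ _ "Poly_Mapping.single (Poly_Mapping.single i 1) 1"])
      (use that mp_vars_single[of "Poly_Mapping.single i 1" 1] in \<open>auto simp: fn_def mp_eval_single fun_eq_iff\<close>)
  have base: "\<exists>D. point_derivation A0 x D \<and> (\<forall>F\<in>A0. vanishes_on F X \<longrightarrow> D F = 0) \<and> (\<forall>i<d. D (a i) = w i)"
    for x and w :: "nat \<Rightarrow> 'k"
  proof -
    define e where "e P = deriv_at_0 (\<lambda>s. mp_eval (\<lambda>i. a i x + s * w i) P)" for P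
    define D where "D F = e (SOME P. mp_vars P \<subseteq> {..<d} \<and> fn P = F)" for F
    have pc: "pcurve (\<lambda>s. mp_eval (\<lambda>i. a i x + s * w i) P)" for P
      using subalg_mp_eval[OF subalg_pcurve, of P "\<lambda>i s. a i x + s * w i"]
      by (simp add: pcurve_add pcurve_mult pcurve_const pcurve_id)
    have D: "D (fn P) = e P" if P: "mp_vars P \<subseteq> {..<d}" for P
    proof -
      let ?Q = "SOME Q. mp_vars Q \<subseteq> {..<d} \<and> fn Q = fn P"
      have Q: "mp_vars ?Q \<subseteq> {..<d} \<and> fn ?Q = fn P" by (rule someI_ex) (use P in auto)
      have "?Q - P = 0"
      proof (rule indep)
        show "mp_vars (?Q - P) \<subseteq> {..<d}" using mp_vars_diff[of ?Q P] P Q by auto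
        show "vanishes_on (\<lambda>x. mp_eval (\<lambda>i. a i x) (?Q - P)) X"
          using Q by (auto simp: vanishes_on_def mp_eval_diff fn_def fun_eq_iff)
      qed
      then show ?thesis by (simp add: D_def)
    qed
    have e_var: "e (Poly_Mapping.single (Poly_Mapping.single i 1) 1) = w i" for i
    proof -
      have "e (Poly_Mapping.single (Poly_Mapping.single i 1) 1) = coeff [:a i x, w i:] 1"
        unfolding e_def by (rule deriv_at_0_eq) (simp add: mp_eval_single)
      then show ?thesis by simp
    qed
    show ?thesis
    proof (intro exI[of _ D] conjI ballI impI allI)
      show "point_derivation A0 x D"
        unfolding point_derivation_def
      proof (intro conjI allI ballI)
        fix c
        have eq: "(\<lambda>_. c) = fn (Poly_Mapping.single 0 c)" by (simp add: fn_def mp_eval_single fun_eq_iff)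
        show "D (\<lambda>_. c) = 0"
          unfolding eq by (subst D) (use mp_vars_single[of 0 c] in \<open>auto simp: e_def mp_eval_single\<close>)
      next
        fix F G assume "F \<in> A0" "G \<in> A0"
        then obtain P Q where PQ: "mp_vars P \<subseteq> {..<d}" "mp_vars Q \<subseteq> {..<d}" "F = fn P" "G = fn Q"
          by (auto simp: A0_def)
        have eq: "(\<lambda>y. F y + G y) = fn (P + Q)" "(\<lambda>y. F y * G y) = fn (P * Q)"
          by (simp_all add: PQ fn_def mp_eval_add mp_eval_mult fun_eq_iff)
        have v: "mp_vars (P + Q) \<subseteq> {..<d}" "mp_vars (P * Q) \<subseteq> {..<d}"
          using PQ mp_vars_add[of P Q] mp_vars_mult[of P Q] by auto
        show "D (\<lambda>y. F y + G y) = D F + D G"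
          unfolding eq D[OF v(1)] using deriv_at_0_add[OF pc[of P] pc[of Q]]
          by (simp add: PQ D e_def mp_eval_add)
        show "D (\<lambda>y. F y * G y) = F x * D G + G x * D F"
          unfolding eq D[OF v(2)] using deriv_at_0_mult[OF pc[of P] pc[of Q]]
          by (simp add: PQ D e_def mp_eval_mult fn_def)
      qed
      show "D F = 0" if F: "F \<in> A0" "vanishes_on F X" for F
      proof -
        obtain P where P: "mp_vars P \<subseteq> {..<d}" "F = fn P" using F by (auto simp: A0_def)
        then have "P = 0" using F by (intro indep) (auto simp: fn_def vanishes_on_def)
        then show ?thesis using P by (simp add: D e_def)
      qed
      show "D (a i) = w i" if "i < d" for i
      proof -
        have "a i = fn (Poly_Mapping.single (Poly_Mapping.single i 1) 1)"
          by (simp add: fn_def mp_eval_single fun_eq_iff)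
        then show ?thesis
          using D[OF order.trans[OF mp_vars_single]] e_var[of i] that by simp
      qed
    qed
  qed
  have "\<exists>A s. subalg A \<and> A0 \<subseteq> A \<and> A \<subseteq> polyfun \<and> (\<forall>i\<in>S. (\<lambda>x. x $ i) \<in> A) \<and> s \<in> polyfun \<and> \<not> vanishes_on s X \<and>
      (\<forall>x\<in>X. s x \<noteq> 0 \<longrightarrow> (\<forall>w. \<exists>D. point_derivation A x D \<and> (\<forall>F\<in>A. vanishes_on F X \<longrightarrow> D F = 0) \<and> (\<forall>i<d. D (a i) = w i)))"
    if "finite S" for S :: "'n set"
    using that
  proof induction
    case empty
    have "(\<lambda>_. 1) \<in> polyfun" "\<not> vanishes_on (\<lambda>_. 1 :: 'k) X"
      using X0 by (auto simp: vanishes_on_def polyfun_const)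
    then show ?case using A0 A0_poly base by blast
  next
    case (insert i S)
    then obtain A s where A: "subalg A" "A0 \<subseteq> A" "A \<subseteq> polyfun" "\<forall>i\<in>S. (\<lambda>x. x $ i) \<in> A"
      and s: "s \<in> polyfun" "\<not> vanishes_on s X"
      and ex: "\<And>x w. x \<in> X \<Longrightarrow> s x \<noteq> 0 \<Longrightarrow> \<exists>D. point_derivation A x D \<and>
        (\<forall>F\<in>A. vanishes_on F X \<longrightarrow> D F = 0) \<and> (\<forall>i<d. D (a i) = w i)"
      by blast
    let ?z = "\<lambda>x :: 'k^'n. x $ i"
    let ?A = "(\<lambda>P. poly P ?z) ` coeffs_in A"
    have "\<exists>t\<in>polyfun. \<not> vanishes_on t X \<and> (\<forall>x\<in>X. t x \<noteq> 0 \<longrightarrow> (\<forall>D. point_derivation A x D \<and>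
        (\<forall>F\<in>A. vanishes_on F X \<longrightarrow> D F = 0) \<longrightarrow> (\<exists>D'. point_derivation ?A x D' \<and>
          (\<forall>F\<in>?A. vanishes_on F X \<longrightarrow> D' F = 0) \<and> (\<forall>F\<in>A. D' F = D F))))"
      by (rule extend_point_derivation[OF A(1) subalg_polyfun A(3) polyfun_coord _ X0])
        (rule irreducible_prime[OF X])
    then obtain t where t: "t \<in> polyfun" "\<not> vanishes_on t X"
      and ext: "\<forall>x\<in>X. t x \<noteq> 0 \<longrightarrow> (\<forall>D. point_derivation A x D \<and>
        (\<forall>F\<in>A. vanishes_on F X \<longrightarrow> D F = 0) \<longrightarrow> (\<exists>D'. point_derivation ?A x D' \<and>
          (\<forall>F\<in>?A. vanishes_on F X \<longrightarrow> D' F = 0) \<and> (\<forall>F\<in>A. D' F = D F)))"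
      by (elim bexE conjE) (rule that; assumption)
    show ?case
    proof (intro exI[of _ ?A] exI[of _ "\<lambda>x. s x * t x"] conjI ballI impI allI)
      show "subalg ?A" by (rule subalg_adjoin[OF A(1)])
      show "A0 \<subseteq> ?A" using A(2) adjoin_superset[OF A(1)] by blast
      show "?A \<subseteq> polyfun"
        using poly_in_subalg[OF subalg_polyfun _ polyfun_coord] A(3) by (auto simp: coeffs_in_def)
      show "(\<lambda>x. x $ j) \<in> ?A" if "j \<in> insert i S" for j
        using that adjoin_generator[OF A(1)] adjoin_superset[OF A(1)] A(4) by blast
      show "(\<lambda>x. s x * t x) \<in> polyfun" by (rule polyfun_mult[OF s(1) t(1)])
      show "\<not> vanishes_on (\<lambda>x. s x * t x) X" using irreducible_prime[OF X s(1) t(1)] s t by blast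
      fix x w assume x: "x \<in> X" "s x * t x \<noteq> 0"
      obtain D where D: "point_derivation A x D" "\<forall>F\<in>A. vanishes_on F X \<longrightarrow> D F = 0" "\<forall>i<d. D (a i) = w i"
        using ex[of x w] x by auto
      obtain D' where D': "point_derivation ?A x D'" "\<forall>F\<in>?A. vanishes_on F X \<longrightarrow> D' F = 0" "\<forall>F\<in>A. D' F = D F"
        using ext[rule_format, OF x(1) _ conjI[OF D(1,2)]] x by auto
      moreover have "D' (a i) = w i" if "i < d" for i
        using D(3) D'(3) A(2) aA0[OF that] that by (metis subsetD)
      ultimately show "\<exists>D. point_derivation ?A x D \<and> (\<forall>F\<in>?A. vanishes_on F X \<longrightarrow> D F = 0) \<and> (\<forall>i<d. D (a i) = w i)"
        by blast
    qed
  qed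
  from this[OF finite_class.finite_UNIV] obtain A s where A: "subalg A" "A \<subseteq> polyfun" "\<And>i. (\<lambda>x. x $ i) \<in> A"
      and s: "s \<in> polyfun" "\<not> vanishes_on s X"
      and ex: "\<And>x w. x \<in> X \<Longrightarrow> s x \<noteq> 0 \<Longrightarrow> \<exists>D. point_derivation A x D \<and>
        (\<forall>F\<in>A. vanishes_on F X \<longrightarrow> D F = 0) \<and> (\<forall>i<d. D (a i) = w i)"
    by blast
  have "F \<in> A" if "F \<in> polyfun" for F
    using that by induction (auto intro: A(3) subalg_const[OF A(1)] subalg_add[OF A(1)] subalg_mult[OF A(1)])
  then have eqA: "A = polyfun" using A(2) by auto
  show ?thesis
  proof (intro bexI[of _ s] conjI ballI impI allI)
    fix x w assume "x \<in> X" "s x \<noteq> 0"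
    then obtain D where D: "point_derivation polyfun x D" "\<And>F. F \<in> polyfun \<Longrightarrow> vanishes_on F X \<Longrightarrow> D F = 0"
        "\<And>i. i < d \<Longrightarrow> D (a i) = w i"
      using ex[of x w] unfolding eqA by blast
    let ?v = "\<chi> i. D (\<lambda>x. x $ i)"
    have "D F = dd F x ?v" if "F \<in> polyfun" for F by (rule point_derivation_polyfun[OF D(1) that])
    then have "?v \<in> tangent_space X x" "\<forall>i<d. dd (a i) x ?v = w i"
      using D(2,3) a by (auto simp: tangent_space_iff vanishes_on_def)
    then show "\<exists>v\<in>tangent_space X x. \<forall>i<d. dd (a i) x v = w i" by blast
  qed (use s in auto)
qed

text \<open>
  A general point lies in the chart around \<open>x\<^sub>0\<close>, where tangent spaces are not larger than at \<open>x\<^sub>0\<close>, and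
  there the differentials of the \<open>a\<^sub>i\<close> have a dual family of tangent vectors.
\<close>

lemma card_le_dim_tangent_space:
  fixes X :: "('k::field_char_0^'n) set" and a :: "nat \<Rightarrow> 'k^'n \<Rightarrow> 'k"
  assumes X: "zariski_irreducible X" and a: "\<And>i. i < d \<Longrightarrow> a i \<in> coord_ring X"
    and indep: "algebraically_independent X d a" and x\<^sub>0: "x\<^sub>0 \<in> X"
  shows "d \<le> vec.dim (tangent_space X x\<^sub>0)"
proof -
  define a' where "a' i = (SOME F. F \<in> polyfun \<and> (\<forall>x\<in>X. a i x = F x))" for i
  have a': "a' i \<in> polyfun \<and> (\<forall>x\<in>X. a i x = a' i x)" if i: "i < d" for i
  proof -
    obtain F where "F \<in> polyfun" "\<And>x. x \<in> X \<Longrightarrow> a i x = F x"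
      using coord_ring_lift[OF a[OF i]] by metis
    then have "\<exists>F. F \<in> polyfun \<and> (\<forall>x\<in>X. a i x = F x)" by blast
    then show ?thesis unfolding a'_def by (rule someI_ex)
  qed
  have ev: "mp_eval (\<lambda>i. a i x) P = mp_eval (\<lambda>i. a' i x) P" if "x \<in> X" "mp_vars P \<subseteq> {..<d}" for x P
    by (rule mp_eval_cong) (use that a' in auto)
  have "P = 0" if "mp_vars P \<subseteq> {..<d}" "vanishes_on (\<lambda>x. mp_eval (\<lambda>i. a' i x) P) X" for P
    using indep that ev by (auto simp: algebraically_independent_def vanishes_on_def)
  then have "\<exists>s\<in>polyfun. \<not> vanishes_on s X \<and>
    (\<forall>x\<in>X. s x \<noteq> 0 \<longrightarrow> (\<forall>w. \<exists>v\<in>tangent_space X x. \<forall>i<d. dd (a' i) x v = w i))"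
    by (intro generic_tangent_vectors[OF X conjunct1[OF a']]) auto
  then obtain s where s: "s \<in> polyfun" "\<not> vanishes_on s X"
    and ex: "\<forall>x\<in>X. s x \<noteq> 0 \<longrightarrow> (\<forall>w. \<exists>v\<in>tangent_space X x. \<forall>i<d. dd (a' i) x v = w i)"
    by (elim bexE conjE) (rule that; assumption)
  obtain \<Delta> and I :: "'n set" where \<Delta>: "\<Delta> \<in> polyfun" "\<Delta> x\<^sub>0 \<noteq> 0" and I: "card I = vec.dim (tangent_space X x\<^sub>0)"
    and inj: "\<And>x v. \<Delta> x \<noteq> 0 \<Longrightarrow> v \<in> tangent_space X x \<Longrightarrow> (\<And>i. i \<in> I \<Longrightarrow> v $ i = 0) \<Longrightarrow> v = 0"
    using tangent_chart[where x\<^sub>0 = x\<^sub>0 and X = X] by blast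
  have "\<not> vanishes_on (\<lambda>x. s x * \<Delta> x) X"
    using x\<^sub>0 irreducible_prime[OF X s(1) \<Delta>(1)] s(2) \<Delta>(2) by (auto simp: vanishes_on_def)
  then obtain x where x: "x \<in> X" "s x \<noteq> 0" "\<Delta> x \<noteq> 0" by (auto simp: vanishes_on_def)
  define v where "v j = (SOME v. v \<in> tangent_space X x \<and> (\<forall>i<d. dd (a' i) x v = (if i = j then 1 else 0)))" for j
  have v: "v j \<in> tangent_space X x \<and> (\<forall>i<d. dd (a' i) x (v j) = (if i = j then 1 else 0))" for j
  proof -
    have "\<exists>v. v \<in> tangent_space X x \<and> (\<forall>i<d. dd (a' i) x v = (if i = j then 1 else 0))"
      using ex[rule_format, OF x(1,2), of "\<lambda>i. if i = j then 1 else 0"] by blast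
    then show ?thesis unfolding v_def by (rule someI_ex)
  qed
  have inj_v: "inj_on v {..<d}"
    by (rule inj_onI) (metis lessThan_iff v zero_neq_one)
  have "vec.independent (v ` {..<d})"
  proof (rule vec.independent_if_scalars_zero)
    fix f y assume sum: "(\<Sum>y\<in>v ` {..<d}. f y *s y) = 0" and "y \<in> v ` {..<d}"
    then obtain i where i: "i < d" "y = v i" by auto
    have "0 = dd (a' i) x (\<Sum>y\<in>v ` {..<d}. f y *s y)" by (simp add: sum)
    also have "\<dots> = (\<Sum>j<d. f (v j) * dd (a' i) x (v j))"
      using a'[OF i(1)] by (simp add: dd_sum_vec dd_scale_vec sum.reindex[OF inj_v])
    also have "\<dots> = (\<Sum>j<d. if j = i then f (v j) else 0)"
      by (rule sum.cong) (use v i in auto)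
    also have "\<dots> = f y" using i by simp
    finally show "f y = 0" by simp
  qed simp
  then have "card (v ` {..<d}) \<le> vec.dim (tangent_space X x)"
    by (rule vec.independent_card_le_dim[rotated]) (use v in auto)
  also have "\<dots> \<le> card I"
    by (rule dim_le_card_if_coords_inj[OF subspace_tangent_space]) (rule inj[OF x(3)])
  finally show ?thesis by (simp add: card_image[OF inj_v] I)
qed

subsection \<open>The dimension\<close>

lemma
  fixes X :: "('k::field_char_0^'n) set"
  assumes X: "zariski_irreducible X"
  shows var_dim_le_dim_tangent_space: "x \<in> X \<Longrightarrow> var_dim X \<le> vec.dim (tangent_space X x)"
    and var_dim_ge: "(\<And>i. i < d \<Longrightarrow> a i \<in> coord_ring X) \<Longrightarrow> algebraically_independent X d a \<Longrightarrow> d \<le> var_dim X"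
proof -
  let ?P = "\<lambda>d. \<exists>a. (\<forall>i<d. a i \<in> coord_ring X) \<and> algebraically_independent X d a"
  obtain x\<^sub>0 where x\<^sub>0: "x\<^sub>0 \<in> X" using X by (auto simp: zariski_irreducible_def)
  have bound: "d \<le> vec.dim (tangent_space X x)" if "?P d" "x \<in> X" for d x
    using that card_le_dim_tangent_space[OF X, of d _ x] by blast
  have "algebraically_independent X 0 (\<lambda>_ _. 0)"
    unfolding algebraically_independent_def
  proof (intro allI impI)
    fix P :: "(nat, 'k) mpoly" assume P: "mp_vars P \<subseteq> {..<0} \<and> (\<forall>x\<in>X. mp_eval (\<lambda>i. 0) P = 0)"
    show "P = 0"
      by (rule no_relation_if_closed_under_pderiv[of "{x\<^sub>0}" 0 "\<lambda>_ _. 0"]) (use P x\<^sub>0 in \<open>auto simp: vanishes_on_def\<close>)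
  qed
  then have "?P 0" by blast
  then have "?P (var_dim X)"
    unfolding var_dim_def by (rule GreatestI_nat) (use bound[OF _ x\<^sub>0] in blast)
  then show "x \<in> X \<Longrightarrow> var_dim X \<le> vec.dim (tangent_space X x)" using bound by blast
  show "d \<le> var_dim X" if "\<And>i. i < d \<Longrightarrow> a i \<in> coord_ring X" "algebraically_independent X d a"
    unfolding var_dim_def by (rule Greatest_le_nat) (use that bound[OF _ x\<^sub>0] in blast)+
qed

text \<open>
  Where the dimension of the tangent space is minimal, a chart stays a chart on a dense open set; the
  coordinates of the chart satisfy no relation, because a relation could be differentiated along
  all of them.
\<close>

lemma ex_point_with_dim_tangent_space_eq:
  fixes X :: "('k::field_char_0^'n) set"
  assumes X: "zariski_irreducible X"
  shows "\<exists>x\<in>X. vec.dim (tangent_space X x) = var_dim X"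
proof -
  have X0: "X \<noteq> {}" using X by (simp add: zariski_irreducible_def)
  define x\<^sub>0 where "x\<^sub>0 = (ARG_MIN (\<lambda>x. vec.dim (tangent_space X x)) x. x \<in> X)"
  have x\<^sub>0: "x\<^sub>0 \<in> X" and min: "\<And>x. x \<in> X \<Longrightarrow> vec.dim (tangent_space X x\<^sub>0) \<le> vec.dim (tangent_space X x)"
    using X0 arg_min_nat_lemma[of "\<lambda>x. x \<in> X" _ "\<lambda>x. vec.dim (tangent_space X x)"] by (auto simp: x\<^sub>0_def)
  obtain \<Delta> and I :: "'n set" where \<Delta>: "\<Delta> \<in> polyfun" "\<Delta> x\<^sub>0 \<noteq> 0" and I: "card I = vec.dim (tangent_space X x\<^sub>0)"
    and inj: "\<And>x v. \<Delta> x \<noteq> 0 \<Longrightarrow> v \<in> tangent_space X x \<Longrightarrow> (\<And>i. i \<in> I \<Longrightarrow> v $ i = 0) \<Longrightarrow> v = 0"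
    using tangent_chart[where x\<^sub>0 = x\<^sub>0 and X = X] by blast
  define t where "t = card I"
  obtain b where b: "bij_betw b {..<t} I"
    using ex_bij_betw_nat_finite[of I] by (auto simp: t_def atLeast0LessThan)
  define a where "a j x = (if x \<in> X then x $ b j else 0)" for j x
  have "algebraically_independent X t a"
    unfolding algebraically_independent_def
  proof (intro allI impI)
    fix P :: "(nat, 'k) mpoly" assume P: "mp_vars P \<subseteq> {..<t} \<and> (\<forall>x\<in>X. mp_eval (\<lambda>i. a i x) P = 0)"
    show "P = 0"
    proof (rule no_relation_if_closed_under_pderiv[OF X0])
      show "mp_vars P \<subseteq> {..<t}" "vanishes_on (\<lambda>x. mp_eval (\<lambda>i. x $ b i) P) X"
        using P by (auto simp: vanishes_on_def a_def)
      fix Q :: "(nat, 'k) mpoly" and j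
      assume Q: "mp_vars Q \<subseteq> {..<t}" "vanishes_on (\<lambda>x. mp_eval (\<lambda>i. x $ b i) Q) X" and j: "j < t"
      have poly: "(\<lambda>x. mp_eval (\<lambda>i. x $ b i) R) \<in> polyfun" for R
        by (rule subalg_mp_eval[OF subalg_polyfun polyfun_coord])
      have "vanishes_on (\<lambda>x. \<Delta> x * mp_eval (\<lambda>i. x $ b i) (mp_pderiv j Q)) X"
        unfolding vanishes_on_def
      proof
        fix x assume x: "x \<in> X"
        show "\<Delta> x * mp_eval (\<lambda>i. x $ b i) (mp_pderiv j Q) = 0"
        proof (cases "\<Delta> x = 0")
          case False
          have "\<exists>v\<in>tangent_space X x. \<forall>i\<in>I. v $ i = (if i = b j then 1 else 0)"
            by (rule coords_surj_if_dim_eq[OF subspace_tangent_space])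
              (rule inj[OF False], use min[OF x] I in auto)
          then obtain v where v: "v \<in> tangent_space X x" "\<forall>i\<in>I. v $ i = (if i = b j then 1 else 0)"
            by blast
          have "0 = dd (\<lambda>x. mp_eval (\<lambda>i. x $ b i) Q) x v"
            using v(1)[unfolded tangent_space_iff, rule_format, OF poly[of Q]] Q(2)
            by (simp add: vanishes_on_def)
          also have "\<dots> = (\<Sum>i<t. mp_eval (\<lambda>i. x $ b i) (mp_pderiv i Q) * v $ b i)"
            using pd_mp_eval[OF subalg_polyfun point_derivation_dd finite_lessThan Q(1), of "\<lambda>i x. x $ b i"]
            by (simp add: polyfun_coord)
          also have "\<dots> = (\<Sum>i<t. if i = j then mp_eval (\<lambda>i. x $ b i) (mp_pderiv i Q) else 0)"
          proof (rule sum.cong[OF refl])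
            fix i assume i: "i \<in> {..<t}"
            have "b i \<in> I" "b i = b j \<longleftrightarrow> i = j"
              using b i j by (auto simp: bij_betw_def inj_on_def)
            then show "mp_eval (\<lambda>i. x $ b i) (mp_pderiv i Q) * v $ b i =
              (if i = j then mp_eval (\<lambda>i. x $ b i) (mp_pderiv i Q) else 0)"
              using v(2) by auto
          qed
          finally show ?thesis using j by simp
        qed simp
      qed
      then show "vanishes_on (\<lambda>x. mp_eval (\<lambda>i. x $ b i) (mp_pderiv j Q)) X"
        using irreducible_prime[OF X \<Delta>(1) poly] \<Delta>(2) x\<^sub>0 by (auto simp: vanishes_on_def)
    qed
  qed
  moreover have "a i \<in> coord_ring X" for i
    unfolding a_def by (rule coord_ring_restrict[OF polyfun_coord])
  ultimately have "t \<le> var_dim X" by (intro var_dim_ge[OF X])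
  then show ?thesis
    using var_dim_le_dim_tangent_space[OF X x\<^sub>0] x\<^sub>0 I t_def by (intro bexI[of _ x\<^sub>0]) auto
qed

text \<open>
  Together with \<open>h\<close> there are more functions than the dimension, so they are dependent.
\<close>

lemma relation_on_hypersurface:
  fixes X :: "('k::field_char_0^'n) set"
  assumes X: "zariski_irreducible X" and h: "h \<in> polyfun" "\<not> vanishes_on h X"
    and Z: "Z \<subseteq> X" "vanishes_on h Z"
  shows "\<exists>R. R \<noteq> 0 \<and> mp_vars R \<subseteq> {..<var_dim X} \<and> vanishes_on (\<lambda>x. mp_eval (\<lambda>i. x $ b i) R) Z"
proof -
  let ?t = "var_dim X"
  define a where "a j x = (if j < ?t then x $ b j else h x)" for j x
  define a' where "a' j x = (if x \<in> X then a j x else 0)" for j x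
  have a: "a j \<in> polyfun" for j
    by (cases "j < ?t") (simp_all add: a_def[abs_def] polyfun_coord h)
  have "a' j \<in> coord_ring X" for j
    unfolding a'_def by (rule coord_ring_restrict[OF a])
  then have "\<not> algebraically_independent X (Suc ?t) a'"
    using var_dim_ge[OF X, of "Suc ?t" a'] by auto
  then obtain P where P: "mp_vars P \<subseteq> {..<Suc ?t}" "P \<noteq> 0" "\<forall>x\<in>X. mp_eval (\<lambda>i. a' i x) P = 0"
    by (auto simp: algebraically_independent_def)
  then have van: "vanishes_on (\<lambda>x. mp_eval (\<lambda>i. a i x) P) X"
    by (auto simp: vanishes_on_def a'_def)
  have "\<exists>R. R \<noteq> 0 \<and> mp_vars R \<subseteq> {..<?t} \<and> vanishes_on (\<lambda>x. mp_eval (\<lambda>i. a i x) R) Z"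
  proof (rule relation_on_zero_set[OF P(2,1) van _ Z(1)])
    fix Q :: "(nat, 'k) mpoly" assume Q: "vanishes_on (\<lambda>x. a ?t x * mp_eval (\<lambda>i. a i x) Q) X"
    have "(\<lambda>x. mp_eval (\<lambda>i. a i x) Q) \<in> polyfun" by (rule subalg_mp_eval[OF subalg_polyfun a])
    then show "vanishes_on (\<lambda>x. mp_eval (\<lambda>i. a i x) Q) X"
      using irreducible_prime[OF X a[of ?t] _ Q] h by (auto simp: a_def vanishes_on_def)
  qed (use Z in \<open>simp add: a_def vanishes_on_def\<close>)
  then obtain R where R: "R \<noteq> 0" "mp_vars R \<subseteq> {..<?t}" "vanishes_on (\<lambda>x. mp_eval (\<lambda>i. a i x) R) Z"
    by blast
  have "mp_eval (\<lambda>i. a i x) R = mp_eval (\<lambda>i. x $ b i) R" for x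
    by (rule mp_eval_cong) (use R(2) in \<open>auto simp: a_def\<close>)
  then show ?thesis using R by auto
qed

section \<open>Polynomial flows\<close>

text \<open>
  Polynomials in time whose coefficients are polynomial functions. They are kept as univariate
  polynomials because their coefficients are needed one by one.
\<close>

definition polyfam :: "('k::comm_ring_1^'n) set \<Rightarrow> ('k \<Rightarrow> 'k^'n \<Rightarrow> 'k) \<Rightarrow> bool" where
  "polyfam Z g \<longleftrightarrow> (\<exists>q\<in>coeffs_in polyfun. \<forall>s. \<forall>x\<in>Z. g s x = poly q (\<lambda>_. s) x)"

text \<open>
  An action of the additive group on \<open>Z\<close> by polynomial maps. Only the values on \<open>Z\<close> matter, and the
  trivial action is included.
\<close>

definition flow :: "('k::comm_ring_1^'n) set \<Rightarrow> ('k \<Rightarrow> 'k^'n \<Rightarrow> 'k^'n) \<Rightarrow> bool" where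
  "flow Z \<Phi> \<longleftrightarrow> (\<forall>s. \<forall>x\<in>Z. \<Phi> s x \<in> Z) \<and> (\<forall>x\<in>Z. \<Phi> 0 x = x) \<and>
     (\<forall>s t. \<forall>x\<in>Z. \<Phi> (s + t) x = \<Phi> s (\<Phi> t x)) \<and> (\<forall>i. polyfam Z (\<lambda>s x. \<Phi> s x $ i))"

definition velocity :: "('k::comm_ring_1 \<Rightarrow> 'k^'n \<Rightarrow> 'k^'n) \<Rightarrow> 'k^'n \<Rightarrow> 'k^'n" where
  "velocity \<Phi> p = (\<chi> i. deriv_at_0 (\<lambda>s. \<Phi> s p $ i))"

lemma poly_fun_apply: "poly q (\<lambda>_. s) x = poly (map_poly (\<lambda>F. F x) q) (s :: 'k::comm_ring_1)"
  by (induction q) (simp_all add: map_poly_pCons)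

lemma poly_fun_apply_sum: "poly q (\<lambda>_. s) x = (\<Sum>j\<le>degree q. coeff q j x * s ^ j)"
  for s :: "'k::comm_ring_1"
  by (simp add: poly_altdef sum_fun_apply power_fun_apply)

lemma polyfam_const: "polyfam Z (\<lambda>s x. c)"
  unfolding polyfam_def
  by (rule bexI[of _ "[:\<lambda>_. c:]"])
    (simp_all add: coeffs_in_pCons[OF subalg_polyfun] coeffs_in_zero[OF subalg_polyfun] polyfun_const)

lemma polyfam_time: "polyfam Z (\<lambda>s x. s)"
  unfolding polyfam_def
  by (rule bexI[of _ "[:0, 1:]"])
    (simp_all add: coeffs_in_pCons[OF subalg_polyfun] coeffs_in_zero[OF subalg_polyfun]
      subalg_zero[OF subalg_polyfun] subalg_one[OF subalg_polyfun])

lemma polyfam_polyfun: "F \<in> polyfun \<Longrightarrow> polyfam Z (\<lambda>s x. F x)"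
  unfolding polyfam_def
  by (rule bexI[of _ "[:F:]"])
    (simp_all add: coeffs_in_pCons[OF subalg_polyfun] coeffs_in_zero[OF subalg_polyfun])

lemma polyfam_add:
  assumes "polyfam Z g" "polyfam Z h" shows "polyfam Z (\<lambda>s x. g s x + h s x)"
proof -
  obtain p q where "p \<in> coeffs_in polyfun" "q \<in> coeffs_in polyfun"
    "\<forall>s. \<forall>x\<in>Z. g s x = poly p (\<lambda>_. s) x" "\<forall>s. \<forall>x\<in>Z. h s x = poly q (\<lambda>_. s) x"
    using assms by (auto simp: polyfam_def)
  then show ?thesis unfolding polyfam_def
    by (intro bexI[of _ "p + q"] coeffs_in_add[OF subalg_polyfun]) auto
qed

lemma polyfam_mult:
  assumes "polyfam Z g" "polyfam Z h" shows "polyfam Z (\<lambda>s x. g s x * h s x)"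
proof -
  obtain p q where "p \<in> coeffs_in polyfun" "q \<in> coeffs_in polyfun"
    "\<forall>s. \<forall>x\<in>Z. g s x = poly p (\<lambda>_. s) x" "\<forall>s. \<forall>x\<in>Z. h s x = poly q (\<lambda>_. s) x"
    using assms by (auto simp: polyfam_def)
  then show ?thesis unfolding polyfam_def
    by (intro bexI[of _ "p * q"] coeffs_in_mult[OF subalg_polyfun]) auto
qed

lemma polyfam_sum: "(\<And>i. i \<in> S \<Longrightarrow> polyfam Z (g i)) \<Longrightarrow> polyfam Z (\<lambda>s x. \<Sum>i\<in>S. g i s x)"
  by (induction S rule: infinite_finite_induct) (simp_all add: polyfam_const polyfam_add)

lemma polyfam_power: "polyfam Z g \<Longrightarrow> polyfam Z (\<lambda>s x. g s x ^ n)"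
  by (induction n) (simp_all add: polyfam_const polyfam_mult)

lemma polyfam_compose:
  assumes "F \<in> polyfun" "\<And>i. polyfam Z (\<lambda>s x. \<gamma> s x $ i)"
  shows "polyfam Z (\<lambda>s x. F (\<gamma> s x))"
  using assms(1) by induction (simp_all add: polyfam_const polyfam_add polyfam_mult assms(2))

lemma polyfam_cong: "(\<And>s x. x \<in> Z \<Longrightarrow> g s x = h s x) \<Longrightarrow> polyfam Z g \<longleftrightarrow> polyfam Z h"
  by (auto simp: polyfam_def)

lemma polyfam_reparametrize:
  assumes g: "polyfam Z g" and \<tau>: "polyfam W \<tau>" and \<pi>: "\<And>y. y \<in> W \<Longrightarrow> \<pi> y \<in> Z" "\<And>i. (\<lambda>y. \<pi> y $ i) \<in> polyfun"
  shows "polyfam W (\<lambda>s y. g (\<tau> s y) (\<pi> y))"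
proof -
  obtain q where q: "q \<in> coeffs_in polyfun" "\<forall>s. \<forall>x\<in>Z. g s x = poly q (\<lambda>_. s) x"
    using g by (auto simp: polyfam_def)
  have "polyfam W (\<lambda>s y. \<Sum>j\<le>degree q. coeff q j (\<pi> y) * \<tau> s y ^ j)"
    by (intro polyfam_sum polyfam_mult polyfam_power \<tau> polyfam_polyfun polyfun_compose[OF _ \<pi>(2)])
      (use q in \<open>simp add: coeffs_in_def\<close>)
  then show ?thesis
    by (subst polyfam_cong[of W _ "\<lambda>s y. \<Sum>j\<le>degree q. coeff q j (\<pi> y) * \<tau> s y ^ j"])
      (simp_all add: q(2) \<pi>(1) poly_fun_apply_sum)
qed

lemma polyfam_pcurve: "polyfam Z g \<Longrightarrow> x \<in> Z \<Longrightarrow> pcurve (\<lambda>s. g s x)"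
  by (auto simp: polyfam_def pcurve_def poly_fun_apply)

lemma polyfam_at_time:
  assumes "polyfam Z g" obtains F where "F \<in> polyfun" "\<And>x. x \<in> Z \<Longrightarrow> g s x = F x"
proof -
  obtain q where q: "q \<in> coeffs_in polyfun" "\<forall>s. \<forall>x\<in>Z. g s x = poly q (\<lambda>_. s) x"
    using assms by (auto simp: polyfam_def)
  have "poly q (\<lambda>_. s) \<in> polyfun"
    by (rule poly_in_subalg[OF subalg_polyfun q(1) polyfun_const])
  then show thesis using q(2) that by blast
qed

lemma
  assumes "flow Z \<Phi>"
  shows flow_in: "x \<in> Z \<Longrightarrow> \<Phi> s x \<in> Z"
    and flow_zero: "x \<in> Z \<Longrightarrow> \<Phi> 0 x = x"
    and flow_add: "x \<in> Z \<Longrightarrow> \<Phi> (s + t) x = \<Phi> s (\<Phi> t x)"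
    and flow_polyfam: "polyfam Z (\<lambda>s x. \<Phi> s x $ i)"
  using assms by (auto simp: flow_def)

lemma flow_inverse: "flow Z \<Phi> \<Longrightarrow> x \<in> Z \<Longrightarrow> \<Phi> (- s) (\<Phi> s x) = x"
  using flow_add[of Z \<Phi> x "- s" s] by (simp add: flow_zero)

lemma flow_polyfun_velocity:
  fixes \<Phi> :: "'k::field_char_0 \<Rightarrow> 'k^'n \<Rightarrow> 'k^'n"
  assumes "flow Z \<Phi>" "p \<in> Z" "F \<in> polyfun"
  shows "deriv_at_0 (\<lambda>s. F (\<Phi> s p)) = dd F p (velocity \<Phi> p)"
  using deriv_at_0_polyfun[OF assms(3), of "\<lambda>s. \<Phi> s p"] polyfam_pcurve[OF flow_polyfam[OF assms(1)] assms(2)]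
  by (simp add: velocity_def flow_zero[OF assms(1,2)])

lemma velocity_tangent_orbit:
  fixes \<Phi> :: "'k::field_char_0 \<Rightarrow> 'k^'n \<Rightarrow> 'k^'n"
  assumes "flow Z \<Phi>" "p \<in> Z"
  shows "velocity \<Phi> p \<in> tangent_space (range (\<lambda>s. \<Phi> s p)) p"
  using flow_polyfun_velocity[OF assms, symmetric] by (simp add: tangent_space_iff)

lemma velocity_tangent:
  fixes \<Phi> :: "'k::field_char_0 \<Rightarrow> 'k^'n \<Rightarrow> 'k^'n"
  assumes "flow Z \<Phi>" "p \<in> Z"
  shows "velocity \<Phi> p \<in> tangent_space Z p"
proof -
  have "range (\<lambda>s. \<Phi> s p) \<subseteq> Z" using flow_in[OF assms] by auto
  then show ?thesis using velocity_tangent_orbit[OF assms] tangent_space_mono by blast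
qed

lemma deriv_at_0_shift: "deriv_at_0 (\<lambda>t. poly r (s + t)) = poly (pderiv r) (s :: 'k::field_char_0)"
proof (induction r)
  case (pCons a r)
  have pc: "pcurve (\<lambda>t. s + t)" "pcurve (\<lambda>t. poly r (s + t))"
  proof -
    show "pcurve (\<lambda>t. s + t)" by (intro pcurve_add pcurve_const pcurve_id)
    show "pcurve (\<lambda>t. poly r (s + t))"
      unfolding pcurve_def by (rule exI[of _ "pcompose r [:s, 1:]"]) (simp add: poly_pcompose)
  qed
  have "deriv_at_0 (\<lambda>t. s + t) = 1"
    using deriv_at_0_add[OF pcurve_const pcurve_id, of s] by simp
  then have "deriv_at_0 (\<lambda>t. a + (s + t) * poly r (s + t)) = s * deriv_at_0 (\<lambda>t. poly r (s + t)) + poly r s"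
    using deriv_at_0_add[OF pcurve_const pcurve_mult[OF pc], of a] deriv_at_0_mult[OF pc] by simp
  then show ?case by (simp add: pCons.IH pderiv_pCons)
qed simp

text \<open>
  On a nonconstant orbit the polynomial functions, as polynomials in time, are closed under
  translation of time and hence under differentiation; so one of them has degree one. It inverts the
  parametrization of the orbit, which shows that the orbit is smooth.
\<close>

lemma tangent_space_orbit:
  fixes \<Phi> :: "'k::field_char_0 \<Rightarrow> 'k^'n \<Rightarrow> 'k^'n"
  assumes \<Phi>: "flow Z \<Phi>" and p: "p \<in> Z"
  shows "tangent_space (range (\<lambda>s. \<Phi> s p)) p \<subseteq> vec.span {velocity \<Phi> p}"
proof
  fix v assume v: "v \<in> tangent_space (range (\<lambda>s. \<Phi> s p)) p"
  have vanish: "dd F p v = 0" if "F \<in> polyfun" "\<And>s. F (\<Phi> s p) = 0" for F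
    using v that by (auto simp: tangent_space_iff)
  define rep where "rep F r \<longleftrightarrow> F \<in> polyfun \<and> (\<forall>s. F (\<Phi> s p) = poly r s) \<and> degree r \<noteq> 0" for F r
  have pc: "pcurve (\<lambda>s. F (\<Phi> s p))" if "F \<in> polyfun" for F
    by (rule pcurve_polyfun[OF that polyfam_pcurve[OF flow_polyfam[OF \<Phi>] p]])
  have curve: "\<exists>r. \<forall>s. \<Phi> s p $ i = poly r s" for i
    using pc[OF polyfun_coord, of i] by (simp add: pcurve_def)
  show "v \<in> vec.span {velocity \<Phi> p}"
  proof (cases "\<exists>r F. rep F r")
    case False
    have "v $ i = 0" for i
    proof -
      obtain r where r: "\<forall>s. \<Phi> s p $ i = poly r s" using curve by blast
      then have "degree r = 0" using False polyfun_coord[of i] unfolding rep_def by blast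
      then obtain c where "r = [:c:]" by (rule degree_eq_zeroE)
      then have "dd (\<lambda>x. x $ i - c) p v = 0"
        using r by (intro vanish polyfun_diff polyfun_coord polyfun_const) simp
      then show ?thesis by (simp add: dd_diff polyfun_coord polyfun_const)
    qed
    then have "v = 0" by (simp add: vec_eq_iff)
    then show ?thesis by (simp add: vec.span_zero)
  next
    case True
    define r where "r = (ARG_MIN degree r. \<exists>F. rep F r)"
    have "\<exists>F. rep F r" and min: "\<And>q F. rep F q \<Longrightarrow> degree r \<le> degree q"
      using True arg_min_nat_lemma[of "\<lambda>r. \<exists>F. rep F r" _ degree] by (auto simp: r_def)
    then obtain F where F: "rep F r" by blast
    have "degree r = 1"
    proof (rule ccontr)
      assume "degree r \<noteq> 1"
      then have d: "degree (pderiv r) \<noteq> 0" "degree (pderiv r) < degree r"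
        using F by (auto simp: degree_pderiv rep_def)
      obtain q where q: "q \<in> coeffs_in polyfun" "\<forall>s. \<forall>x\<in>Z. F (\<Phi> s x) = poly q (\<lambda>_. s) x"
        using polyfam_compose[OF _ flow_polyfam[OF \<Phi>], of F] F by (auto simp: polyfam_def rep_def)
      have "coeff q 1 (\<Phi> s p) = poly (pderiv r) s" for s
      proof -
        have "deriv_at_0 (\<lambda>t. F (\<Phi> t (\<Phi> s p))) = coeff (map_poly (\<lambda>F. F (\<Phi> s p)) q) 1"
          by (rule deriv_at_0_eq) (simp add: q(2) flow_in[OF \<Phi> p] poly_fun_apply)
        moreover have "F (\<Phi> t (\<Phi> s p)) = poly r (s + t)" for t
        proof -
          have "F (\<Phi> t (\<Phi> s p)) = F (\<Phi> (t + s) p)" by (simp add: flow_add[OF \<Phi> p])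
          then show ?thesis using F by (simp add: rep_def add.commute)
        qed
        ultimately show ?thesis by (simp add: deriv_at_0_shift coeff_map_poly)
      qed
      then have "rep (coeff q 1) (pderiv r)" using q(1) d by (simp add: rep_def coeffs_in_def)
      then show False using min d by fastforce
    qed
    then obtain a b where r: "r = [:b, a:]" "a \<noteq> 0"
      by (metis degree_pCons_eq_if degree_eq_zeroE nat.distinct(1) old.nat.inject One_nat_def pCons_cases pCons_eq_0_iff)
    have Fpoly: "F \<in> polyfun" and FPhi: "F (\<Phi> s p) = b + s * a" for s
      using F by (auto simp: rep_def r)
    have "v $ i = (dd F p v / a) * velocity \<Phi> p $ i" for i
    proof -
      obtain c where c: "\<forall>s. \<Phi> s p $ i = poly c s" using curve by blast
      define \<theta> where "\<theta> x = (F x - b) * (1 / a)" for x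
      have \<theta>: "\<theta> \<in> polyfun" unfolding \<theta>_def by (intro polyfun_intros Fpoly)
      have \<theta>\<Phi>: "\<theta> (\<Phi> s p) = s" for s using r(2) by (simp add: \<theta>_def FPhi)
      have "dd (\<lambda>x. x $ i - poly c (\<theta> x)) p v = 0"
        by (rule vanish) (simp_all add: polyfun_diff polyfun_coord polyfun_poly[OF \<theta>] \<theta>\<Phi> c)
      then have "v $ i = dd (\<lambda>x. poly c (\<theta> x)) p v"
        by (simp add: dd_diff polyfun_coord polyfun_poly[OF \<theta>])
      also have "\<dots> = poly (pderiv c) (\<theta> p) * dd \<theta> p v"
      proof (induction c)
        case (pCons e c)
        then show ?case
          by (simp add: dd_add dd_mult polyfun_const polyfun_mult polyfun_poly \<theta> pderiv_pCons algebra_simps)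
      qed simp
      also have "\<theta> p = 0" using \<theta>\<Phi>[of 0] by (simp add: flow_zero[OF \<Phi> p])
      also have "poly (pderiv c) 0 = velocity \<Phi> p $ i"
        using deriv_at_0_eq[of "\<lambda>s. \<Phi> s p $ i" c] c by (simp add: velocity_def poly_0_coeff_0 coeff_pderiv)
      also have "dd \<theta> p v = dd F p v / a"
        unfolding \<theta>_def by (subst dd_mult) (simp_all add: dd_diff polyfun_diff Fpoly polyfun_const)
      finally show ?thesis by (simp add: mult.commute)
    qed
    then have "v = (dd F p v / a) *s velocity \<Phi> p" by (simp add: vec_eq_iff)
    then show ?thesis by (metis vec.span_base vec.span_scale singletonI)
  qed
qed

subsection \<open>Flows and one-parameter subgroups\<close>

lemma Ga_subgroup_flow:
  fixes Z :: "('k::field_char_0^'n) set"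
  assumes "Ga_subgroup Z H"
  obtains \<Phi> where "flow Z \<Phi>" "\<And>p. orbit H p = range (\<lambda>s. \<Phi> s p)"
proof -
  from assms obtain \<phi> :: "'k \<Rightarrow> 'k^'n \<Rightarrow> 'k^'n" where H: "H = range \<phi>" and aut: "H \<subseteq> variety_aut Z"
    and add: "\<And>s t. \<phi> (s + t) = compose Z (\<phi> s) (\<phi> t)"
    and mor: "variety_morphism (var_prod (UNIV :: ('k^1) set) Z) Z (\<lambda>y. \<phi> (vfst y $ 1) (vsnd y))"
    by (auto simp: Ga_subgroup_def)
  have bij: "bij_betw (\<phi> s) Z Z" for s using aut H by (auto simp: variety_aut_def)
  have inZ: "\<phi> s x \<in> Z" if "x \<in> Z" for s x using bij[of s] that by (auto simp: bij_betw_def)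
  have add': "\<phi> (s + t) x = \<phi> s (\<phi> t x)" if "x \<in> Z" for s t x
    using add[of s t] that by (simp add: compose_def)
  have zero: "\<phi> 0 x = x" if "x \<in> Z" for x
    using add'[OF that, of 0 0] bij[of 0] inZ[OF that] that by (auto simp: bij_betw_def inj_on_def)
  have "polyfam Z (\<lambda>s x. \<phi> s x $ i)" for i
  proof -
    obtain P where P: "\<forall>y\<in>var_prod (UNIV :: ('k^1) set) Z. \<phi> (vfst y $ 1) (vsnd y) $ i = mp_eval (($) y) P"
      using mor unfolding variety_morphism_def by blast
    have "\<phi> s x $ i = mp_eval (($) (vjoin ((\<chi> _. s) :: 'k^1) x)) P" if "x \<in> Z" for s x
    proof -
      have "vjoin ((\<chi> _. s) :: 'k^1) x \<in> var_prod UNIV Z" using that by (auto simp: var_prod_def)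
      from bspec[OF P this] show ?thesis by (simp add: vfst_def vsnd_def vjoin_def vec_lambda_eta)
    qed
    moreover have "polyfam Z (\<lambda>s x. vjoin ((\<chi> _. s) :: 'k^1) x $ j)" for j
      by (cases j) (simp_all add: vjoin_def polyfam_time polyfam_polyfun polyfun_coord)
    then have "polyfam Z (\<lambda>s x. mp_eval (($) (vjoin ((\<chi> _. s) :: 'k^1) x)) P)"
      by (rule polyfam_compose[OF polyfun_mp_eval])
    ultimately show ?thesis by (subst polyfam_cong) auto
  qed
  then have "flow Z \<phi>" by (simp add: flow_def inZ zero add')
  moreover have "orbit H p = range (\<lambda>s. \<phi> s p)" for p by (auto simp: orbit_def H)
  ultimately show thesis by (rule that)
qed

text \<open>
  A flow with a nonzero velocity is faithful: a time \<open>s \<noteq> 0\<close> acting trivially would make the polynomial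
  curve through \<open>p\<close> constant, as it would return to \<open>p\<close> at all multiples of \<open>s\<close>.
\<close>

lemma flow_Ga_subgroup:
  fixes Z :: "('k::field_char_0^'n) set"
  assumes \<Phi>: "flow Z \<Phi>" and p: "p \<in> Z" "velocity \<Phi> p \<noteq> 0"
  obtains H where "Ga_subgroup Z H" "\<And>p. p \<in> Z \<Longrightarrow> orbit H p = range (\<lambda>s. \<Phi> s p)"
proof -
  define \<phi> where "\<phi> s = restrict (\<Phi> s) Z" for s
  have mor: "variety_morphism Z Z g" if "\<And>x. x \<in> Z \<Longrightarrow> g x = \<Phi> s x" for g s
    unfolding variety_morphism_def
  proof (intro conjI allI)
    show "g ` Z \<subseteq> Z" using that flow_in[OF \<Phi>] by auto
    fix i
    obtain F where "F \<in> polyfun" "\<And>x. x \<in> Z \<Longrightarrow> \<Phi> s x $ i = F x"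
      using polyfam_at_time[OF flow_polyfam[OF \<Phi>]] by blast
    then show "\<exists>P. \<forall>x\<in>Z. g x $ i = mp_eval (($) x) P"
      using that by (metis polyfunE)
  qed
  have inj: "inj \<phi>"
  proof (rule injI, rule ccontr)
    fix s t assume eq: "\<phi> s = \<phi> t" and ne: "s \<noteq> t"
    have "\<Phi> s p = \<Phi> t p" using fun_cong[OF eq, of p] p by (simp add: \<phi>_def)
    then have "\<Phi> (s - t) p = p"
      using flow_add[OF \<Phi> p(1), of "- t" s] flow_inverse[OF \<Phi> p(1), of t] by simp
    then have fixed: "\<Phi> (of_nat n * (s - t)) p = p" for n
    proof (induction n)
      case 0
      then show ?case by (simp add: flow_zero[OF \<Phi> p(1)])
    next
      case (Suc n)
      then show ?case
        using flow_add[OF \<Phi> p(1), of "of_nat n * (s - t)" "s - t"] by (simp add: algebra_simps)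
    qed
    have "velocity \<Phi> p $ i = 0" for i
    proof -
      obtain r where r: "\<forall>s. \<Phi> s p $ i = poly r s"
        using polyfam_pcurve[OF flow_polyfam[OF \<Phi>] p(1)] by (auto simp: pcurve_def)
      have inf: "infinite (range (\<lambda>n. of_nat n * (s - t)))"
        by (rule range_inj_infinite) (use ne in \<open>auto simp: inj_def\<close>)
      have "r - [:p $ i:] = 0"
      proof (rule ccontr)
        assume "r - [:p $ i:] \<noteq> 0"
        then have "finite {x. poly (r - [:p $ i:]) x = 0}" by (rule poly_roots_finite)
        moreover have "range (\<lambda>n. of_nat n * (s - t)) \<subseteq> {x. poly (r - [:p $ i:]) x = 0}"
          using r fixed by (auto simp flip: r[rule_format])
        ultimately show False using inf finite_subset by blast
      qed
      then have "r = [:p $ i:]" by simp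
      then show ?thesis using deriv_at_0_eq[of "\<lambda>s. \<Phi> s p $ i" r] r by (simp add: velocity_def)
    qed
    then show False using p(2) by (simp add: vec_eq_iff)
  qed
  have "Ga_subgroup Z (range \<phi>)"
    unfolding Ga_subgroup_def
  proof (intro exI[of _ \<phi>] conjI allI)
    show "range \<phi> = range \<phi>" by simp
    show "inj \<phi>" by (rule inj)
    show "range \<phi> \<subseteq> variety_aut Z"
    proof
      fix h assume "h \<in> range \<phi>"
      then obtain s where h: "h = \<phi> s" by auto
      have bij: "bij_betw (\<phi> s) Z Z"
        by (rule bij_betw_byWitness[where f' = "\<Phi> (- s)"])
          (use flow_in[OF \<Phi>] flow_inverse[OF \<Phi>] flow_inverse[OF \<Phi>, of _ "- s"] in \<open>auto simp: \<phi>_def\<close>)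
      have "inv_into Z (\<phi> s) x = \<Phi> (- s) x" if "x \<in> Z" for x
      proof (rule inv_into_f_eq)
        show "inj_on (\<phi> s) Z" using bij by (simp add: bij_betw_def)
        show "\<Phi> (- s) x \<in> Z" "\<phi> s (\<Phi> (- s) x) = x"
          using that flow_in[OF \<Phi>] flow_inverse[OF \<Phi>, of x "- s"] by (auto simp: \<phi>_def)
      qed
      then have "variety_morphism Z Z (inv_into Z (\<phi> s))" by (rule mor)
      moreover have "variety_morphism Z Z (\<phi> s)" by (rule mor) (simp add: \<phi>_def)
      ultimately show "h \<in> variety_aut Z" using bij by (simp add: variety_aut_def h) (simp add: \<phi>_def)
    qed
    show "\<phi> (s + t) = compose Z (\<phi> s) (\<phi> t)" for s t
      using flow_add[OF \<Phi>] flow_in[OF \<Phi>] by (auto simp: \<phi>_def compose_def fun_eq_iff)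
    show "variety_morphism (var_prod (UNIV :: ('k^1) set) Z) Z (\<lambda>y. \<phi> (vfst y $ 1) (vsnd y))"
      unfolding variety_morphism_def
    proof (intro conjI allI)
      have vs: "vsnd y \<in> Z" if "y \<in> var_prod (UNIV :: ('k^1) set) Z" for y
        using that by (auto simp: var_prod_def vsnd_def vjoin_def vec_lambda_eta)
      then show "(\<lambda>y. \<phi> (vfst y $ 1) (vsnd y)) ` var_prod (UNIV :: ('k^1) set) Z \<subseteq> Z"
        using flow_in[OF \<Phi>] by (auto simp: \<phi>_def)
      fix i
      obtain q where q: "q \<in> coeffs_in polyfun" "\<forall>s. \<forall>x\<in>Z. \<Phi> s x $ i = poly q (\<lambda>_. s) x"
        using flow_polyfam[OF \<Phi>, of i] unfolding polyfam_def by blast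
      have v: "(\<lambda>y :: 'k^(1 + 'n). vfst y $ 1) \<in> polyfun" "(\<lambda>y :: 'k^(1 + 'n). vsnd y $ j) \<in> polyfun" for j
        by (simp_all add: vfst_def vsnd_def polyfun_coord)
      have c: "(\<lambda>y :: 'k^(1 + 'n). coeff q j (vsnd y)) \<in> polyfun" for j
        by (rule polyfun_compose[OF _ v(2)]) (use q(1) in \<open>simp add: coeffs_in_def\<close>)
      have "(\<lambda>y :: 'k^(1 + 'n). \<Sum>j\<le>degree q. coeff q j (vsnd y) * (vfst y $ 1) ^ j) \<in> polyfun"
        by (intro polyfun_sum polyfun_mult polyfun_power c v)
      then obtain P where "\<And>y :: 'k^(1 + 'n). (\<Sum>j\<le>degree q. coeff q j (vsnd y) * (vfst y $ 1) ^ j) = mp_eval (($) y) P"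
        by (rule polyfunE) blast
      then show "\<exists>P. \<forall>y\<in>var_prod (UNIV :: ('k^1) set) Z. \<phi> (vfst y $ 1) (vsnd y) $ i = mp_eval (($) y) P"
        using q(2) vs by (intro exI[of _ P]) (simp add: \<phi>_def poly_fun_apply_sum)
    qed
  qed
  moreover have "orbit (range \<phi>) q = range (\<lambda>s. \<Phi> s q)" if "q \<in> Z" for q
  proof -
    have "orbit (range \<phi>) q = (\<lambda>h. h q) ` range \<phi>" by (auto simp: orbit_def)
    then show ?thesis using that by (simp add: image_image \<phi>_def)
  qed
  ultimately show thesis by (rule that)
qed

text \<open>
  Flexibility thus becomes a statement about velocities. The trivial flow does no harm here, as its
  velocity is zero.
\<close>

lemma span_orbit_tangents:
  fixes Z :: "('k::field_char_0^'n) set"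
  assumes p: "p \<in> Z"
  shows "vec.span (\<Union>H\<in>{H. Ga_subgroup Z H}. tangent_space (orbit H p) p) =
    vec.span {velocity \<Phi> p | \<Phi>. flow Z \<Phi>}"
proof (rule vec.span_eq[THEN iffD2], rule conjI)
  show "(\<Union>H\<in>{H. Ga_subgroup Z H}. tangent_space (orbit H p) p) \<subseteq> vec.span {velocity \<Phi> p | \<Phi>. flow Z \<Phi>}"
  proof
    fix v assume "v \<in> (\<Union>H\<in>{H. Ga_subgroup Z H}. tangent_space (orbit H p) p)"
    then obtain H where H: "Ga_subgroup Z H" "v \<in> tangent_space (orbit H p) p" by auto
    obtain \<Phi> where \<Phi>: "flow Z \<Phi>" "\<And>p. orbit H p = range (\<lambda>s. \<Phi> s p)"
      using Ga_subgroup_flow[OF H(1)] by blast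
    then have "v \<in> vec.span {velocity \<Phi> p}" using tangent_space_orbit[OF \<Phi>(1) p] H(2) by auto
    then show "v \<in> vec.span {velocity \<Phi> p | \<Phi>. flow Z \<Phi>}"
      using vec.span_mono[of "{velocity \<Phi> p}" "{velocity \<Phi> p | \<Phi>. flow Z \<Phi>}"] \<Phi>(1) by blast
  qed
  show "{velocity \<Phi> p | \<Phi>. flow Z \<Phi>} \<subseteq> vec.span (\<Union>H\<in>{H. Ga_subgroup Z H}. tangent_space (orbit H p) p)"
  proof
    fix v assume "v \<in> {velocity \<Phi> p | \<Phi>. flow Z \<Phi>}"
    then obtain \<Phi> where \<Phi>: "flow Z \<Phi>" "v = velocity \<Phi> p" by auto
    show "v \<in> vec.span (\<Union>H\<in>{H. Ga_subgroup Z H}. tangent_space (orbit H p) p)"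
    proof (cases "v = 0")
      case False
      obtain H where H: "Ga_subgroup Z H" "\<And>p. p \<in> Z \<Longrightarrow> orbit H p = range (\<lambda>s. \<Phi> s p)"
        using flow_Ga_subgroup[OF \<Phi>(1) p] False \<Phi>(2) by blast
      then have "v \<in> tangent_space (orbit H p) p"
        using velocity_tangent_orbit[OF \<Phi>(1) p] \<Phi>(2) p by simp
      then show ?thesis using H(1) by (intro vec.span_base) auto
    qed (simp add: vec.span_zero)
  qed
qed

definition flexible_at :: "('k::field_char_0^'n) set \<Rightarrow> 'k^'n \<Rightarrow> bool" where
  "flexible_at Z p \<longleftrightarrow> tangent_space Z p \<subseteq> vec.span {velocity \<Phi> p | \<Phi>. flow Z \<Phi>}"

lemma flexible_iff:
  fixes Z :: "('k::field_char_0^'n) set"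
  shows "flexible Z \<longleftrightarrow> irreducible_affine_variety Z \<and> (\<forall>p\<in>smooth_locus Z. flexible_at Z p)"
proof -
  have "vec.span {velocity \<Phi> p | \<Phi>. flow Z \<Phi>} = tangent_space Z p \<longleftrightarrow> flexible_at Z p" if "p \<in> Z" for p
  proof -
    have "vec.span {velocity \<Phi> p | \<Phi>. flow Z \<Phi>} \<subseteq> tangent_space Z p"
      by (rule vec.span_minimal[OF _ subspace_tangent_space]) (use velocity_tangent that in auto)
    then show ?thesis by (auto simp: flexible_at_def)
  qed
  then show ?thesis
    by (auto simp: flexible_def span_orbit_tangents smooth_locus_def)
qed

subsection \<open>Transport along flows\<close>

definition differential :: "('k::field_char_0^'n \<Rightarrow> 'k^'m) \<Rightarrow> 'k^'n \<Rightarrow> 'k^'n \<Rightarrow> 'k^'m" where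
  "differential \<psi> p v = (\<chi> i. dd (\<lambda>x. \<psi> x $ i) p v)"

lemma differential_tangent:
  assumes "\<And>i. (\<lambda>x. \<psi> x $ i) \<in> polyfun" "\<And>x. x \<in> Z \<Longrightarrow> \<psi> x \<in> W" "v \<in> tangent_space Z p"
  shows "differential \<psi> p v \<in> tangent_space W (\<psi> p)"
  unfolding tangent_space_iff
proof (intro ballI impI)
  fix F assume F: "F \<in> polyfun" "\<forall>x\<in>W. F x = 0"
  then have "dd (\<lambda>x. F (\<psi> x)) p v = 0"
    using assms polyfun_compose[OF F(1) assms(1)] by (auto simp: tangent_space_iff)
  then show "dd F (\<psi> p) (differential \<psi> p v) = 0"
    by (simp add: dd_compose[OF F(1) assms(1)] differential_def)
qed

lemma differential_inverse:
  assumes "\<And>i. (\<lambda>x. \<psi> x $ i) \<in> polyfun" "\<And>i. (\<lambda>x. \<eta> x $ i) \<in> polyfun" "\<And>x. x \<in> Z \<Longrightarrow> \<eta> (\<psi> x) = x"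
    and v: "v \<in> tangent_space Z p"
  shows "differential \<eta> (\<psi> p) (differential \<psi> p v) = v"
proof -
  have "dd (\<lambda>x. \<eta> (\<psi> x) $ i) p v = v $ i" for i
  proof -
    have poly: "(\<lambda>x. \<eta> (\<psi> x) $ i) \<in> polyfun" by (rule polyfun_compose[OF assms(2,1)])
    have "dd (\<lambda>x. \<eta> (\<psi> x) $ i - x $ i) p v = 0"
      using v polyfun_diff[OF poly polyfun_coord, of i] assms(3) by (auto simp: tangent_space_iff)
    then show ?thesis by (simp add: dd_diff poly polyfun_coord)
  qed
  then show ?thesis
    by (simp add: differential_def vec_eq_iff dd_compose[OF assms(2,1), symmetric])
qed

lemma linear_differential:
  assumes "\<And>i. (\<lambda>x. \<psi> x $ i) \<in> polyfun"
  shows "Vector_Spaces.linear (*s) (*s) (differential \<psi> p)"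
  by unfold_locales (auto simp: differential_def vec_eq_iff dd_add_vec[OF assms] dd_scale_vec[OF assms] algebra_simps)

lemma flow_map:
  assumes \<Phi>: "flow Z \<Phi>"
  obtains \<psi> where "\<And>i. (\<lambda>x. \<psi> x $ i) \<in> polyfun" "\<And>x. x \<in> Z \<Longrightarrow> \<psi> x = \<Phi> s x"
proof -
  have "\<exists>F\<in>polyfun. \<forall>x\<in>Z. \<Phi> s x $ i = F x" for i
    using polyfam_at_time[OF flow_polyfam[OF \<Phi>]] by metis
  then obtain F where F: "\<And>i. F i \<in> polyfun" "\<And>i x. x \<in> Z \<Longrightarrow> \<Phi> s x $ i = F i x" by metis
  show thesis by (rule that[of "\<lambda>x. \<chi> i. F i x"]) (simp_all add: F vec_eq_iff)
qed

lemma flow_dim_tangent_le: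
  fixes Z :: "('k::field_char_0^'n) set"
  assumes \<Phi>: "flow Z \<Phi>" and p: "p \<in> Z"
  shows "vec.dim (tangent_space Z p) \<le> vec.dim (tangent_space Z (\<Phi> s p))"
proof -
  obtain \<psi> where \<psi>: "\<And>i. (\<lambda>x. \<psi> x $ i) \<in> polyfun" "\<And>x. x \<in> Z \<Longrightarrow> \<psi> x = \<Phi> s x" using flow_map[OF \<Phi>] by blast
  obtain \<eta> where \<eta>: "\<And>i. (\<lambda>x. \<eta> x $ i) \<in> polyfun" "\<And>x. x \<in> Z \<Longrightarrow> \<eta> x = \<Phi> (- s) x" using flow_map[OF \<Phi>] by blast
  have inv: "\<eta> (\<psi> x) = x" if "x \<in> Z" for x
    using that by (simp add: \<psi> \<eta> flow_in[OF \<Phi>] flow_inverse[OF \<Phi>])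
  have "inj_on (differential \<psi> p) (tangent_space Z p)"
    by (rule inj_on_inverseI) (rule differential_inverse[OF \<psi>(1) \<eta>(1) inv])
  then have "vec.dim (differential \<psi> p ` tangent_space Z p) = vec.dim (tangent_space Z p)"
    by (intro vec.dim_image_eq linear_differential \<psi>(1))
      (simp add: vec.span_eq_iff[THEN iffD2, OF subspace_tangent_space])
  moreover have "differential \<psi> p ` tangent_space Z p \<subseteq> tangent_space Z (\<psi> p)"
    using differential_tangent[OF \<psi>(1), of Z Z _ p] \<psi>(2) flow_in[OF \<Phi>] by auto
  ultimately show ?thesis using vec.dim_subset \<psi>(2)[OF p] by metis
qed

text \<open>
  Conjugating all flows by one of them transports their velocities by its differential.
\<close>

lemma flexible_at_flow:
  fixes Z :: "('k::field_char_0^'n) set"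
  assumes \<Phi>: "flow Z \<Phi>" and p: "p \<in> Z" and flex: "flexible_at Z (\<Phi> s p)"
  shows "flexible_at Z p"
  unfolding flexible_at_def
proof
  fix v assume v: "v \<in> tangent_space Z p"
  obtain \<psi> where \<psi>: "\<And>i. (\<lambda>x. \<psi> x $ i) \<in> polyfun" "\<And>x. x \<in> Z \<Longrightarrow> \<psi> x = \<Phi> s x" using flow_map[OF \<Phi>] by blast
  obtain \<eta> where \<eta>: "\<And>i. (\<lambda>x. \<eta> x $ i) \<in> polyfun" "\<And>x. x \<in> Z \<Longrightarrow> \<eta> x = \<Phi> (- s) x" using flow_map[OF \<Phi>] by blast
  have inv: "\<eta> (\<psi> x) = x" if "x \<in> Z" for x
    using that by (simp add: \<psi> \<eta> flow_in[OF \<Phi>] flow_inverse[OF \<Phi>])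
  let ?q = "\<Phi> s p"
  have q: "?q \<in> Z" by (rule flow_in[OF \<Phi> p])
  interpret lin: Vector_Spaces.linear "(*s)" "(*s)" "differential \<eta> ?q" by (rule linear_differential[OF \<eta>(1)])
  have conj: "differential \<eta> ?q (velocity \<Theta> ?q) \<in> {velocity \<Psi> p | \<Psi>. flow Z \<Psi>}" if \<Theta>: "flow Z \<Theta>" for \<Theta>
  proof -
    define \<Psi> where "\<Psi> t x = \<Phi> (- s) (\<Theta> t (\<Phi> s x))" for t x
    have eq: "\<Psi> t x = \<eta> (\<Theta> t (\<psi> x))" if "x \<in> Z" for t x
      using that by (simp add: \<Psi>_def \<psi> \<eta> flow_in[OF \<Phi>] flow_in[OF \<Theta>])
    have "flow Z \<Psi>"
      unfolding flow_def
    proof (intro conjI allI ballI)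
      fix t t' x assume x: "x \<in> Z"
      show "\<Psi> t x \<in> Z" using x by (simp add: \<Psi>_def flow_in[OF \<Phi>] flow_in[OF \<Theta>])
      show "\<Psi> 0 x = x" using x by (simp add: \<Psi>_def flow_in[OF \<Phi>] flow_zero[OF \<Theta>] flow_inverse[OF \<Phi>])
      have "\<Phi> s (\<Phi> (- s) y) = y" if "y \<in> Z" for y using flow_inverse[OF \<Phi> that, of "- s"] by simp
      then show "\<Psi> (t + t') x = \<Psi> t (\<Psi> t' x)"
        using x by (simp add: \<Psi>_def flow_in[OF \<Phi>] flow_in[OF \<Theta>] flow_add[OF \<Theta>])
    next
      fix i
      have "polyfam Z (\<lambda>t x. \<Theta> t (\<psi> x) $ j)" for j
        by (rule polyfam_reparametrize[OF flow_polyfam[OF \<Theta>] polyfam_time]) (simp_all add: \<psi> flow_in[OF \<Phi>])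
      then have "polyfam Z (\<lambda>t x. \<eta> (\<Theta> t (\<psi> x)) $ i)" by (rule polyfam_compose[OF \<eta>(1)])
      then show "polyfam Z (\<lambda>t x. \<Psi> t x $ i)" by (subst polyfam_cong) (auto simp: eq)
    qed
    moreover have "velocity \<Psi> p = differential \<eta> ?q (velocity \<Theta> ?q)"
      using flow_polyfun_velocity[OF \<Theta> q \<eta>(1)]
      by (simp add: velocity_def[of \<Psi>] differential_def eq[OF p] \<psi>(2)[OF p])
    ultimately show ?thesis by (metis (mono_tags, lifting) mem_Collect_eq)
  qed
  have "differential \<psi> p v \<in> tangent_space Z ?q"
    using differential_tangent[OF \<psi>(1) _ v] \<psi>(2) flow_in[OF \<Phi>] p by metis
  then have "differential \<psi> p v \<in> vec.span {velocity \<Theta> ?q | \<Theta>. flow Z \<Theta>}"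
    using flex by (auto simp: flexible_at_def)
  then have "differential \<eta> ?q (differential \<psi> p v) \<in> vec.span (differential \<eta> ?q ` {velocity \<Theta> ?q | \<Theta>. flow Z \<Theta>})"
    unfolding lin.span_image by blast
  also have "vec.span (differential \<eta> ?q ` {velocity \<Theta> ?q | \<Theta>. flow Z \<Theta>}) \<subseteq> vec.span {velocity \<Psi> p | \<Psi>. flow Z \<Psi>}"
    by (rule vec.span_mono) (use conj in blast)
  finally show "v \<in> vec.span {velocity \<Psi> p | \<Psi>. flow Z \<Psi>}"
    using differential_inverse[OF \<psi>(1) \<eta>(1) inv v] by (simp add: \<psi>(2)[OF p])
qed

definition reach :: "('k::field_char_0^'n) set \<Rightarrow> 'k^'n \<Rightarrow> 'k^'n \<Rightarrow> bool" where
  "reach Z = (\<lambda>p q. \<exists>\<Phi> s. flow Z \<Phi> \<and> q = \<Phi> s p)\<^sup>*\<^sup>*"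

lemma reach_refl: "reach Z p p"
  and reach_trans: "reach Z p q \<Longrightarrow> reach Z q r \<Longrightarrow> reach Z p r"
  and reach_flow: "flow Z \<Phi> \<Longrightarrow> reach Z p (\<Phi> s p)"
  unfolding reach_def by (auto intro: rtranclp_trans r_into_rtranclp)

lemma
  fixes Z :: "('k::field_char_0^'n) set"
  assumes "reach Z p q" "p \<in> Z"
  shows reach_in: "q \<in> Z"
    and reach_dim: "vec.dim (tangent_space Z q) = vec.dim (tangent_space Z p)"
    and reach_flexible_at: "flexible_at Z q \<Longrightarrow> flexible_at Z p"
proof -
  have "q \<in> Z \<and> vec.dim (tangent_space Z q) = vec.dim (tangent_space Z p) \<and> (flexible_at Z q \<longrightarrow> flexible_at Z p)"
    using assms(1) unfolding reach_def
  proof (induction rule: rtranclp_induct)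
    case base
    show ?case using assms(2) by simp
  next
    case (step y z)
    then obtain \<Phi> s where \<Phi>: "flow Z \<Phi>" "z = \<Phi> s y" by auto
    have y: "y \<in> Z" using step by simp
    have "vec.dim (tangent_space Z z) = vec.dim (tangent_space Z y)"
      using flow_dim_tangent_le[OF \<Phi>(1) y, of s] flow_dim_tangent_le[OF \<Phi>(1) flow_in[OF \<Phi>(1) y], of s "- s"]
      by (simp add: \<Phi>(2) flow_inverse[OF \<Phi>(1) y])
    then show ?case
      using step.IH flow_in[OF \<Phi>(1) y] flexible_at_flow[OF \<Phi>(1) y] \<Phi>(2) by auto
  qed
  then show "q \<in> Z" "vec.dim (tangent_space Z q) = vec.dim (tangent_space Z p)"
    "flexible_at Z q \<Longrightarrow> flexible_at Z p" by auto
qed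

text \<open>
  If the orbit were not dense, the coordinates of a chart would satisfy a relation on the part of
  the orbit covered by the chart. This relation persists along flows, so it can be differentiated along
  all velocities, hence in all tangent directions, until it becomes a nonzero constant.
\<close>

lemma orbit_dense:
  fixes X :: "('k::field_char_0^'n) set"
  assumes X: "flexible X" and x: "x \<in> smooth_locus X" and h: "h \<in> polyfun" "\<not> vanishes_on h X"
  shows "\<exists>q. reach X x q \<and> h q \<noteq> 0"
proof (rule ccontr)
  assume no: "\<nexists>q. reach X x q \<and> h q \<noteq> 0"
  have irr: "zariski_irreducible X"
    using X by (simp add: flexible_def irreducible_affine_variety_def)
  have xX: "x \<in> X" and dimx: "vec.dim (tangent_space X x) = var_dim X"
    using x by (auto simp: smooth_locus_def)
  obtain \<Delta> and I :: "'n set" where \<Delta>: "\<Delta> \<in> polyfun" "\<Delta> x \<noteq> 0" and I: "card I = vec.dim (tangent_space X x)"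
    and inj: "\<And>y v. \<Delta> y \<noteq> 0 \<Longrightarrow> v \<in> tangent_space X y \<Longrightarrow> (\<And>i. i \<in> I \<Longrightarrow> v $ i = 0) \<Longrightarrow> v = 0"
    using tangent_chart[where x\<^sub>0 = x and X = X] by blast
  define U where "U = {q. reach X x q \<and> \<Delta> q \<noteq> 0}"
  let ?t = "var_dim X"
  obtain b where b: "bij_betw b {..<?t} I"
    using ex_bij_betw_nat_finite[of I] I dimx by (auto simp: atLeast0LessThan)
  have "U \<subseteq> X" using reach_in xX by (auto simp: U_def)
  moreover have "vanishes_on h U" using no by (auto simp: U_def vanishes_on_def)
  ultimately obtain R where R: "R \<noteq> 0" "mp_vars R \<subseteq> {..<?t}" "vanishes_on (\<lambda>x. mp_eval (\<lambda>i. x $ b i) R) U"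
    using relation_on_hypersurface[OF irr h] by blast
  have "R = 0"
  proof (rule no_relation_if_closed_under_pderiv[OF _ _ R(2,3)])
    show "U \<noteq> {}" using \<Delta>(2) reach_refl by (auto simp: U_def)
    fix Q :: "(nat, 'k) mpoly" and j
    assume Q: "mp_vars Q \<subseteq> {..<?t}" "vanishes_on (\<lambda>x. mp_eval (\<lambda>i. x $ b i) Q) U" and j: "j < ?t"
    let ?F = "\<lambda>x. mp_eval (\<lambda>i. x $ b i) Q"
    have F: "?F \<in> polyfun" by (rule subalg_mp_eval[OF subalg_polyfun polyfun_coord])
    show "vanishes_on (\<lambda>x. mp_eval (\<lambda>i. x $ b i) (mp_pderiv j Q)) U"
      unfolding vanishes_on_def
    proof
      fix q assume q: "q \<in> U"
      then have qX: "q \<in> X" and reach: "reach X x q" and \<Delta>q: "\<Delta> q \<noteq> 0" and dimq: "vec.dim (tangent_space X q) = ?t"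
        using reach_in[OF _ xX] reach_dim[OF _ xX] dimx by (auto simp: U_def)
      have "flexible_at X q"
        using X qX dimq by (auto simp: flexible_iff smooth_locus_def)
      have vel: "dd ?F q (velocity \<Phi> q) = 0" if \<Phi>: "flow X \<Phi>" for \<Phi>
      proof -
        have pc: "pcurve (\<lambda>s. G (\<Phi> s q))" if "G \<in> polyfun" for G
          by (rule pcurve_polyfun[OF that polyfam_pcurve[OF flow_polyfam[OF \<Phi>] qX]])
        obtain r1 where r1: "\<forall>s. ?F (\<Phi> s q) = poly r1 s" using pc[OF F] unfolding pcurve_def by blast
        obtain r2 where r2: "\<forall>s. \<Delta> (\<Phi> s q) = poly r2 s" using pc[OF \<Delta>(1)] unfolding pcurve_def by blast
        \<comment> \<open>the flow may leave the chart, but only at the finitely many zeros of \<open>r2\<close>\<close>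
        have "poly (r1 * r2) s = 0" for s
        proof (cases "\<Delta> (\<Phi> s q) = 0")
          case False
          then have "\<Phi> s q \<in> U" using reach_trans[OF reach reach_flow[OF \<Phi>]] by (auto simp: U_def)
          then have "?F (\<Phi> s q) = 0" using Q(2) by (auto simp: vanishes_on_def)
          then show ?thesis using r1 by simp
        qed (use r2 in simp)
        then have "r1 * r2 = 0" using poly_all_0_iff_0 by blast
        moreover have "poly r2 0 \<noteq> 0" using r2[rule_format, of 0] \<Delta>q by (simp add: flow_zero[OF \<Phi> qX])
        ultimately have "r1 = 0" by auto
        then have "deriv_at_0 (\<lambda>s. ?F (\<Phi> s q)) = 0" using r1 by simp
        then show ?thesis by (simp add: flow_polyfun_velocity[OF \<Phi> qX F])
      qed
      have "dd ?F q v = 0" if "v \<in> vec.span {velocity \<Phi> q | \<Phi>. flow X \<Phi>}" for v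
        using that by (induction rule: vec.span_induct_alt) (auto simp: dd_add_vec[OF F] dd_scale_vec[OF F] vel)
      then have tan: "dd ?F q v = 0" if "v \<in> tangent_space X q" for v
        using that \<open>flexible_at X q\<close> by (auto simp: flexible_at_def)
      have "\<exists>v\<in>tangent_space X q. \<forall>i\<in>I. v $ i = (if i = b j then 1 else 0)"
        by (rule coords_surj_if_dim_eq[OF subspace_tangent_space])
          (rule inj[OF \<Delta>q], use I dimx dimq in auto)
      then obtain v where v: "v \<in> tangent_space X q" "\<forall>i\<in>I. v $ i = (if i = b j then 1 else 0)"
        by blast
      have "0 = (\<Sum>i<?t. mp_eval (\<lambda>i. q $ b i) (mp_pderiv i Q) * v $ b i)"
        using pd_mp_eval[OF subalg_polyfun point_derivation_dd finite_lessThan Q(1), of "\<lambda>i x. x $ b i" q v] tan[OF v(1)]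
        by (simp add: polyfun_coord)
      also have "\<dots> = (\<Sum>i<?t. if i = j then mp_eval (\<lambda>i. q $ b i) (mp_pderiv i Q) else 0)"
      proof (rule sum.cong[OF refl])
        fix i assume i: "i \<in> {..<?t}"
        have "b i \<in> I" "b i = b j \<longleftrightarrow> i = j"
          using b i j by (auto simp: bij_betw_def inj_on_def)
        then show "mp_eval (\<lambda>i. q $ b i) (mp_pderiv i Q) * v $ b i =
          (if i = j then mp_eval (\<lambda>i. q $ b i) (mp_pderiv i Q) else 0)"
          using v(2) by auto
      qed
      finally show "mp_eval (\<lambda>i. q $ b i) (mp_pderiv j Q) = 0" using j by simp
    qed
  qed
  then show False using R(1) by simp
qed

subsection \<open>The exponential of a locally nilpotent derivation\<close>

definition on_variety :: "('k::field^'n) set \<Rightarrow> ('k^'n \<Rightarrow> 'k) \<Rightarrow> 'k^'n \<Rightarrow> 'k" where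
  "on_variety X F = (\<lambda>x. if x \<in> X then F x else 0)"

lemma on_variety_coord_ring: "F \<in> polyfun \<Longrightarrow> on_variety X F \<in> coord_ring X"
  unfolding on_variety_def by (rule coord_ring_restrict)

lemma coord_ring_eq: "coord_ring X = on_variety X ` polyfun"
proof (intro equalityI subsetI)
  fix a assume a: "a \<in> coord_ring X"
  obtain F where "F \<in> polyfun" "\<And>x. x \<in> X \<Longrightarrow> a x = F x" using coord_ring_lift[OF a] by metis
  then show "a \<in> on_variety X ` polyfun"
    using coord_ring_outside[OF a] by (intro image_eqI[of _ _ F]) (auto simp: on_variety_def)
qed (auto simp: on_variety_coord_ring)

lemma coord_ring_add: "a \<in> coord_ring X \<Longrightarrow> b \<in> coord_ring X \<Longrightarrow> (\<lambda>x. a x + b x) \<in> coord_ring X"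
  and coord_ring_mult: "a \<in> coord_ring X \<Longrightarrow> b \<in> coord_ring X \<Longrightarrow> (\<lambda>x. a x * b x) \<in> coord_ring X"
proof -
  assume "a \<in> coord_ring X" "b \<in> coord_ring X"
  then obtain F G where FG: "F \<in> polyfun" "G \<in> polyfun" "a = on_variety X F" "b = on_variety X G"
    by (auto simp: coord_ring_eq)
  have "(\<lambda>x. a x + b x) = on_variety X (\<lambda>x. F x + G x)" "(\<lambda>x. a x * b x) = on_variety X (\<lambda>x. F x * G x)"
    by (simp_all add: FG on_variety_def fun_eq_iff)
  then show "(\<lambda>x. a x + b x) \<in> coord_ring X" "(\<lambda>x. a x * b x) \<in> coord_ring X"
    using on_variety_coord_ring[OF polyfun_add[OF FG(1,2)], of X] on_variety_coord_ring[OF polyfun_mult[OF FG(1,2)], of X]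
    by simp_all
qed

lemma coord_ring_zero: "(\<lambda>_. 0) \<in> coord_ring X"
  using on_variety_coord_ring[OF polyfun_const[of 0], of X] by (simp add: on_variety_def cong: if_cong)

context
  fixes X :: "('k::field_char_0^'n) set" and \<delta>
  assumes \<delta>: "\<delta> \<in> LND X"
begin

lemma
  shows der_in: "a \<in> coord_ring X \<Longrightarrow> \<delta> a \<in> coord_ring X"
    and der_add: "a \<in> coord_ring X \<Longrightarrow> b \<in> coord_ring X \<Longrightarrow> \<delta> (\<lambda>x. a x + b x) = (\<lambda>x. \<delta> a x + \<delta> b x)"
    and der_cmult: "a \<in> coord_ring X \<Longrightarrow> \<delta> (\<lambda>x. c * a x) = (\<lambda>x. c * \<delta> a x)"
    and der_mult: "a \<in> coord_ring X \<Longrightarrow> b \<in> coord_ring X \<Longrightarrow>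
      \<delta> (\<lambda>x. a x * b x) = (\<lambda>x. \<delta> a x * b x + a x * \<delta> b x)"
    and der_nilpotent: "a \<in> coord_ring X \<Longrightarrow> \<exists>n. (\<delta> ^^ n) a = (\<lambda>_. 0)"
  using \<delta> by (simp_all add: LND_def derivation_def)

lemma der_zero: "\<delta> (\<lambda>_. 0) = (\<lambda>_. 0)"
  using der_cmult[OF coord_ring_zero, of 0] by simp

lemma der_const: "\<delta> (on_variety X (\<lambda>_. c)) = (\<lambda>_. 0)"
proof -
  let ?e = "on_variety X (\<lambda>_. 1 :: 'k)"
  have e: "?e \<in> coord_ring X" by (rule on_variety_coord_ring[OF polyfun_const])
  have "(\<lambda>x. ?e x * ?e x) = ?e" by (simp add: on_variety_def fun_eq_iff)
  then have "\<delta> ?e = (\<lambda>x. \<delta> ?e x * ?e x + ?e x * \<delta> ?e x)"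
    using der_mult[OF e e] by simp
  then have eq: "\<delta> ?e x = \<delta> ?e x * ?e x + ?e x * \<delta> ?e x" for x
    by (rule fun_cong)
  have "\<delta> ?e x = 0" for x
  proof (cases "x \<in> X")
    case True
    then have "?e x = 1" by (simp add: on_variety_def)
    then show ?thesis using eq[of x] by simp
  qed (use coord_ring_outside[OF der_in[OF e]] in blast)
  moreover have "on_variety X (\<lambda>_. c) = (\<lambda>x. c * ?e x)" by (simp add: on_variety_def fun_eq_iff)
  ultimately show ?thesis using der_cmult[OF e, of c] by simp
qed

lemma der_iter_in: "a \<in> coord_ring X \<Longrightarrow> (\<delta> ^^ n) a \<in> coord_ring X"
  by (induction n) (simp_all add: der_in)

lemma der_iter_zero: "(\<delta> ^^ n) a = (\<lambda>_. 0) \<Longrightarrow> n \<le> m \<Longrightarrow> (\<delta> ^^ m) a = (\<lambda>_. 0)"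
proof (induction m)
  case (Suc m)
  then show ?case by (cases "n \<le> m") (auto simp: der_zero le_Suc_eq)
qed simp

text \<open>The value at \<open>x\<close> of \<open>exp(s\<delta>)(a)\<close>, as a polynomial in \<open>s\<close>.\<close>

definition exp_der :: "('k^'n \<Rightarrow> 'k) \<Rightarrow> 'k^'n \<Rightarrow> 'k poly" where
  "exp_der a x = (\<Sum>j<(LEAST n. (\<delta> ^^ n) a = (\<lambda>_. 0)). monom ((\<delta> ^^ j) a x / fact j) j)"

lemma coeff_exp_der:
  assumes "a \<in> coord_ring X"
  shows "coeff (exp_der a x) j = (\<delta> ^^ j) a x / fact j"
proof -
  let ?n = "LEAST n. (\<delta> ^^ n) a = (\<lambda>_. 0)"
  have "(\<delta> ^^ ?n) a = (\<lambda>_. 0)" using der_nilpotent[OF assms] by (rule LeastI_ex)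
  then have "(\<delta> ^^ j) a x = 0" if "?n \<le> j" using der_iter_zero[OF _ that] by metis
  then show ?thesis
    by (auto simp: exp_der_def coeff_sum not_less[symmetric])
qed

lemma exp_der_0: "a \<in> coord_ring X \<Longrightarrow> poly (exp_der a x) 0 = a x"
  by (simp add: poly_0_coeff_0 coeff_exp_der)

lemma pderiv_exp_der: "a \<in> coord_ring X \<Longrightarrow> pderiv (exp_der a x) = exp_der (\<delta> a) x"
  by (rule poly_eqI)
    (simp add: coeff_pderiv coeff_exp_der der_in funpow_swap1 divide_simps del: of_nat_Suc)

lemma exp_der_zero: "exp_der (\<lambda>_. 0) x = 0"
proof (rule poly_eqI)
  fix j
  have "(\<delta> ^^ j) (\<lambda>_. 0) = (\<lambda>_. 0)" using der_iter_zero[of 0 "\<lambda>_. 0" j] by simp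
  then show "coeff (exp_der (\<lambda>_. 0) x) j = coeff 0 j" by (simp add: coeff_exp_der[OF coord_ring_zero])
qed

lemma poly_eq_if_pderiv_eq:
  fixes p q :: "'k poly"
  assumes "pderiv p = pderiv q" "poly p 0 = poly q 0"
  shows "p = q"
proof -
  have "pderiv (p - q) = 0" using assms by (simp add: pderiv_diff)
  then obtain c where c: "p - q = [:c:]" using pderiv_iszero by blast
  have "poly (p - q) 0 = 0" using assms(2) by simp
  then have "p - q = 0" unfolding c by simp
  then show ?thesis by simp
qed

lemma exp_der_add:
  assumes "a \<in> coord_ring X" "b \<in> coord_ring X"
  shows "exp_der (\<lambda>x. a x + b x) x = exp_der a x + exp_der b x"
proof -
  have "(\<delta> ^^ j) (\<lambda>x. a x + b x) = (\<lambda>x. (\<delta> ^^ j) a x + (\<delta> ^^ j) b x)" for j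
    by (induction j) (simp_all add: der_add der_iter_in assms)
  then show ?thesis
    by (intro poly_eqI) (simp add: coeff_exp_der coord_ring_add assms add_divide_distrib)
qed

text \<open>Both sides have the same derivative in \<open>s\<close>, by induction on the orders of nilpotency.\<close>

lemma exp_der_mult:
  assumes "a \<in> coord_ring X" "b \<in> coord_ring X"
  shows "exp_der (\<lambda>x. a x * b x) x = exp_der a x * exp_der b x"
proof -
  obtain m n where "(\<delta> ^^ m) a = (\<lambda>_. 0)" "(\<delta> ^^ n) b = (\<lambda>_. 0)"
    using der_nilpotent assms by blast
  then show ?thesis using assms
  proof (induction "m + n" arbitrary: a b m n rule: less_induct)
    case less
    note ab = less.prems(3,4)
    show ?case
    proof (cases "m = 0 \<or> n = 0")
      case True
      then have "a = (\<lambda>_. 0) \<or> b = (\<lambda>_. 0)" using less.prems by auto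
      then show ?thesis by (auto simp: exp_der_zero)
    next
      case False
      then obtain m' n' where mn: "m = Suc m'" "n = Suc n'" by (meson not0_implies_Suc)
      have da: "(\<delta> ^^ m') (\<delta> a) = (\<lambda>_. 0)" and db: "(\<delta> ^^ n') (\<delta> b) = (\<lambda>_. 0)"
        using less.prems by (simp_all add: mn funpow_swap1)
      have "pderiv (exp_der (\<lambda>x. a x * b x) x) = exp_der (\<lambda>x. \<delta> a x * b x + a x * \<delta> b x) x"
        by (simp add: pderiv_exp_der coord_ring_mult ab der_mult)
      also have "\<dots> = exp_der (\<lambda>x. \<delta> a x * b x) x + exp_der (\<lambda>x. a x * \<delta> b x) x"
        by (intro exp_der_add coord_ring_mult der_in ab)
      also have "\<dots> = exp_der (\<delta> a) x * exp_der b x + exp_der a x * exp_der (\<delta> b) x"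
        using less.hyps[of m' n "\<delta> a" b] less.hyps[of m n' a "\<delta> b"] less.prems da db
        by (simp add: mn der_in)
      also have "\<dots> = pderiv (exp_der a x * exp_der b x)"
        by (simp add: pderiv_mult pderiv_exp_der ab algebra_simps)
      finally show ?thesis
        by (rule poly_eq_if_pderiv_eq) (simp add: exp_der_0 coord_ring_mult ab)
    qed
  qed
qed

definition exp_flow :: "'k \<Rightarrow> 'k^'n \<Rightarrow> 'k^'n" where
  "exp_flow s x = (\<chi> i. poly (exp_der (on_variety X (\<lambda>x. x $ i)) x) s)"

lemma polyfun_exp_flow:
  assumes "F \<in> polyfun" "x \<in> X"
  shows "F (exp_flow s x) = poly (exp_der (on_variety X F) x) s"
  using assms(1)
proof induction
  case (polyfun_const c)
  have "exp_der (on_variety X (\<lambda>_. c)) x = [:c:]"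
    by (rule poly_eq_if_pderiv_eq)
      (simp_all add: pderiv_exp_der on_variety_coord_ring polyfun.polyfun_const der_const exp_der_zero exp_der_0,
        simp add: on_variety_def assms)
  then show ?case by simp
next
  case (polyfun_coord i)
  then show ?case by (simp add: exp_flow_def)
next
  case (polyfun_add F G)
  have "on_variety X (\<lambda>x. F x + G x) = (\<lambda>x. on_variety X F x + on_variety X G x)"
    by (simp add: on_variety_def fun_eq_iff)
  then show ?case using polyfun_add by (simp add: exp_der_add on_variety_coord_ring)
next
  case (polyfun_mult F G)
  have "on_variety X (\<lambda>x. F x * G x) = (\<lambda>x. on_variety X F x * on_variety X G x)"
    by (simp add: on_variety_def fun_eq_iff)
  then show ?case using polyfun_mult by (simp add: exp_der_mult on_variety_coord_ring)
qed

lemma exp_flow_in: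
  assumes "zariski_closed X" "x \<in> X"
  shows "exp_flow s x \<in> X"
proof -
  obtain S where S: "X = {x. \<forall>p\<in>S. mp_eval (($) x) p = 0}"
    using assms(1) by (auto simp: zariski_closed_def)
  have "mp_eval (($) (exp_flow s x)) p = 0" if "p \<in> S" for p
  proof -
    have "on_variety X (\<lambda>x. mp_eval (($) x) p) = (\<lambda>_. 0)"
      using S that by (auto simp: on_variety_def fun_eq_iff)
    then show ?thesis using polyfun_exp_flow[OF polyfun_mp_eval assms(2)] by (simp add: exp_der_zero)
  qed
  then show ?thesis by (subst S) blast
qed

lemma coord_ring_exp_flow:
  assumes "zariski_closed X" "x \<in> X" "a \<in> coord_ring X"
  shows "a (exp_flow s x) = poly (exp_der a x) s"
proof -
  obtain F where F: "F \<in> polyfun" "a = on_variety X F" using assms(3) by (auto simp: coord_ring_eq)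
  then show ?thesis
    using polyfun_exp_flow[OF F(1) assms(2), of s] exp_flow_in[OF assms(1,2), of s]
    by (simp add: on_variety_def)
qed

text \<open>
  Taylor's formula. Again both sides have the same derivative and the same value at \<open>0\<close>.
\<close>

lemma exp_der_exp_flow:
  assumes X: "zariski_closed X" and x: "x \<in> X" and a: "a \<in> coord_ring X"
  shows "exp_der a (exp_flow t x) = pcompose (exp_der a x) [:t, 1:]"
proof -
  obtain n where "(\<delta> ^^ n) a = (\<lambda>_. 0)" using der_nilpotent[OF a] by blast
  then show ?thesis using a
  proof (induction n arbitrary: a)
    case 0
    then show ?case by (simp add: exp_der_zero)
  next
    case (Suc n)
    have "(\<delta> ^^ n) (\<delta> a) = (\<lambda>_. 0)" using Suc.prems by (simp add: funpow_swap1)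
    then have IH: "exp_der (\<delta> a) (exp_flow t x) = pcompose (exp_der (\<delta> a) x) [:t, 1:]"
      by (rule Suc.IH) (rule der_in[OF Suc.prems(2)])
    show ?case
    proof (rule poly_eq_if_pderiv_eq)
      show "pderiv (exp_der a (exp_flow t x)) = pderiv (pcompose (exp_der a x) [:t, 1:])"
        by (simp add: pderiv_pcompose pderiv_exp_der Suc.prems IH pderiv_pCons)
      show "poly (exp_der a (exp_flow t x)) 0 = poly (pcompose (exp_der a x) [:t, 1:]) 0"
        by (simp add: exp_der_0 Suc.prems poly_pcompose coord_ring_exp_flow[OF X x])
    qed
  qed
qed

lemma flow_exp_flow:
  assumes X: "zariski_closed X"
  shows "flow X exp_flow"
  unfolding flow_def
proof (intro conjI allI ballI)
  fix s t x assume x: "x \<in> X"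
  have co: "on_variety X (\<lambda>x. x $ i) \<in> coord_ring X" for i by (rule on_variety_coord_ring[OF polyfun_coord])
  show "exp_flow s x \<in> X" by (rule exp_flow_in[OF X x])
  show "exp_flow 0 x = x" using x by (simp add: exp_flow_def exp_der_0[OF co] vec_eq_iff) (simp add: on_variety_def)
  show "exp_flow (s + t) x = exp_flow s (exp_flow t x)"
    unfolding exp_flow_def[of s] exp_der_exp_flow[OF X x co]
    by (simp add: exp_flow_def poly_pcompose add.commute)
next
  fix i
  let ?a = "on_variety X (\<lambda>x. x $ i)"
  have a: "?a \<in> coord_ring X" by (rule on_variety_coord_ring[OF polyfun_coord])
  let ?n = "LEAST n. (\<delta> ^^ n) ?a = (\<lambda>_. 0)"
  have "\<exists>F\<in>polyfun. \<forall>x\<in>X. (\<delta> ^^ j) ?a x = F x" for j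
    using coord_ring_lift[OF der_iter_in[OF a]] by metis
  then obtain F where F: "\<And>j. F j \<in> polyfun" "\<And>j x. x \<in> X \<Longrightarrow> (\<delta> ^^ j) ?a x = F j x" by metis
  have "polyfam X (\<lambda>s x. \<Sum>j<?n. F j x * (1 / fact j) * s ^ j)"
    by (intro polyfam_sum polyfam_mult polyfam_power polyfam_time polyfam_const polyfam_polyfun F)
  then show "polyfam X (\<lambda>s x. exp_flow s x $ i)"
    by (subst polyfam_cong[where h = "\<lambda>s x. \<Sum>j<?n. F j x * (1 / fact j) * s ^ j"])
      (simp_all add: exp_flow_def exp_der_def poly_sum poly_monom F(2))
qed

end

lemma LND_flow:
  fixes X :: "('k::field_char_0^'n) set"
  assumes X: "zariski_closed X" and \<delta>: "\<delta> \<in> LND X"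
    and f: "f \<in> coord_ring X" "\<delta> (\<delta> f) = (\<lambda>_. 0)"
  obtains \<Phi> where "flow X \<Phi>" "\<And>s x. x \<in> X \<Longrightarrow> f (\<Phi> s x) = f x + s * \<delta> f x"
proof -
  have "exp_der \<delta> f x = [:f x, \<delta> f x:]" for x
  proof (rule poly_eqI)
    fix j
    have "(\<delta> ^^ Suc (Suc i)) f = (\<lambda>_. 0)" for i
      by (rule der_iter_zero[OF \<delta>, of 2]) (simp_all add: f numeral_2_eq_2)
    then show "coeff (exp_der \<delta> f x) j = coeff [:f x, \<delta> f x:] j"
      using coeff_exp_der[OF \<delta> f(1), of x j] by (auto simp: coeff_pCons split: nat.split)
  qed
  then show thesis
    using that[OF flow_exp_flow[OF \<delta> X]] coord_ring_exp_flow[OF \<delta> X _ f(1)] by simp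
qed

section \<open>Suspensions\<close>

subsection \<open>Roots\<close>

text \<open>
  In characteristic zero \<open>t\<^sup>k - b\<close> is separable, so it has more than \<open>degree R\<close> roots.
\<close>

lemma poly_zero_if_vanishes_on_roots:
  fixes R :: "'k::{alg_closed_field, field_char_0} poly"
  assumes b: "b \<noteq> 0" and R: "degree R < k" "\<And>t. t ^ k = b \<Longrightarrow> poly R t = 0"
  shows "R = 0"
proof (rule ccontr)
  assume "R \<noteq> 0"
  have k: "k > 0" using R(1) by simp
  define q where "q = monom 1 k + [:- b:]"
  have deg: "degree q = k" unfolding q_def using k by (subst degree_add_eq_left) (simp_all add: degree_monom_eq)
  have q0: "q \<noteq> 0" using deg k by auto
  have ev: "poly q t = t ^ k - b" for t by (simp add: q_def poly_monom)
  from alg_closed_imp_factorization[OF q0]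
  obtain A where A0: "size A = degree q \<and> q = smult (lead_coeff q) (\<Prod>x\<in>#A. [:-x, 1:])" ..
  have A1: "size A = k" using conjunct1[OF A0] deg by (rule trans)
  note A2 = conjunct2[OF A0]
  have root: "x ^ k = b" if xA: "x \<in># A" for x
  proof -
    obtain B where "A = add_mset x B" using multi_member_split[OF xA] by blast
    then have "poly q x = 0" by (subst A2) simp
    then show ?thesis by (simp add: ev)
  qed
  have "count A x \<le> 1" for x
  proof (rule ccontr)
    assume "\<not> count A x \<le> 1"
    then have c: "count A x \<ge> 2" by simp
    then have x: "x \<in># A" by (auto simp flip: count_greater_zero_iff)
    from multi_member_split[OF x] obtain B where B: "A = add_mset x B" ..
    then have xB: "x \<in># B" using c by (auto simp flip: count_greater_zero_iff)
    from multi_member_split[OF xB] obtain C where C: "B = add_mset x C" ..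
    define r where "r = smult (lead_coeff q) (\<Prod>x\<in>#C. [:-x, 1:])"
    have "q = [:-x, 1:] * ([:-x, 1:] * r)"
      by (subst A2) (simp add: B C r_def mult.assoc)
    then have "poly (pderiv q) x = 0" by (simp add: pderiv_mult pderiv_pCons del: mult_pCons_left)
    moreover have "pderiv q = monom (of_nat k) (k - 1)"
      by (simp add: q_def pderiv_add pderiv_monom pderiv_pCons)
    ultimately have "x = 0" using k by (simp add: poly_monom)
    then show False using root[OF x] b k by (simp add: power_0_left)
  qed
  then have "size A \<le> (\<Sum>x\<in>set_mset A. 1)"
    unfolding size_multiset_overloaded_eq by (intro sum_mono)
  then have "k \<le> card (set_mset A)" using A1 by simp
  also have "\<dots> \<le> card {t. poly R t = 0}"
    by (rule card_mono) (use R(2) root poly_roots_finite[OF \<open>R \<noteq> 0\<close>] in auto)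
  also have "\<dots> \<le> degree R" by (rule card_poly_roots_bound[OF \<open>R \<noteq> 0\<close>])
  finally show False using R(1) by simp
qed

lemma ex_root:
  fixes b :: "'k::alg_closed_field"
  assumes "k > 0" shows "\<exists>t. t ^ k = b"
  using nth_root_exists[OF assms, of b] by auto

lemma pcurve_zero_if_cofinite:
  fixes c d :: "'k::field_char_0 \<Rightarrow> 'k"
  assumes "pcurve c" "pcurve d" "d s\<^sub>0 \<noteq> 0" "\<And>s. d s \<noteq> 0 \<Longrightarrow> c s = 0"
  shows "c s = 0"
proof -
  obtain p q where p: "\<And>s. c s = poly p s" and q: "\<And>s. d s = poly q s"
    using assms(1,2) by (auto simp: pcurve_def)
  have "poly (p * q) s = 0" for s using assms(4)[of s] p q by (cases "d s = 0") auto
  then have "p * q = 0" using poly_all_0_iff_0 by blast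
  moreover have "q \<noteq> 0" using assms(3) q by auto
  ultimately show ?thesis using p by simp
qed

subsection \<open>The suspension and its tangent spaces\<close>

lemma vfst_vjoin [simp]: "vfst (vjoin x w) = x"
  and vsnd_vjoin [simp]: "vsnd (vjoin x w) = w"
  and vjoin_vfst_vsnd [simp]: "vjoin (vfst z) (vsnd z) = z"
  and vjoin_Inl [simp]: "vjoin x w $ Inl a = x $ a"
  and vjoin_Inr [simp]: "vjoin x w $ Inr b = w $ b"
  and vfst_nth [simp]: "vfst z $ a = z $ Inl a"
  and vsnd_nth [simp]: "vsnd z $ b = z $ Inr b"
  by (auto simp: vfst_def vsnd_def vjoin_def vec_eq_iff split: sum.split)

lemma vjoin_ex: obtains x w where "z = vjoin x w"
  by (metis vjoin_vfst_vsnd)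

definition cofactor :: "('q \<Rightarrow> nat) \<Rightarrow> 'q \<Rightarrow> 'k::comm_ring_1^'q::finite \<Rightarrow> 'k" where
  "cofactor \<kappa> i w = (\<Prod>j\<in>UNIV - {i}. w $ j ^ \<kappa> j)"

definition suspension :: "('k::comm_ring_1^'n) set \<Rightarrow> ('k^'n \<Rightarrow> 'k) \<Rightarrow> ('q \<Rightarrow> nat) \<Rightarrow> ('k^('n::finite + 'q::finite)) set" where
  "suspension X F \<kappa> = {z. vfst z \<in> X \<and> (\<Prod>i\<in>UNIV. vsnd z $ i ^ \<kappa> i) = F (vfst z)}"

lemma prod_eq_cofactor: "(\<Prod>i\<in>UNIV. w $ i ^ \<kappa> i) = w $ i ^ \<kappa> i * cofactor \<kappa> i w"
  unfolding cofactor_def by (rule prod.remove) simp_all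

lemma cofactor_zero: "w $ a = 0 \<Longrightarrow> \<kappa> a \<noteq> 0 \<Longrightarrow> a \<noteq> i \<Longrightarrow> cofactor \<kappa> i w = 0"
  unfolding cofactor_def by (rule prod_zero) (auto simp: power_0_left intro!: bexI[of _ a])

lemma cofactor_cong: "(\<And>j. j \<noteq> i \<Longrightarrow> w $ j = w' $ j) \<Longrightarrow> cofactor \<kappa> i w = cofactor \<kappa> i w'"
  unfolding cofactor_def by (rule prod.cong) auto

lemma polyfun_vfst: "F \<in> polyfun \<Longrightarrow> (\<lambda>z. F (vfst z)) \<in> polyfun"
  and polyfun_vsnd: "G \<in> polyfun \<Longrightarrow> (\<lambda>z. G (vsnd z)) \<in> polyfun"
  by (rule polyfun_compose; simp add: polyfun_coord)+

lemma polyfun_cofactor: "cofactor \<kappa> i \<in> polyfun"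
  unfolding cofactor_def[abs_def] by (intro polyfun_prod polyfun_power polyfun_coord)

lemma dd_vfst: "F \<in> polyfun \<Longrightarrow> dd (\<lambda>z. F (vfst z)) z v = dd F (vfst z) (vfst v)"
  by (subst dd_compose) (simp_all add: polyfun_coord vec_lambda_eta flip: vfst_def)

lemma cofactor_prod_power:
  "(\<Prod>i\<in>UNIV. w $ i ^ (\<kappa> i - (if i = j then 1 else 0))) = w $ j ^ (\<kappa> j - 1) * cofactor \<kappa> j w"
proof -
  have "(\<Prod>i\<in>UNIV. w $ i ^ (\<kappa> i - (if i = j then 1 else 0))) =
    w $ j ^ (\<kappa> j - 1) * (\<Prod>i\<in>UNIV - {j}. w $ i ^ (\<kappa> i - (if i = j then 1 else 0)))"
    by (subst prod.remove[of _ j]) simp_all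
  also have "(\<Prod>i\<in>UNIV - {j}. w $ i ^ (\<kappa> i - (if i = j then 1 else 0))) = cofactor \<kappa> j w"
    unfolding cofactor_def by (rule prod.cong) auto
  finally show ?thesis .
qed

definition monomial_differential :: "('q \<Rightarrow> nat) \<Rightarrow> 'k::comm_ring_1^'q::finite \<Rightarrow> 'k^'q \<Rightarrow> 'k" where
  "monomial_differential \<kappa> w \<eta> = (\<Sum>i\<in>UNIV. of_nat (\<kappa> i) * (w $ i ^ (\<kappa> i - 1) * cofactor \<kappa> i w) * \<eta> $ i)"

lemma dd_monomial:
  fixes z v :: "'k::field_char_0^('n::finite + 'q::finite)"
  shows "dd (\<lambda>z. \<Prod>i\<in>UNIV. vsnd z $ i ^ \<kappa> i) z v = monomial_differential \<kappa> (vsnd z) (vsnd v)"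
  using pd_monomial[OF subalg_polyfun point_derivation_dd[of z v], of UNIV "\<lambda>i z. vsnd z $ i" \<kappa>]
    cofactor_prod_power[of "vsnd z"]
  by (simp add: polyfun_coord monomial_differential_def)

text \<open>
  All factors of the monomial are treated alike; what distinguishes the two kinds of variables is only
  whether the exponent is one.
\<close>

locale irreducible_suspension =
  fixes X :: "('k::{alg_closed_field, field_char_0}^'n::finite) set" and F :: "'k^'n \<Rightarrow> 'k"
    and \<kappa> :: "'q::finite \<Rightarrow> nat" and Y :: "('k^('n + 'q)) set"
  defines "Y \<equiv> suspension X F \<kappa>"
  assumes X: "zariski_irreducible X" and F: "F \<in> polyfun" and F_nz: "\<not> vanishes_on F X"
    and \<kappa>: "\<And>i. \<kappa> i > 0" and Y: "zariski_irreducible Y"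
begin

lemma mem_Y: "vjoin x w \<in> Y \<longleftrightarrow> x \<in> X \<and> (\<Prod>i\<in>UNIV. w $ i ^ \<kappa> i) = F x"
  by (simp add: Y_def suspension_def)

lemma tangent_Y_necessary:
  assumes v: "v \<in> tangent_space Y z"
  shows "vfst v \<in> tangent_space X (vfst z)" "monomial_differential \<kappa> (vsnd z) (vsnd v) = dd F (vfst z) (vfst v)"
proof -
  show "vfst v \<in> tangent_space X (vfst z)"
    unfolding tangent_space_iff
  proof (intro ballI impI)
    fix H assume H: "H \<in> polyfun" "\<forall>x\<in>X. H x = 0"
    then have "dd (\<lambda>z. H (vfst z)) z v = 0"
      using v polyfun_vfst[OF H(1)] by (auto simp: tangent_space_iff Y_def suspension_def)
    then show "dd H (vfst z) (vfst v) = 0" by (simp add: dd_vfst[OF H(1)])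
  qed
  have mon: "(\<lambda>z. \<Prod>i\<in>UNIV. vsnd z $ i ^ \<kappa> i) \<in> polyfun"
    using polyfun_prod[OF polyfun_power[OF polyfun_coord]] by simp
  have "dd (\<lambda>z. (\<Prod>i\<in>UNIV. vsnd z $ i ^ \<kappa> i) - F (vfst z)) z v = 0"
    using v polyfun_diff[OF mon polyfun_vfst[OF F]] by (auto simp: tangent_space_iff Y_def suspension_def)
  then show "monomial_differential \<kappa> (vsnd z) (vsnd v) = dd F (vfst z) (vfst v)"
    by (simp add: dd_diff[OF mon polyfun_vfst[OF F]] dd_monomial dd_vfst[OF F] del: vsnd_nth)
qed

definition set_coord :: "'q \<Rightarrow> 'k^('n + 'q) \<Rightarrow> 'k \<Rightarrow> 'k^('n + 'q)" where
  "set_coord i z t = (\<chi> j. if j = Inr i then t else z $ j)"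

definition free_of :: "'q \<Rightarrow> ('k^('n + 'q) \<Rightarrow> 'k) set" where
  "free_of i = {H \<in> polyfun. \<forall>z t. H (set_coord i z t) = H z}"

lemma vfst_set_coord [simp]: "vfst (set_coord i z t) = vfst z"
  by (simp add: set_coord_def vec_eq_iff)

lemma subalg_free_of: "subalg (free_of i)"
  by (auto simp: subalg_def free_of_def intro: polyfun.intros)

lemma adjoin_free_of: "(\<lambda>P. poly P (\<lambda>z. z $ Inr i)) ` coeffs_in (free_of i) = polyfun"
proof (intro equalityI subsetI)
  fix H assume "H \<in> (\<lambda>P. poly P (\<lambda>z. z $ Inr i)) ` coeffs_in (free_of i)"
  then obtain P where P: "P \<in> coeffs_in (free_of i)" "H = poly P (\<lambda>z. z $ Inr i)" by auto
  then have "P \<in> coeffs_in polyfun" by (simp add: coeffs_in_def free_of_def)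
  then show "H \<in> polyfun"
    unfolding P(2) by (rule poly_in_subalg[OF subalg_polyfun _ polyfun_coord])
next
  let ?A = "(\<lambda>P. poly P (\<lambda>z. z $ Inr i)) ` coeffs_in (free_of i)"
  have A: "subalg ?A" by (rule subalg_adjoin[OF subalg_free_of])
  have coord: "(\<lambda>z. z $ j) \<in> ?A" for j
  proof (cases "j = Inr i")
    case True
    then show ?thesis using adjoin_generator[OF subalg_free_of] by simp
  next
    case False
    then have "(\<lambda>z. z $ j) \<in> free_of i" by (simp add: free_of_def polyfun_coord set_coord_def)
    then show ?thesis using adjoin_superset[OF subalg_free_of] by blast
  qed
  fix H :: "'k^('n + 'q) \<Rightarrow> 'k" assume "H \<in> polyfun"
  then show "H \<in> ?A"
    by induction (auto intro: coord subalg_const[OF A] subalg_add[OF A] subalg_mult[OF A])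
qed

lemma vfst_free_of: "H \<in> polyfun \<Longrightarrow> (\<lambda>z. H (vfst z)) \<in> free_of i"
  by (simp add: free_of_def polyfun_vfst)

lemma cofactor_free_of: "(\<lambda>z. cofactor \<kappa> i (vsnd z)) \<in> free_of i"
  unfolding free_of_def using polyfun_vsnd[OF polyfun_cofactor, of \<kappa> i]
  by (auto intro!: cofactor_cong simp: set_coord_def)

lemma mem_Y_set_coord:
  assumes "vfst z \<in> X" "t ^ \<kappa> i * cofactor \<kappa> i (vsnd z) = F (vfst z)"
  shows "set_coord i z t \<in> Y"
proof -
  have "cofactor \<kappa> i (vsnd (set_coord i z t)) = cofactor \<kappa> i (vsnd z)"
    by (rule cofactor_cong) (simp add: set_coord_def)
  then show ?thesis
    using assms prod_eq_cofactor[of "vsnd (set_coord i z t)" \<kappa> i]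
    by (simp add: Y_def suspension_def del: vsnd_nth) (simp add: set_coord_def)
qed

lemma cofactor_shift_nz: "\<exists>s\<^sub>0. cofactor \<kappa> i (w + s\<^sub>0 *s (\<chi> j. if j = i then 0 else 1)) \<noteq> (0 :: 'k)"
proof -
  have "finite (range (\<lambda>j. - w $ j))" by simp
  then obtain s where s: "s \<notin> range (\<lambda>j. - w $ j)" using ex_new_if_finite[OF infinite_UNIV_char_0] by blast
  have "w $ j + s \<noteq> 0" for j
  proof
    assume "w $ j + s = 0"
    then have "s = - w $ j" by (simp add: eq_neg_iff_add_eq_0 add.commute)
    then show False using s by blast
  qed
  then show ?thesis by (intro exI[of _ s]) (simp add: cofactor_def)
qed

text \<open>
  Over a general point of the product of \<open>X\<close> with the other coordinates, the equation can be solved for \<open>w\<^sub>i\<close>.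
\<close>

lemma free_of_vanishes:
  assumes H: "H \<in> free_of i" "vanishes_on H Y" and x: "x \<in> X"
  shows "H (vjoin x w) = 0"
proof -
  let ?e = "(\<chi> j. if j = i then 0 else 1) :: 'k^'q"
  obtain s\<^sub>0 where s0: "cofactor \<kappa> i (w + s\<^sub>0 *s ?e) \<noteq> 0" using cofactor_shift_nz by blast
  have Hp: "H \<in> polyfun" using H(1) by (simp add: free_of_def)
  have "(\<lambda>w. H (vjoin x w)) \<in> polyfun"
  proof (rule polyfun_compose[OF Hp])
    fix j show "(\<lambda>w. vjoin x w $ j) \<in> polyfun" by (cases j) (simp_all add: polyfun_coord polyfun_const)
  qed
  then have "pcurve (\<lambda>s. H (vjoin x (w + s *s ?e)))" by (rule pcurve_polyfun_line)
  then have "H (vjoin x (w + 0 *s ?e)) = 0"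
  proof (rule pcurve_zero_if_cofinite[OF _ pcurve_polyfun_line[OF polyfun_cofactor] s0])
    fix s assume nz: "cofactor \<kappa> i (w + s *s ?e) \<noteq> 0"
    let ?z = "vjoin x (w + s *s ?e)"
    obtain t where t: "t ^ \<kappa> i = F x / cofactor \<kappa> i (w + s *s ?e)" using ex_root[OF \<kappa>] by blast
    have "set_coord i ?z t \<in> Y" by (rule mem_Y_set_coord) (use x t nz in simp_all)
    then have "H (set_coord i ?z t) = 0" using H(2) by (simp add: vanishes_on_def)
    then show "H ?z = 0" using H(1) by (simp add: free_of_def)
  qed
  then show ?thesis by simp
qed

lemma free_of_dd_zero:
  assumes H: "H \<in> free_of i" "vanishes_on H Y" and x: "x \<in> X" and \<xi>: "\<xi> \<in> tangent_space X x"
  shows "dd H (vjoin x w) (vjoin \<xi> \<eta>) = 0"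
proof -
  have Hp: "H \<in> polyfun" using H(1) by (simp add: free_of_def)
  have co: "(\<lambda>y. vjoin y w $ j) \<in> polyfun" for j :: "'n + 'q" and w
    by (cases j) (simp_all add: polyfun_coord polyfun_const)
  have "dd (\<lambda>y. H (vjoin y w)) x \<xi> = 0"
    using \<xi> polyfun_compose[OF Hp co] free_of_vanishes[OF H] by (auto simp: tangent_space_iff)
  moreover have "(\<chi> j. dd (\<lambda>y. vjoin y w $ j) x \<xi>) = vjoin \<xi> 0"
    by (auto simp: vec_eq_iff vjoin_def split: sum.split)
  ultimately have 1: "dd H (vjoin x w) (vjoin \<xi> 0) = 0"
    using dd_compose[OF Hp co, of w x \<xi>] by simp
  have "vjoin x w + s *s vjoin 0 \<eta> = vjoin x (w + s *s \<eta>)" for s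
    by (simp add: vec_eq_iff vjoin_def split: sum.split)
  then have 2: "dd H (vjoin x w) (vjoin 0 \<eta>) = 0"
    using free_of_vanishes[OF H x] by (simp add: dd_def)
  have "vjoin \<xi> \<eta> = vjoin \<xi> 0 + vjoin 0 \<eta>" by (simp add: vec_eq_iff vjoin_def split: sum.split)
  then show ?thesis using 1 2 by (simp add: dd_add_vec[OF Hp])
qed

text \<open>
  Over a general point the equation has \<open>\<kappa> i\<close> distinct roots \<open>w\<^sub>i\<close>, which are also roots of every relation.
\<close>

lemma short_relation_trivial:
  assumes P: "P \<in> coeffs_in (free_of i)" "vanishes_on (poly P (\<lambda>z. z $ Inr i)) Y" and deg: "degree P < \<kappa> i"
  shows "vanishes_on (lead_coeff P) Y"
proof -
  let ?U = "\<lambda>z. cofactor \<kappa> i (vsnd z)" and ?F = "\<lambda>z :: 'k^('n + 'q). F (vfst z)"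
  have U: "?U \<in> free_of i" by (rule cofactor_free_of)
  have l: "lead_coeff P \<in> polyfun" using P(1) by (simp add: coeffs_in_def free_of_def)
  have Up: "?U \<in> polyfun" by (rule polyfun_vsnd[OF polyfun_cofactor])
  have Fp: "?F \<in> polyfun" by (rule polyfun_vfst[OF F])
  have "vanishes_on (\<lambda>z. lead_coeff P z * (?U z * ?F z)) Y"
    unfolding vanishes_on_def
  proof
    fix z assume z: "z \<in> Y"
    show "lead_coeff P z * (?U z * ?F z) = 0"
    proof (cases "?U z * ?F z = 0")
      case False
      let ?R = "map_poly (\<lambda>H. H z) P"
      have "?R = 0"
      proof (rule poly_zero_if_vanishes_on_roots)
        show "?F z / ?U z \<noteq> 0" using False by auto
        have "degree ?R \<le> degree P" by (rule degree_le) (simp add: coeff_map_poly coeff_eq_0)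
        then show "degree ?R < \<kappa> i" using deg by simp
        fix t assume t: "t ^ \<kappa> i = ?F z / ?U z"
        have "set_coord i z t \<in> Y"
          by (rule mem_Y_set_coord) (use z t False in \<open>auto simp: Y_def suspension_def\<close>)
        then have "0 = poly P (\<lambda>z. z $ Inr i) (set_coord i z t)" using P(2) by (simp add: vanishes_on_def)
        also have "\<dots> = (\<Sum>j\<le>degree P. coeff P j (set_coord i z t) * t ^ j)"
          by (simp add: poly_altdef sum_fun_apply power_fun_apply set_coord_def)
        also have "\<dots> = (\<Sum>j\<le>degree P. coeff P j z * t ^ j)"
          using P(1) by (simp add: coeffs_in_def free_of_def)
        also have "\<dots> = poly ?R t" by (simp add: poly_fun_apply_sum flip: poly_fun_apply)
        finally show "poly ?R t = 0" by simp
      qed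
      then have "coeff ?R (degree P) = 0" by simp
      then show ?thesis by (simp add: coeff_map_poly)
    qed auto
  qed
  then have "vanishes_on (lead_coeff P) Y \<or> vanishes_on (\<lambda>z. ?U z * ?F z) Y"
    using irreducible_prime[OF Y l polyfun_mult[OF Up Fp]] by blast
  moreover have "\<not> vanishes_on ?U Y"
    using free_of_vanishes[OF U] X cofactor_shift_nz[of i 0]
    by (auto simp: zariski_irreducible_def)
  moreover have "\<not> vanishes_on ?F Y"
    using free_of_vanishes[OF vfst_free_of[OF F]] F_nz by (auto simp: vanishes_on_def)
  ultimately show ?thesis using irreducible_prime[OF Y Up Fp] by blast
qed

text \<open>
  The equation has minimal degree in \<open>w\<^sub>i\<close> among the relations. So where its leading coefficient, the
  cofactor, does not vanish, a derivation that respects the equation respects all relations.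
\<close>

lemma tangent_Y_sufficient:
  assumes z: "vjoin x w \<in> Y" and nz: "cofactor \<kappa> i w \<noteq> 0"
    and \<xi>: "\<xi> \<in> tangent_space X x" and eq: "monomial_differential \<kappa> w \<eta> = dd F x \<xi>"
  shows "vjoin \<xi> \<eta> \<in> tangent_space Y (vjoin x w)"
proof -
  let ?z = "vjoin x w" and ?v = "vjoin \<xi> \<eta>" and ?zi = "\<lambda>z :: 'k^('n + 'q). z $ Inr i" and ?A = "free_of i"
  let ?D = "\<lambda>H. dd H ?z ?v"
  define U where "U z = cofactor \<kappa> i (vsnd z)" for z :: "'k^('n + 'q)"
  define p where "p = monom U (\<kappa> i) - [:\<lambda>z. F (vfst z):]"
  have xX: "x \<in> X" using z by (simp add: mem_Y)
  have U: "U \<in> ?A" unfolding U_def[abs_def] by (rule cofactor_free_of)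
  have D: "point_derivation ?A ?z ?D"
    using point_derivation_dd[of ?z ?v] by (auto simp: point_derivation_def free_of_def)
  have pA: "p \<in> coeffs_in ?A"
    unfolding p_def
    by (intro coeffs_in_diff coeffs_in_monom subalg_free_of U)
      (simp add: coeffs_in_pCons[OF subalg_free_of] coeffs_in_zero[OF subalg_free_of] vfst_free_of F)
  have degp: "degree p \<le> \<kappa> i"
    unfolding p_def by (rule degree_diff_le) (simp_all add: degree_monom_le)
  have cop: "coeff p (\<kappa> i) = U"
    using \<kappa>[of i] by (cases "\<kappa> i") (simp_all add: p_def)
  have evp: "poly p ?zi = (\<lambda>z. (\<Prod>i\<in>UNIV. vsnd z $ i ^ \<kappa> i) - F (vfst z))"
    by (simp add: p_def poly_monom fun_eq_iff power_fun_apply U_def prod_eq_cofactor[of _ \<kappa> i] del: vsnd_nth)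
      (simp add: mult.commute)
  have ext: "extend_pd ?D ?z ?zi (\<eta> $ i) P = ?D (poly P ?zi)" if "P \<in> coeffs_in ?A" for P
    using that
  proof (induction P)
    case 0
    have "?D 0 = 0" using dd_const[of 0 ?z ?v] by (simp add: zero_fun_def)
    then show ?case by (simp add: extend_pd_zero[OF subalg_free_of D])
  next
    case (pCons a P)
    then have a: "a \<in> polyfun" and P: "P \<in> coeffs_in ?A" "P \<in> coeffs_in polyfun"
      by (auto simp: coeffs_in_pCons[OF subalg_free_of], auto simp: coeffs_in_def free_of_def)
    have Pz: "poly P ?zi \<in> polyfun" by (rule poly_in_subalg[OF subalg_polyfun P(2) polyfun_coord])
    have "poly (pCons a P) ?zi = (\<lambda>z. a z + ?zi z * poly P ?zi z)" by (simp add: fun_eq_iff)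
    then have E: "?D (poly (pCons a P) ?zi) = ?D a + (?z $ Inr i * ?D (poly P ?zi) + poly P ?zi ?z * \<eta> $ i)"
      by (simp add: dd_add dd_mult a Pz polyfun_mult polyfun_coord del: poly_pCons)
    show ?case
      unfolding extend_pd_pCons[OF subalg_free_of D] pCons.IH[OF P(1)] E by (simp add: mult.commute)
  qed
  have mon: "(\<lambda>z :: 'k^('n + 'q). \<Prod>i\<in>UNIV. vsnd z $ i ^ \<kappa> i) \<in> polyfun"
    using polyfun_prod[OF polyfun_power[OF polyfun_coord]] by simp
  have Ep: "extend_pd ?D ?z ?zi (\<eta> $ i) p = 0"
    unfolding ext[OF pA] evp dd_diff[OF mon polyfun_vfst[OF F]] dd_monomial dd_vfst[OF F] by (simp add: eq)
  have vanp: "vanishes_on (poly p ?zi) Y"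
    unfolding evp by (simp add: vanishes_on_def Y_def suspension_def)
  have resp: "extend_pd ?D ?z ?zi (\<eta> $ i) P = 0" if "P \<in> coeffs_in ?A" "vanishes_on (poly P ?zi) Y" for P
  proof (rule extend_pd_respects_relations[OF subalg_free_of D z _ _ that, where r = "1 / cofactor \<kappa> i w"])
    fix H assume "H \<in> ?A" "vanishes_on H Y"
    then show "dd H ?z ?v = 0" by (rule free_of_dd_zero[OF _ _ xX \<xi>])
  next
    fix P assume P: "P \<in> coeffs_in ?A" "vanishes_on (poly P ?zi) Y" "\<not> vanishes_on (lead_coeff P) Y"
    then have le: "\<kappa> i \<le> degree P" using short_relation_trivial[OF P(1,2)] by (meson not_le)
    have lA: "lead_coeff P \<in> ?A" using P by (simp add: coeffs_in_def)
    let ?m = "monom (lead_coeff P) (degree P - \<kappa> i)"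
    have mA: "?m \<in> coeffs_in ?A" by (rule coeffs_in_monom[OF subalg_free_of lA])
    have "degree (?m * p) \<le> degree ?m + degree p" by (rule degree_mult_le)
    also have "\<dots> \<le> degree P" using le degp degree_monom_le[of "lead_coeff P" "degree P - \<kappa> i"] by simp
    finally have d: "degree (?m * p) \<le> degree P" .
    have c: "coeff (?m * p) (degree P) = U * lead_coeff P"
      by (subst coeff_monom_mult) (use le cop in \<open>simp add: mult.commute\<close>)
    have "poly p ?zi ?z = 0" using vanp z by (simp add: vanishes_on_def)
    then have "extend_pd ?D ?z ?zi (\<eta> $ i) (?m * p) = 0"
      by (simp add: extend_pd_mult[OF subalg_free_of D mA pA] Ep)
    moreover have "vanishes_on (poly (?m * p) ?zi) Y" using vanp by (simp add: vanishes_on_def)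
    moreover have "U ?z * (1 / cofactor \<kappa> i w) = 1" using nz by (simp add: U_def)
    ultimately show "\<exists>c\<in>?A. \<exists>Q\<in>coeffs_in ?A. c ?z * (1 / cofactor \<kappa> i w) = 1 \<and> degree Q \<le> degree P \<and>
        coeff Q (degree P) = c * lead_coeff P \<and> vanishes_on (poly Q ?zi) Y \<and> extend_pd ?D ?z ?zi (\<eta> $ i) Q = 0"
      using d c U coeffs_in_mult[OF subalg_free_of mA pA] by blast
  qed
  have "dd H ?z ?v = 0" if H: "H \<in> polyfun" "vanishes_on H Y" for H
  proof -
    obtain P where P: "P \<in> coeffs_in ?A" "H = poly P ?zi"
      using H(1) unfolding adjoin_free_of[of i, symmetric] by blast
    show ?thesis using resp[OF P(1)]
      ext[OF P(1)] H(2) unfolding P(2) by simp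
  qed
  then show ?thesis by (auto simp: tangent_space_iff vanishes_on_def)
qed

text \<open>
  Over a zero of \<open>F\<close> the point may be moved within the fibre until only the factor \<open>w\<^sub>a\<close> vanishes;
  tangent vectors at these nearby points specialize.
\<close>

lemma tangent_Y_zero_factor:
  assumes x: "x \<in> X" "F x = 0" and a: "w $ a = 0"
    and \<xi>: "\<xi> \<in> tangent_space X x" "dd F x \<xi> = 0" and \<eta>: "\<eta> $ a = 0 \<or> \<kappa> a > 1"
  shows "vjoin \<xi> \<eta> \<in> tangent_space Y (vjoin x w)"
  unfolding tangent_space_iff
proof (intro ballI impI)
  fix H assume H: "H \<in> polyfun" "\<forall>z\<in>Y. H z = 0"
  let ?e = "(\<chi> j. if j = a then 0 else 1) :: 'k^'q"
  obtain s\<^sub>0 where s0: "cofactor \<kappa> a (w + s\<^sub>0 *s ?e) \<noteq> 0" using cofactor_shift_nz by blast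
  have "(\<lambda>w. dd H (vjoin x w) (vjoin \<xi> \<eta>)) \<in> polyfun"
  proof (rule polyfun_compose[OF dd_polyfun_point[OF H(1)]])
    fix j show "(\<lambda>w. vjoin x w $ j) \<in> polyfun" by (cases j) (simp_all add: polyfun_coord polyfun_const)
  qed
  then have "pcurve (\<lambda>s. dd H (vjoin x (w + s *s ?e)) (vjoin \<xi> \<eta>))" by (rule pcurve_polyfun_line)
  then have "dd H (vjoin x (w + 0 *s ?e)) (vjoin \<xi> \<eta>) = 0"
  proof (rule pcurve_zero_if_cofinite[OF _ pcurve_polyfun_line[OF polyfun_cofactor] s0])
    fix s assume nz: "cofactor \<kappa> a (w + s *s ?e) \<noteq> 0"
    let ?w = "w + s *s ?e"
    have wa: "?w $ a = 0" using a by simp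
    have zY: "vjoin x ?w \<in> Y"
      using x wa \<kappa>[of a] by (simp add: mem_Y prod_eq_cofactor[of ?w \<kappa> a] power_0_left del: vector_add_component)
    have "monomial_differential \<kappa> ?w \<eta> = 0"
      unfolding monomial_differential_def
    proof (rule sum.neutral, rule ballI)
      fix i
      show "of_nat (\<kappa> i) * (?w $ i ^ (\<kappa> i - 1) * cofactor \<kappa> i ?w) * \<eta> $ i = 0"
      proof (cases "i = a")
        case True
        then show ?thesis using \<eta> wa by (auto simp: power_0_left)
      next
        case False
        then show ?thesis using cofactor_zero[OF wa, of \<kappa> i] \<kappa>[of a] by auto
      qed
    qed
    then have "vjoin \<xi> \<eta> \<in> tangent_space Y (vjoin x ?w)"
      using \<xi> by (intro tangent_Y_sufficient[OF zY nz]) simp_all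
    then show "dd H (vjoin x ?w) (vjoin \<xi> \<eta>) = 0" using H by (auto simp: tangent_space_iff)
  qed
  then show "dd H (vjoin x w) (vjoin \<xi> \<eta>) = 0" by simp
qed

subsection \<open>Smooth points of the suspension\<close>

lemma monomial_differential_remove:
  "monomial_differential \<kappa> w \<eta> = of_nat (\<kappa> i) * (w $ i ^ (\<kappa> i - 1) * cofactor \<kappa> i w) * \<eta> $ i +
    (\<Sum>j\<in>UNIV - {i}. of_nat (\<kappa> j) * (w $ j ^ (\<kappa> j - 1) * cofactor \<kappa> j w) * \<eta> $ j)"
  for w \<eta> :: "'k^'q"
  unfolding monomial_differential_def by (rule sum.remove) simp_all

lemma card_coords:
  fixes I :: "'n set" and J :: "'q set"
  shows "card (Inl ` I \<union> Inr ` J) = card I + card J"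
  by (subst card_Un_disjoint) (auto simp: card_image)

text \<open>
  A tangent space of \<open>Y\<close> is computed at a point with \<open>F x \<noteq> 0\<close>, where the equation eliminates one
  coordinate of \<open>w\<close>.
\<close>

lemma var_dim_Y_less: "var_dim Y < var_dim X + CARD('q)"
proof -
  obtain x\<^sub>0 where x0: "x\<^sub>0 \<in> X" "vec.dim (tangent_space X x\<^sub>0) = var_dim X"
    using ex_point_with_dim_tangent_space_eq[OF X] by blast
  obtain \<Delta> and I :: "'n set" where \<Delta>: "\<Delta> \<in> polyfun" "\<Delta> x\<^sub>0 \<noteq> 0" and I: "card I = vec.dim (tangent_space X x\<^sub>0)"
    and inj: "\<And>x v. \<Delta> x \<noteq> 0 \<Longrightarrow> v \<in> tangent_space X x \<Longrightarrow> (\<And>i. i \<in> I \<Longrightarrow> v $ i = 0) \<Longrightarrow> v = 0"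
    using tangent_chart[where x\<^sub>0 = x\<^sub>0 and X = X] by blast
  have "\<not> vanishes_on (\<lambda>x. \<Delta> x * F x) X"
    using irreducible_prime[OF X \<Delta>(1) F] F_nz x0(1) \<Delta>(2) by (auto simp: vanishes_on_def)
  then obtain x where x: "x \<in> X" "\<Delta> x \<noteq> 0" "F x \<noteq> 0" by (auto simp: vanishes_on_def)
  define i :: 'q where "i = undefined"
  obtain t where t: "t ^ \<kappa> i = F x" using ex_root[OF \<kappa>] by blast
  define w :: "'k^'q" where "w = (\<chi> j. if j = i then t else 1)"
  have cof: "cofactor \<kappa> i w = 1" unfolding cofactor_def by (rule prod.neutral) (simp add: w_def)
  have wi: "w $ i = t" by (simp add: w_def)
  have t0: "t \<noteq> 0" using t x(3) \<kappa>[of i] by (auto simp: power_0_left)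
  have zY: "vjoin x w \<in> Y"
    using x t by (simp add: mem_Y prod_eq_cofactor[of w \<kappa> i] cof wi)
  let ?J = "Inl ` I \<union> Inr ` (UNIV - {i})"
  have "vec.dim (tangent_space Y (vjoin x w)) \<le> card ?J"
  proof (rule dim_le_card_if_coords_inj[OF subspace_tangent_space])
    fix v assume v: "v \<in> tangent_space Y (vjoin x w)" "\<And>j. j \<in> ?J \<Longrightarrow> v $ j = 0"
    have "vfst v = 0"
      by (rule inj[OF x(2)]) (use tangent_Y_necessary(1)[OF v(1)] v(2) in auto)
    moreover have "v $ Inr i = 0"
    proof -
      have "monomial_differential \<kappa> w (vsnd v) = 0"
        using tangent_Y_necessary(2)[OF v(1)] \<open>vfst v = 0\<close> by simp
      moreover have "(\<Sum>j\<in>UNIV - {i}. of_nat (\<kappa> j) * (w $ j ^ (\<kappa> j - 1) * cofactor \<kappa> j w) * vsnd v $ j) = 0"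
        by (rule sum.neutral) (use v(2) in auto)
      ultimately have "of_nat (\<kappa> i) * (t ^ (\<kappa> i - 1) * 1) * v $ Inr i = 0"
        using monomial_differential_remove[of w "vsnd v" i] by (simp only: cof wi vsnd_nth add_0_right)
      then show ?thesis using \<kappa>[of i] t0 by simp
    qed
    ultimately show "v = 0"
    proof -
      assume v1: "vfst v = 0" and vi: "v $ Inr i = 0"
      have "v $ j = 0" for j
      proof (cases j)
        case (Inl b)
        then show ?thesis using arg_cong[OF v1, of "\<lambda>y. y $ b"] by simp
      next
        case (Inr b)
        then show ?thesis using vi v(2)[of j] by (cases "b = i") auto
      qed
      then show ?thesis by (simp add: vec_eq_iff)
    qed
  qed
  also have "\<dots> = var_dim X + (CARD('q) - 1)" by (simp add: card_coords I x0 card_Diff_singleton)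
  also have "\<dots> < var_dim X + CARD('q)" by simp
  finally show ?thesis using var_dim_le_dim_tangent_space[OF Y zY] by simp
qed

text \<open>
  Eliminating \<open>w\<^sub>i\<close>, the tangent space of \<open>Y\<close> projects onto that of \<open>X\<close> times the other coordinates, so
  its dimension bounds that of the tangent space of \<open>X\<close>.
\<close>

lemma smooth_Y_if_cofactor_nz:
  assumes z: "vjoin x w \<in> smooth_locus Y" and i: "\<kappa> i = 1" "cofactor \<kappa> i w \<noteq> 0"
  shows "x \<in> smooth_locus X"
proof -
  have zY: "vjoin x w \<in> Y" and dimz: "vec.dim (tangent_space Y (vjoin x w)) = var_dim Y"
    using z by (auto simp: smooth_locus_def)
  have x: "x \<in> X" using zY by (simp add: mem_Y)
  obtain \<Delta> and I :: "'n set" where "\<Delta> \<in> polyfun" and \<Delta>: "\<Delta> x \<noteq> 0" and I: "card I = vec.dim (tangent_space X x)"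
    and inj: "\<And>y v. \<Delta> y \<noteq> 0 \<Longrightarrow> v \<in> tangent_space X y \<Longrightarrow> (\<And>i. i \<in> I \<Longrightarrow> v $ i = 0) \<Longrightarrow> v = 0"
    using tangent_chart[where x\<^sub>0 = x and X = X] by blast
  have surj: "\<exists>\<xi>\<in>tangent_space X x. \<forall>i\<in>I. \<xi> $ i = y i" for y
    by (rule coords_surj_if_dim_eq[OF subspace_tangent_space]) (rule inj[OF \<Delta>], use I in auto)
  let ?J = "Inl ` I \<union> Inr ` (UNIV - {i})"
  have "card ?J \<le> vec.dim (tangent_space Y (vjoin x w))"
  proof (rule card_le_dim_if_coords_surj)
    fix y :: "'n + 'q \<Rightarrow> 'k"
    obtain \<xi> where \<xi>: "\<xi> \<in> tangent_space X x" "\<forall>i\<in>I. \<xi> $ i = y (Inl i)"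
      using surj[of "\<lambda>i. y (Inl i)"] by blast
    define r where "r = (\<Sum>j\<in>UNIV - {i}. of_nat (\<kappa> j) * (w $ j ^ (\<kappa> j - 1) * cofactor \<kappa> j w) * y (Inr j))"
    define \<eta> :: "'k^'q" where "\<eta> = (\<chi> j. if j = i then (dd F x \<xi> - r) / cofactor \<kappa> i w else y (Inr j))"
    have "monomial_differential \<kappa> w \<eta> = cofactor \<kappa> i w * \<eta> $ i +
      (\<Sum>j\<in>UNIV - {i}. of_nat (\<kappa> j) * (w $ j ^ (\<kappa> j - 1) * cofactor \<kappa> j w) * \<eta> $ j)"
      by (simp add: monomial_differential_remove[of w \<eta> i] i(1))
    also have "(\<Sum>j\<in>UNIV - {i}. of_nat (\<kappa> j) * (w $ j ^ (\<kappa> j - 1) * cofactor \<kappa> j w) * \<eta> $ j) = r"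
      unfolding r_def by (rule sum.cong) (auto simp: \<eta>_def)
    finally have "monomial_differential \<kappa> w \<eta> = dd F x \<xi>" using i(2) by (simp add: \<eta>_def)
    then have "vjoin \<xi> \<eta> \<in> tangent_space Y (vjoin x w)" by (rule tangent_Y_sufficient[OF zY i(2) \<xi>(1)])
    then show "\<exists>v\<in>tangent_space Y (vjoin x w). \<forall>j\<in>?J. v $ j = y j"
      by (rule bexI[rotated]) (use \<xi>(2) in \<open>auto simp: \<eta>_def split: if_splits\<close>)
  qed
  then have "vec.dim (tangent_space X x) + (CARD('q) - 1) < var_dim X + CARD('q)"
    using var_dim_Y_less by (simp add: card_coords I dimz card_Diff_singleton)
  then have "vec.dim (tangent_space X x) \<le> var_dim X"
    using zero_less_card_finite[where 'a = 'q] by linarith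
  then show ?thesis
    using var_dim_le_dim_tangent_space[OF X x] x by (simp add: smooth_locus_def)
qed

text \<open>
  Here the tangent space of \<open>Y\<close> contains the product of all of the fibre direction with the kernel of the
  differential of \<open>F\<close>. Its dimension is too large if that differential is zero or if \<open>x\<close> is singular.
\<close>

lemma smooth_Y_if_cofactors_zero:
  assumes z: "vjoin x w \<in> smooth_locus Y" and Fx: "F x = 0" and cof: "\<And>i. \<kappa> i = 1 \<Longrightarrow> cofactor \<kappa> i w = 0"
  shows "x \<in> smooth_locus X" "\<exists>\<xi>\<in>tangent_space X x. dd F x \<xi> \<noteq> 0"
proof -
  have zY: "vjoin x w \<in> Y" and dimz: "vec.dim (tangent_space Y (vjoin x w)) = var_dim Y"
    using z by (auto simp: smooth_locus_def)
  have x: "x \<in> X" using zY by (simp add: mem_Y)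
  have le: "var_dim X \<le> vec.dim (tangent_space X x)" by (rule var_dim_le_dim_tangent_space[OF X x])
  obtain a where a: "w $ a = 0"
    using zY Fx by (auto simp: mem_Y prod_zero_iff)
  have ker: "vjoin \<xi> \<eta> \<in> tangent_space Y (vjoin x w)" if \<xi>: "\<xi> \<in> tangent_space X x" "dd F x \<xi> = 0" for \<xi> \<eta>
  proof (cases "\<kappa> a > 1")
    case True
    then show ?thesis using tangent_Y_zero_factor[OF x Fx a \<xi>] by blast
  next
    case False
    then have "\<kappa> a = 1" using \<kappa>[of a] by simp
    then obtain b where b: "b \<noteq> a" "w $ b = 0" using cof[of a] by (auto simp: cofactor_def)
    \<comment> \<open>the direction of \<open>w\<^sub>a\<close> itself is tangent because of the second vanishing factor \<open>w\<^sub>b\<close>\<close>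
    let ?\<eta> = "(\<chi> j. if j = a then 0 else \<eta> $ j) :: 'k^'q"
    have "vjoin \<xi> ?\<eta> \<in> tangent_space Y (vjoin x w)"
      by (rule tangent_Y_zero_factor[OF x Fx a \<xi>]) simp
    moreover have "vjoin 0 (axis a (\<eta> $ a)) \<in> tangent_space Y (vjoin x w)"
      by (rule tangent_Y_zero_factor[OF x Fx b(2)])
        (use b(1) vec.subspace_0[OF subspace_tangent_space] in \<open>auto simp: axis_def\<close>)
    moreover have "vjoin \<xi> \<eta> = vjoin \<xi> ?\<eta> + vjoin 0 (axis a (\<eta> $ a))"
      by (auto simp: vec_eq_iff vjoin_def axis_def split: sum.split)
    ultimately show ?thesis by (simp only: vec.subspace_add[OF subspace_tangent_space])
  qed
  obtain \<Delta> and I :: "'n set" where "\<Delta> \<in> polyfun" and \<Delta>: "\<Delta> x \<noteq> 0" and I: "card I = vec.dim (tangent_space X x)"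
    and inj: "\<And>y v. \<Delta> y \<noteq> 0 \<Longrightarrow> v \<in> tangent_space X y \<Longrightarrow> (\<And>i. i \<in> I \<Longrightarrow> v $ i = 0) \<Longrightarrow> v = 0"
    using tangent_chart[where x\<^sub>0 = x and X = X] by blast
  have surj: "\<exists>\<xi>\<in>tangent_space X x. \<forall>i\<in>I. \<xi> $ i = y i" for y
    by (rule coords_surj_if_dim_eq[OF subspace_tangent_space]) (rule inj[OF \<Delta>], use I in auto)
  have many: "card I' + CARD('q) < var_dim X + CARD('q)"
    if ex: "\<And>y. \<exists>\<xi>\<in>tangent_space X x. dd F x \<xi> = 0 \<and> (\<forall>i\<in>I'. \<xi> $ i = y i)" for I' :: "'n set"
  proof -
    have "card (Inl ` I' \<union> Inr ` (UNIV :: 'q set)) \<le> vec.dim (tangent_space Y (vjoin x w))"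
    proof (rule card_le_dim_if_coords_surj)
      fix y :: "'n + 'q \<Rightarrow> 'k"
      obtain \<xi> where \<xi>: "\<xi> \<in> tangent_space X x" "dd F x \<xi> = 0" "\<forall>i\<in>I'. \<xi> $ i = y (Inl i)"
        using ex[of "\<lambda>i. y (Inl i)"] by blast
      show "\<exists>v\<in>tangent_space Y (vjoin x w). \<forall>j\<in>Inl ` I' \<union> Inr ` UNIV. v $ j = y j"
        by (rule bexI[OF _ ker[OF \<xi>(1,2), of "\<chi> j. y (Inr j)"]]) (use \<xi>(3) in auto)
    qed
    then show ?thesis using var_dim_Y_less dimz by (simp add: card_coords)
  qed
  show ex: "\<exists>\<xi>\<in>tangent_space X x. dd F x \<xi> \<noteq> 0"
  proof (rule ccontr)
    assume "\<not> ?thesis"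
    then have "card I + CARD('q) < var_dim X + CARD('q)" using surj by (intro many) blast
    then show False using le I by simp
  qed
  have "\<exists>e. \<forall>k. e k \<in> tangent_space X x \<and> (\<forall>i\<in>I. e k $ i = (if i = k then 1 else 0))"
    by (rule choice) (use surj in \<open>simp add: Bex_def\<close>)
  then obtain e where e: "\<And>k. e k \<in> tangent_space X x" "\<And>k i. i \<in> I \<Longrightarrow> e k $ i = (if i = k then 1 else 0)"
    by blast
  have "\<exists>k\<in>I. dd F x (e k) \<noteq> 0"
  proof (rule ccontr)
    assume no: "\<not> ?thesis"
    obtain \<xi> where \<xi>: "\<xi> \<in> tangent_space X x" "dd F x \<xi> \<noteq> 0" using ex by blast
    have "\<xi> - (\<Sum>k\<in>I. \<xi> $ k *s e k) = 0"
    proof (rule inj[OF \<Delta>])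
      show "\<xi> - (\<Sum>k\<in>I. \<xi> $ k *s e k) \<in> tangent_space X x"
        by (intro vec.subspace_diff vec.subspace_sum vec.subspace_scale subspace_tangent_space \<xi>(1) e(1))
      fix i assume i: "i \<in> I"
      have "(\<Sum>k\<in>I. \<xi> $ k *s e k) $ i = (\<Sum>k\<in>I. if k = i then \<xi> $ k else 0)"
        unfolding sum_component by (rule sum.cong) (auto simp: e(2)[OF i])
      then show "(\<xi> - (\<Sum>k\<in>I. \<xi> $ k *s e k)) $ i = 0" using i by simp
    qed
    then have "dd F x \<xi> = dd F x (\<Sum>k\<in>I. \<xi> $ k *s e k)" by simp
    also have "\<dots> = (\<Sum>k\<in>I. \<xi> $ k * dd F x (e k))" by (simp add: dd_sum_vec[OF F] dd_scale_vec[OF F])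
    also have "\<dots> = 0" using no by (intro sum.neutral) auto
    finally show False using \<xi>(2) by simp
  qed
  then obtain k where k: "k \<in> I" "dd F x (e k) \<noteq> 0" by blast
  have "card (I - {k}) + CARD('q) < var_dim X + CARD('q)"
  proof (rule many)
    fix y
    obtain \<xi> where \<xi>: "\<xi> \<in> tangent_space X x" "\<forall>i\<in>I. \<xi> $ i = y i" using surj by blast
    let ?\<xi> = "\<xi> - (dd F x \<xi> / dd F x (e k)) *s e k"
    have "?\<xi> \<in> tangent_space X x"
      by (intro vec.subspace_diff vec.subspace_scale subspace_tangent_space \<xi>(1) e(1))
    moreover have "dd F x ?\<xi> = 0"
      using dd_add_vec[OF F, of x ?\<xi> "(dd F x \<xi> / dd F x (e k)) *s e k"] k(2)
      by (simp add: dd_scale_vec[OF F])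
    ultimately show "\<exists>\<xi>\<in>tangent_space X x. dd F x \<xi> = 0 \<and> (\<forall>i\<in>I - {k}. \<xi> $ i = y i)"
      by (intro bexI[of _ ?\<xi>]) (use \<xi>(2) e(2) in auto)
  qed
  then have "vec.dim (tangent_space X x) \<le> var_dim X"
    using k(1) I by (simp add: card_Diff_singleton)
  then show "x \<in> smooth_locus X" using le x by (simp add: smooth_locus_def)
qed

end

subsection \<open>Flows on the suspension\<close>

lemma deriv_at_0_compose_time:
  fixes c \<tau> :: "'k::field_char_0 \<Rightarrow> 'k"
  assumes "pcurve c" "pcurve \<tau>" "\<tau> 0 = 0"
  shows "deriv_at_0 (\<lambda>s. c (\<tau> s)) = deriv_at_0 \<tau> * deriv_at_0 c"
proof -
  obtain r where r: "\<And>s. c s = poly r s" using assms(1) by (auto simp: pcurve_def)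
  obtain t where t: "\<And>s. \<tau> s = poly t s" using assms(2) by (auto simp: pcurve_def)
  obtain a q where q: "r = pCons a q" by (rule pCons_cases)
  have pq: "pcurve (\<lambda>s. poly q (\<tau> s))"
    unfolding pcurve_def by (rule exI[of _ "pcompose q t"]) (simp add: poly_pcompose t)
  have "deriv_at_0 (\<lambda>s. c (\<tau> s)) = deriv_at_0 (\<lambda>s. a + \<tau> s * poly q (\<tau> s))"
    by (simp add: r q)
  also have "\<dots> = poly q 0 * deriv_at_0 \<tau>"
    using deriv_at_0_add[OF pcurve_const pcurve_mult[OF assms(2) pq], of a] deriv_at_0_mult[OF assms(2) pq] assms(3)
    by simp
  also have "poly q 0 = deriv_at_0 c" using deriv_at_0_eq[of c r, OF r] by (simp add: q poly_0_coeff_0)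
  finally show ?thesis by (simp add: mult.commute)
qed

lemma deriv_at_0_time_mult: "pcurve h \<Longrightarrow> deriv_at_0 (\<lambda>s. s * h s) = h (0 :: 'k::field_char_0)"
  using deriv_at_0_mult[OF pcurve_id, of h] by simp

lemma vjoin_add: "vjoin x w + vjoin x' w' = vjoin (x + x') (w + w')"
  by (auto simp: vec_eq_iff vjoin_def split: sum.split)

lemma flow_linear_invariant:
  fixes F :: "'k::field_char_0^'n \<Rightarrow> 'k"
  assumes \<Phi>: "flow X \<Phi>" and lin: "\<And>s x. x \<in> X \<Longrightarrow> F (\<Phi> s x) = F x + s * f\<^sub>1 x" and x: "x \<in> X"
  shows "f\<^sub>1 (\<Phi> t x) = f\<^sub>1 x"
proof -
  have "F x + (1 + t) * f\<^sub>1 x = F (\<Phi> 1 (\<Phi> t x))"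
    by (simp add: lin[OF x, symmetric] flow_add[OF \<Phi> x])
  also have "\<dots> = F x + t * f\<^sub>1 x + f\<^sub>1 (\<Phi> t x)" using lin[OF flow_in[OF \<Phi> x], of 1 t] lin[OF x, of t] by simp
  finally show ?thesis by (simp add: algebra_simps)
qed

context irreducible_suspension
begin

lemma cofactor_add_axis: "cofactor \<kappa> i (w + axis i c) = cofactor \<kappa> i w" for w :: "'k^'q"
  by (rule cofactor_cong) (simp add: axis_def)

text \<open>
  Lifting a flow of \<open>X\<close>: run it with the changed time \<open>\<tau>\<close>, and compensate the change of \<open>F\<close> by
  moving the coordinate \<open>w\<^sub>i\<close>.
\<close>

lemma lifted_flow:
  assumes \<Phi>: "flow X \<Phi>" and \<tau>: "polyfam Y \<tau>" and \<omega>: "polyfam Y \<omega>"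
    and \<Psi>: "\<And>s z. \<Psi> s z = vjoin (\<Phi> (\<tau> s z) (vfst z)) (vsnd z + axis i (\<omega> s z))"
    and eq: "\<And>s z. z \<in> Y \<Longrightarrow> F (\<Phi> (\<tau> s z) (vfst z)) = (vsnd z $ i + \<omega> s z) ^ \<kappa> i * cofactor \<kappa> i (vsnd z)"
    and zero: "\<And>z. z \<in> Y \<Longrightarrow> \<tau> 0 z = 0 \<and> \<omega> 0 z = 0"
    and add: "\<And>s t z. z \<in> Y \<Longrightarrow> \<tau> (s + t) z = \<tau> s (\<Psi> t z) + \<tau> t z \<and> \<omega> (s + t) z = \<omega> s (\<Psi> t z) + \<omega> t z"
  shows "flow Y \<Psi>"
    and "z \<in> Y \<Longrightarrow> velocity \<Psi> z =
      vjoin (deriv_at_0 (\<lambda>s. \<tau> s z) *s velocity \<Phi> (vfst z)) (axis i (deriv_at_0 (\<lambda>s. \<omega> s z)))"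
proof -
  have fstX: "vfst z \<in> X" if "z \<in> Y" for z using that by (simp add: Y_def suspension_def)
  show "flow Y \<Psi>"
    unfolding flow_def
  proof (intro conjI allI ballI)
    fix s t z assume z: "z \<in> Y"
    note x = fstX[OF z]
    show "\<Psi> s z \<in> Y"
      unfolding \<Psi> mem_Y prod_eq_cofactor[of _ \<kappa> i] cofactor_add_axis
      using flow_in[OF \<Phi> x] eq[OF z, of s] by (simp del: vsnd_nth)
    show "\<Psi> 0 z = z"
      using zero[OF z] by (simp add: \<Psi> flow_zero[OF \<Phi> x] axis_def flip: zero_vec_def)
    have "axis i (a + b) = axis i b + (axis i a :: 'k^'q)" for a b by (simp add: axis_def vec_eq_iff)
    moreover have "vfst (\<Psi> t z) = \<Phi> (\<tau> t z) (vfst z)" "vsnd (\<Psi> t z) = vsnd z + axis i (\<omega> t z)"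
      by (simp_all add: \<Psi>[of t z])
    ultimately show "\<Psi> (s + t) z = \<Psi> s (\<Psi> t z)"
      unfolding \<Psi>[of "s + t" z] \<Psi>[of s "\<Psi> t z"]
      by (simp only: conjunct1[OF add[OF z]] conjunct2[OF add[OF z]] flow_add[OF \<Phi> x] add.assoc)
  next
    fix j
    show "polyfam Y (\<lambda>s z. \<Psi> s z $ j)"
    proof (cases j)
      case (Inl a)
      have "polyfam Y (\<lambda>s z. \<Phi> (\<tau> s z) (vfst z) $ a)"
        by (rule polyfam_reparametrize[OF flow_polyfam[OF \<Phi>] \<tau> fstX]) (simp_all add: polyfun_coord)
      then show ?thesis by (simp add: \<Psi> Inl)
    next
      case (Inr b)
      have "polyfam Y (\<lambda>s z. z $ Inr b + (if b = i then \<omega> s z else 0))"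
        by (intro polyfam_add polyfam_polyfun polyfun_coord) (cases "b = i"; simp add: \<omega> polyfam_const)
      then show ?thesis by (simp add: \<Psi> Inr axis_def)
    qed
  qed
  show "velocity \<Psi> z = vjoin (deriv_at_0 (\<lambda>s. \<tau> s z) *s velocity \<Phi> (vfst z)) (axis i (deriv_at_0 (\<lambda>s. \<omega> s z)))" if z: "z \<in> Y"
  proof -
    note x = fstX[OF z]
    have "velocity \<Psi> z $ j = vjoin (deriv_at_0 (\<lambda>s. \<tau> s z) *s velocity \<Phi> (vfst z)) (axis i (deriv_at_0 (\<lambda>s. \<omega> s z))) $ j" for j
    proof (cases j)
      case (Inl a)
      have "deriv_at_0 (\<lambda>s. \<Phi> (\<tau> s z) (vfst z) $ a) = deriv_at_0 (\<lambda>s. \<tau> s z) * deriv_at_0 (\<lambda>s. \<Phi> s (vfst z) $ a)"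
        by (rule deriv_at_0_compose_time[OF polyfam_pcurve[OF flow_polyfam[OF \<Phi>] x] polyfam_pcurve[OF \<tau> z]])
          (simp add: zero[OF z])
      then show ?thesis by (simp add: velocity_def \<Psi> Inl)
    next
      case (Inr b)
      have "deriv_at_0 (\<lambda>s. z $ Inr b + \<omega> s z) = deriv_at_0 (\<lambda>s. \<omega> s z)"
        using deriv_at_0_add[OF pcurve_const polyfam_pcurve[OF \<omega> z]] by simp
      then show ?thesis by (cases "b = i") (simp_all add: velocity_def \<Psi> Inr axis_def)
    qed
    then show ?thesis by (simp add: vec_eq_iff)
  qed
qed

text \<open>
  If \<open>F\<close> grows linearly along the flow, with slope \<open>f\<^sub>1\<close>, then \<open>w\<^sub>i\<close> can be moved linearly, and the
  difference quotient of \<open>w\<^sub>i\<^sup>\<kappa>\<^sup>i\<close> is the required time; it is a polynomial even where \<open>f\<^sub>1\<close> vanishes.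
\<close>

lemma linear_lift:
  assumes \<Phi>: "flow X \<Phi>" and f1: "f\<^sub>1 \<in> polyfun" and lin: "\<And>s x. x \<in> X \<Longrightarrow> F (\<Phi> s x) = F x + s * f\<^sub>1 x"
  obtains \<Psi> where "flow Y \<Psi>"
    "\<And>x w. vjoin x w \<in> Y \<Longrightarrow> velocity \<Psi> (vjoin x w) =
      vjoin ((w $ i ^ (\<kappa> i - 1) * cofactor \<kappa> i w) *s velocity \<Phi> x) (axis i (f\<^sub>1 x / of_nat (\<kappa> i)))"
    "\<And>s x w. vjoin x w \<in> Y \<Longrightarrow> cofactor \<kappa> i w = 0 \<Longrightarrow>
      \<Psi> s (vjoin x w) = vjoin x (w + axis i (s * f\<^sub>1 x / of_nat (\<kappa> i)))"
proof -
  have k0: "of_nat (\<kappa> i) \<noteq> (0 :: 'k)" using \<kappa>[of i] by simp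
  define c where "c z = f\<^sub>1 (vfst z) * (1 / of_nat (\<kappa> i))" for z :: "'k^('n + 'q)"
  define T where "T s z = (\<Sum>j<\<kappa> i. vsnd z $ i ^ (\<kappa> i - Suc j) * (vsnd z $ i + s * c z) ^ j)" for s z
  define \<tau> where "\<tau> s z = cofactor \<kappa> i (vsnd z) * (s * (1 / of_nat (\<kappa> i))) * T s z" for s z
  define \<Psi> where "\<Psi> s z = vjoin (\<Phi> (\<tau> s z) (vfst z)) (vsnd z + axis i (s * c z))" for s z
  have wp: "(\<lambda>z :: 'k^('n + 'q). vsnd z $ i) \<in> polyfun" by (simp add: polyfun_coord)
  have cp: "c \<in> polyfun" unfolding c_def[abs_def] by (intro polyfun_mult polyfun_const polyfun_vfst f1)
  have \<omega>: "polyfam Y (\<lambda>s z. s * c z)" by (intro polyfam_mult polyfam_time polyfam_polyfun cp)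
  have T: "polyfam Y T"
    unfolding T_def[abs_def]
    by (intro polyfam_sum polyfam_mult polyfam_power polyfam_add polyfam_polyfun[OF wp] \<omega>)
  have \<tau>: "polyfam Y \<tau>"
    unfolding \<tau>_def[abs_def]
    by (intro polyfam_mult polyfam_time polyfam_const T polyfam_polyfun polyfun_vsnd polyfun_cofactor)
  have key: "\<tau> s z * f\<^sub>1 (vfst z) = cofactor \<kappa> i (vsnd z) * ((vsnd z $ i + s * c z) ^ \<kappa> i - vsnd z $ i ^ \<kappa> i)" for s z
    unfolding power_diff_sumr2 T_def[symmetric] by (simp add: \<tau>_def c_def)
  have fstX: "vfst z \<in> X" if "z \<in> Y" for z using that by (simp add: Y_def suspension_def)
  have mon: "F (vfst z) = vsnd z $ i ^ \<kappa> i * cofactor \<kappa> i (vsnd z)" if "z \<in> Y" for z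
    using that prod_eq_cofactor[of "vsnd z" \<kappa> i] by (simp add: Y_def suspension_def)
  have cinv: "c (\<Psi> t z) = c z" if "z \<in> Y" for t z
    using flow_linear_invariant[OF \<Phi> lin fstX[OF that]] by (simp add: c_def \<Psi>_def)
  have cof: "cofactor \<kappa> i (vsnd (\<Psi> t z)) = cofactor \<kappa> i (vsnd z)" for t z
    by (simp add: \<Psi>_def cofactor_add_axis)
  have wi: "vsnd (\<Psi> t z) $ i = vsnd z $ i + t * c z" for t z
    by (simp add: \<Psi>_def)
  have eq: "F (\<Phi> (\<tau> s z) (vfst z)) = (vsnd z $ i + s * c z) ^ \<kappa> i * cofactor \<kappa> i (vsnd z)" if "z \<in> Y" for s z
    unfolding lin[OF fstX[OF that]] key mon[OF that] by (simp add: algebra_simps)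
  have add: "\<tau> (s + t) z = \<tau> s (\<Psi> t z) + \<tau> t z" if z: "z \<in> Y" for s t z
  proof (cases "f\<^sub>1 (vfst z) = 0")
    case True
    then have "c z = 0" by (simp add: c_def)
    then show ?thesis by (simp add: \<tau>_def T_def cof cinv[OF z] wi algebra_simps add_divide_distrib del: vsnd_nth)
  next
    case False
    have "f\<^sub>1 (vfst (\<Psi> t z)) = f\<^sub>1 (vfst z)"
      using flow_linear_invariant[OF \<Phi> lin fstX[OF z]] by (simp add: \<Psi>_def)
    note finv = this
    let ?C = "cofactor \<kappa> i (vsnd z)" and ?w = "vsnd z $ i"
    have "\<tau> (s + t) z * f\<^sub>1 (vfst z) = ?C * ((?w + (s + t) * c z) ^ \<kappa> i - ?w ^ \<kappa> i)" by (rule key)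
    also have "?w + (s + t) * c z = ?w + t * c z + s * c z" by (simp add: algebra_simps)
    also have "?C * ((?w + t * c z + s * c z) ^ \<kappa> i - ?w ^ \<kappa> i) =
      ?C * ((?w + t * c z + s * c z) ^ \<kappa> i - (?w + t * c z) ^ \<kappa> i) + ?C * ((?w + t * c z) ^ \<kappa> i - ?w ^ \<kappa> i)"
      by (simp add: algebra_simps)
    also have "\<dots> = \<tau> s (\<Psi> t z) * f\<^sub>1 (vfst z) + \<tau> t z * f\<^sub>1 (vfst z)"
      using key[of s "\<Psi> t z"] key[of t z] by (simp only: cof cinv[OF z] wi finv)
    finally have "\<tau> (s + t) z * f\<^sub>1 (vfst z) = (\<tau> s (\<Psi> t z) + \<tau> t z) * f\<^sub>1 (vfst z)"
      by (simp only: distrib_right)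
    then show ?thesis using False by simp
  qed
  have addw: "(s + t) * c z = s * c (\<Psi> t z) + t * c z" if "z \<in> Y" for s t z
    by (simp add: cinv[OF that] algebra_simps)
  have zero: "\<tau> 0 z = 0 \<and> 0 * c z = 0" for z by (simp add: \<tau>_def)
  note addc = conjI[OF add addw]
  have lift1: "flow Y \<Psi>"
    by (rule lifted_flow(1)[where \<Phi> = \<Phi> and \<tau> = \<tau> and \<omega> = "\<lambda>s z. s * c z" and \<Psi> = \<Psi> and i = i, OF \<Phi> \<tau> \<omega> \<Psi>_def])
      (erule eq | rule zero | rule addc; assumption)+
  have lift2: "velocity \<Psi> z = vjoin (deriv_at_0 (\<lambda>s. \<tau> s z) *s velocity \<Phi> (vfst z)) (axis i (deriv_at_0 (\<lambda>s. s * c z)))"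
    if "z \<in> Y" for z
    by (rule lifted_flow(2)[where \<Phi> = \<Phi> and \<tau> = \<tau> and \<omega> = "\<lambda>s z. s * c z" and \<Psi> = \<Psi> and i = i, OF \<Phi> \<tau> \<omega> \<Psi>_def])
      (erule eq | rule zero | rule that | rule addc; assumption)+
  show thesis
  proof
    show "flow Y \<Psi>" by (rule lift1)
    fix x w assume z: "vjoin x w \<in> Y"
    have "deriv_at_0 (\<lambda>s. s * c (vjoin x w)) = f\<^sub>1 x / of_nat (\<kappa> i)"
      using deriv_at_0_time_mult[OF pcurve_const, of "c (vjoin x w)"] by (simp add: c_def)
    moreover have "deriv_at_0 (\<lambda>s. \<tau> s (vjoin x w)) = w $ i ^ (\<kappa> i - 1) * cofactor \<kappa> i w"
    proof -
      let ?z = "vjoin x w"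
      have "(\<lambda>s. \<tau> s ?z) = (\<lambda>s. s * (cofactor \<kappa> i w * (1 / of_nat (\<kappa> i)) * T s ?z))"
        by (simp add: \<tau>_def algebra_simps)
      then have "deriv_at_0 (\<lambda>s. \<tau> s ?z) = cofactor \<kappa> i w * (1 / of_nat (\<kappa> i)) * T 0 ?z"
        by (simp only: deriv_at_0_time_mult[OF pcurve_mult[OF pcurve_const polyfam_pcurve[OF T z]]])
      also have "T 0 ?z = (\<Sum>j<\<kappa> i. w $ i ^ (\<kappa> i - 1))"
        unfolding T_def by (rule sum.cong) (simp_all flip: power_add)
      finally show ?thesis using k0 by simp
    qed
    ultimately show "velocity \<Psi> (vjoin x w) =
      vjoin ((w $ i ^ (\<kappa> i - 1) * cofactor \<kappa> i w) *s velocity \<Phi> x) (axis i (f\<^sub>1 x / of_nat (\<kappa> i)))"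
      using lift2[OF z] by (simp only: vfst_vjoin)
  next
    fix s x w assume "vjoin x w \<in> Y" "cofactor \<kappa> i w = 0"
    then show "\<Psi> s (vjoin x w) = vjoin x (w + axis i (s * f\<^sub>1 x / of_nat (\<kappa> i)))"
      using flow_zero[OF \<Phi>, of x] fstX[of "vjoin x w"] by (simp add: \<Psi>_def \<tau>_def c_def)
  qed
qed

text \<open>
  The change of \<open>F\<close> during the time \<open>s U\<close>, with \<open>U\<close> the cofactor, is divisible by \<open>s U\<close>; dividing it
  by \<open>U\<close> gives the change of \<open>w\<^sub>i\<close>, also where \<open>U = 0\<close>.
\<close>

lemma unit_lift:
  assumes \<Phi>: "flow X \<Phi>" and i: "\<kappa> i = 1"
  obtains \<Psi> where "flow Y \<Psi>"
    "\<And>x w. vjoin x w \<in> Y \<Longrightarrow> velocity \<Psi> (vjoin x w) =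
      vjoin (cofactor \<kappa> i w *s velocity \<Phi> x) (axis i (dd F x (velocity \<Phi> x)))"
    "\<And>s x w. vfst (\<Psi> s (vjoin x w)) = \<Phi> (s * cofactor \<kappa> i w) x"
    "\<And>s x w. cofactor \<kappa> i (vsnd (\<Psi> s (vjoin x w))) = cofactor \<kappa> i w"
proof -
  have "polyfam X (\<lambda>s x. F (\<Phi> s x))" by (rule polyfam_compose[OF F flow_polyfam[OF \<Phi>]])
  then obtain q where q: "q \<in> coeffs_in polyfun" "\<forall>s. \<forall>x\<in>X. F (\<Phi> s x) = poly q (\<lambda>_. s) x"
    unfolding polyfam_def by blast
  obtain a q' where q': "q = pCons a q'" by (rule pCons_cases)
  define g where "g s x = poly q' (\<lambda>_. s) x" for s x
  have g: "polyfam X g"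
    unfolding polyfam_def g_def using q(1) by (intro bexI[of _ q']) (auto simp: q' coeffs_in_pCons[OF subalg_polyfun])
  have Fg: "F (\<Phi> s x) = F x + s * g s x" if "x \<in> X" for s x
  proof -
    have eq: "F (\<Phi> s x) = a x + s * g s x" for s using q(2) that by (simp add: q' g_def)
    show ?thesis using eq[of s] eq[of 0] by (simp add: flow_zero[OF \<Phi> that])
  qed
  define \<tau> where "\<tau> s z = s * cofactor \<kappa> i (vsnd z)" for s and z :: "'k^('n + 'q)"
  define \<omega> where "\<omega> s z = s * g (\<tau> s z) (vfst z)" for s z
  define \<Psi> where "\<Psi> s z = vjoin (\<Phi> (\<tau> s z) (vfst z)) (vsnd z + axis i (\<omega> s z))" for s z
  have fstX: "vfst z \<in> X" if "z \<in> Y" for z using that by (simp add: Y_def suspension_def)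
  have \<tau>: "polyfam Y \<tau>"
    unfolding \<tau>_def[abs_def] by (intro polyfam_mult polyfam_time polyfam_polyfun polyfun_vsnd polyfun_cofactor)
  have g\<tau>: "polyfam Y (\<lambda>s z. g (\<tau> s z) (vfst z))"
    by (rule polyfam_reparametrize[OF g \<tau> fstX]) (simp_all add: polyfun_coord)
  have \<omega>: "polyfam Y \<omega>" unfolding \<omega>_def[abs_def] by (intro polyfam_mult polyfam_time g\<tau>)
  have cof: "cofactor \<kappa> i (vsnd (\<Psi> t z)) = cofactor \<kappa> i (vsnd z)" for t z
    by (simp add: \<Psi>_def cofactor_add_axis)
  have eq: "F (\<Phi> (\<tau> s z) (vfst z)) = (vsnd z $ i + \<omega> s z) ^ \<kappa> i * cofactor \<kappa> i (vsnd z)" if z: "z \<in> Y" for s z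
  proof -
    have "F (vfst z) = vsnd z $ i * cofactor \<kappa> i (vsnd z)"
      using z prod_eq_cofactor[of "vsnd z" \<kappa> i] by (simp add: Y_def suspension_def i)
    then show ?thesis
      unfolding Fg[OF fstX[OF z]] by (simp add: i \<omega>_def \<tau>_def algebra_simps)
  qed
  have inY: "\<Psi> t z \<in> Y" if z: "z \<in> Y" for t z
    unfolding \<Psi>_def mem_Y prod_eq_cofactor[of _ \<kappa> i] cofactor_add_axis
    using flow_in[OF \<Phi> fstX[OF z]] eq[OF z, of t] by (simp del: vsnd_nth)
  have add\<tau>: "\<tau> (s + t) z = \<tau> s (\<Psi> t z) + \<tau> t z" for s t z
    by (simp add: \<tau>_def cof algebra_simps)
  have add\<omega>: "\<omega> (s + t) z = \<omega> s (\<Psi> t z) + \<omega> t z" if z: "z \<in> Y" for s t z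
  proof (cases "cofactor \<kappa> i (vsnd z) = 0")
    case True
    then have "\<tau> s' z = 0" "\<tau> s' (\<Psi> t z) = 0" for s' by (simp_all add: \<tau>_def cof)
    then show ?thesis
      by (simp add: \<omega>_def \<Psi>_def flow_zero[OF \<Phi> fstX[OF z]] algebra_simps)
  next
    case False
    have "F (\<Phi> (\<tau> (s + t) z) (vfst z)) = F (\<Phi> (\<tau> s (\<Psi> t z)) (vfst (\<Psi> t z)))"
      unfolding add\<tau> flow_add[OF \<Phi> fstX[OF z]] by (simp add: \<Psi>_def)
    then have "(vsnd z $ i + \<omega> (s + t) z) * cofactor \<kappa> i (vsnd z) =
      (vsnd (\<Psi> t z) $ i + \<omega> s (\<Psi> t z)) * cofactor \<kappa> i (vsnd z)"
      unfolding eq[OF z] eq[OF inY[OF z]] cof by (simp add: i)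
    then have "vsnd z $ i + \<omega> (s + t) z = vsnd (\<Psi> t z) $ i + \<omega> s (\<Psi> t z)" using False by simp
    moreover have "vsnd (\<Psi> t z) $ i = vsnd z $ i + \<omega> t z" by (simp add: \<Psi>_def)
    ultimately show ?thesis by simp
  qed
  have zero: "\<tau> 0 z = 0 \<and> \<omega> 0 z = 0" for z by (simp add: \<tau>_def \<omega>_def)
  note addc = conjI[OF add\<tau> add\<omega>]
  have lift1: "flow Y \<Psi>"
    by (rule lifted_flow(1)[where \<Phi> = \<Phi> and \<tau> = \<tau> and \<omega> = \<omega> and \<Psi> = \<Psi> and i = i, OF \<Phi> \<tau> \<omega> \<Psi>_def])
      (erule eq | rule zero | rule addc; assumption)+
  have lift2: "velocity \<Psi> z = vjoin (deriv_at_0 (\<lambda>s. \<tau> s z) *s velocity \<Phi> (vfst z)) (axis i (deriv_at_0 (\<lambda>s. \<omega> s z)))"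
    if "z \<in> Y" for z
    by (rule lifted_flow(2)[where \<Phi> = \<Phi> and \<tau> = \<tau> and \<omega> = \<omega> and \<Psi> = \<Psi> and i = i, OF \<Phi> \<tau> \<omega> \<Psi>_def])
      (erule eq | rule zero | rule that | rule addc; assumption)+
  show thesis
  proof
    show "flow Y \<Psi>" by (rule lift1)
    show "vfst (\<Psi> s (vjoin x w)) = \<Phi> (s * cofactor \<kappa> i w) x" for s x w by (simp add: \<Psi>_def \<tau>_def)
    show "cofactor \<kappa> i (vsnd (\<Psi> s (vjoin x w))) = cofactor \<kappa> i w" for s x w by (simp add: cof)
    fix x w assume z: "vjoin x w \<in> Y"
    have x: "x \<in> X" using z by (simp add: mem_Y)
    have "deriv_at_0 (\<lambda>s. \<tau> s (vjoin x w)) = cofactor \<kappa> i w"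
      using deriv_at_0_mult[OF pcurve_id pcurve_const, of "cofactor \<kappa> i w"] by (simp add: \<tau>_def)
    moreover have "deriv_at_0 (\<lambda>s. \<omega> s (vjoin x w)) = g 0 x"
      using deriv_at_0_mult[OF pcurve_id polyfam_pcurve[OF g\<tau> z]] by (simp add: \<omega>_def \<tau>_def)
    moreover have "g 0 x = dd F x (velocity \<Phi> x)"
      using flow_polyfun_velocity[OF \<Phi> x F] deriv_at_0_add[OF pcurve_const pcurve_mult[OF pcurve_id polyfam_pcurve[OF g x]], of "F x"]
        deriv_at_0_mult[OF pcurve_id polyfam_pcurve[OF g x]]
      by (simp add: Fg[OF x])
    ultimately show "velocity \<Psi> (vjoin x w) =
        vjoin (cofactor \<kappa> i w *s velocity \<Phi> x) (axis i (dd F x (velocity \<Phi> x)))"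
      using lift2[OF z] by simp
  qed
qed

subsection \<open>Flexibility\<close>

lemma velocity_linear:
  assumes \<Phi>: "flow X \<Phi>" and lin: "\<And>s x. x \<in> X \<Longrightarrow> F (\<Phi> s x) = F x + s * f\<^sub>1 x" and x: "x \<in> X"
  shows "dd F x (velocity \<Phi> x) = f\<^sub>1 x"
  using flow_polyfun_velocity[OF \<Phi> x F] deriv_at_0_add[OF pcurve_const pcurve_mult[OF pcurve_id pcurve_const], of "F x" "f\<^sub>1 x"]
    deriv_at_0_mult[OF pcurve_id pcurve_const, of "f\<^sub>1 x"]
  by (simp add: lin[OF x])

text \<open>
  Where no \<open>w\<^sub>j\<close> vanishes, a tangent vector can be freed of all components along \<open>w\<^sub>j\<close> except the
  one solvable coordinate by means of the linear lifts; what
  remains is in the span of the velocities of lifted flows of \<open>X\<close>.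
\<close>

lemma flexible_at_general_point:
  assumes X_flex: "flexible X" and x: "x \<in> smooth_locus X" and z: "vjoin x w \<in> Y" and Fx: "F x \<noteq> 0"
    and i: "\<kappa> i = 1"
    and \<Phi>: "flow X \<Phi>" and f1: "f\<^sub>1 \<in> polyfun" and lin: "\<And>s x. x \<in> X \<Longrightarrow> F (\<Phi> s x) = F x + s * f\<^sub>1 x"
    and f1x: "f\<^sub>1 x \<noteq> 0"
  shows "flexible_at Y (vjoin x w)"
  unfolding flexible_at_def
proof
  let ?z = "vjoin x w"
  let ?S = "vec.span {velocity \<Psi> ?z | \<Psi>. flow Y \<Psi>}"
  let ?U = "cofactor \<kappa> i w"
  have xX: "x \<in> X" using z by (simp add: mem_Y)
  have U: "?U \<noteq> 0" using z Fx prod_eq_cofactor[of w \<kappa> i] by (auto simp: mem_Y)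
  have span_S: "vec.subspace ?S" by (rule vec.subspace_span)
  define L where "L \<xi> = vjoin (?U *s \<xi>) (axis i (dd F x \<xi>))" for \<xi> :: "'k^'n"
  have L_add: "L (\<xi> + \<xi>') = L \<xi> + L \<xi>'" for \<xi> \<xi>'
    by (simp add: L_def vjoin_add dd_add_vec[OF F] vector_add_ldistrib) (simp add: axis_def vec_eq_iff vjoin_def split: sum.split)
  have L_scale: "L (c *s \<xi>) = c *s L \<xi>" for c \<xi>
    by (simp add: L_def dd_scale_vec[OF F]) (simp add: axis_def vec_eq_iff vjoin_def split: sum.split)
  have L_velocity: "L (velocity \<Theta> x) \<in> ?S" if \<Theta>: "flow X \<Theta>" for \<Theta>
  proof -
    obtain \<Psi> where "flow Y \<Psi>" "velocity \<Psi> ?z = L (velocity \<Theta> x)"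
      using unit_lift[OF \<Theta> i] z unfolding L_def by metis
    then show ?thesis by (intro vec.span_base) force
  qed
  have "L \<xi> \<in> ?S" if "\<xi> \<in> vec.span {velocity \<Theta> x | \<Theta>. flow X \<Theta>}" for \<xi>
    using that
  proof (induction rule: vec.span_induct_alt)
    case base
    show ?case using L_scale[of 0 0] vec.subspace_0[OF span_S] by simp
  next
    case (step c \<xi> \<xi>')
    then show ?case
      using L_velocity vec.subspace_add[OF span_S] vec.subspace_scale[OF span_S] by (auto simp: L_add L_scale)
  qed
  moreover have "flexible_at X x" using X_flex x by (simp add: flexible_iff)
  ultimately have L_tangent: "L \<xi> \<in> ?S" if "\<xi> \<in> tangent_space X x" for \<xi>
    using that by (auto simp: flexible_at_def)
  let ?\<xi>0 = "velocity \<Phi> x"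
  define c where "c j = w $ j ^ (\<kappa> j - 1) * cofactor \<kappa> j w" for j
  define V where "V j = vjoin (c j *s ?\<xi>0) (axis j (f\<^sub>1 x / of_nat (\<kappa> j)))" for j
  have V: "V j \<in> ?S" for j
  proof -
    obtain \<Psi> where "flow Y \<Psi>" "velocity \<Psi> ?z = V j"
      using linear_lift[OF \<Phi> f1 lin, of j] z unfolding V_def c_def by metis
    then show ?thesis by (intro vec.span_base) force
  qed
  fix v assume v: "v \<in> tangent_space Y ?z"
  obtain \<xi> \<eta> where v_eq: "v = vjoin \<xi> \<eta>" by (rule vjoin_ex)
  have \<xi>: "\<xi> \<in> tangent_space X x" and monomial_differential: "monomial_differential \<kappa> w \<eta> = dd F x \<xi>"
    using tangent_Y_necessary[OF v] by (simp_all add: v_eq)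
  define a where "a j = \<eta> $ j * of_nat (\<kappa> j) / f\<^sub>1 x" for j
  \<comment> \<open>the coefficients \<open>a j\<close> remove the components of \<open>\<eta>\<close> other than the \<open>i\<close>-th, at the cost of changing \<open>\<xi>\<close>\<close>
  define \<xi>' where "\<xi>' = \<xi> - (\<Sum>j\<in>UNIV - {i}. a j * c j) *s ?\<xi>0"
  have \<xi>': "\<xi>' \<in> tangent_space X x"
    unfolding \<xi>'_def
    by (intro vec.subspace_diff vec.subspace_scale subspace_tangent_space \<xi> velocity_tangent[OF \<Phi> xX])
  have "dd F x \<xi> = dd F x \<xi>' + (\<Sum>j\<in>UNIV - {i}. a j * c j) * f\<^sub>1 x"
    using dd_add_vec[OF F, of x \<xi>' "(\<Sum>j\<in>UNIV - {i}. a j * c j) *s ?\<xi>0"] velocity_linear[OF \<Phi> lin xX]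
    by (simp add: \<xi>'_def dd_scale_vec[OF F])
  moreover have "dd F x \<xi> = ?U * \<eta> $ i + (\<Sum>j\<in>UNIV - {i}. of_nat (\<kappa> j) * c j * \<eta> $ j)"
    using monomial_differential_remove[of w \<eta> i] by (simp add: monomial_differential i c_def)
  moreover have "(\<Sum>j\<in>UNIV - {i}. a j * c j) * f\<^sub>1 x = (\<Sum>j\<in>UNIV - {i}. of_nat (\<kappa> j) * c j * \<eta> $ j)"
    unfolding sum_distrib_right by (rule sum.cong) (use f1x in \<open>auto simp: a_def\<close>)
  ultimately have dd': "dd F x \<xi>' = ?U * \<eta> $ i" by simp
  have "v = L ((1 / ?U) *s \<xi>') + (\<Sum>j\<in>UNIV - {i}. a j *s V j)"
  proof -
    have k0: "\<kappa> j \<noteq> 0" for j using \<kappa>[of j] by simp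
    have "v $ b = (L ((1 / ?U) *s \<xi>') + (\<Sum>j\<in>UNIV - {i}. a j *s V j)) $ b" for b
    proof (cases b)
      case (Inl b')
      have "(\<Sum>j\<in>UNIV - {i}. a j *s V j) $ b = (\<Sum>j\<in>UNIV - {i}. a j * c j) * ?\<xi>0 $ b'"
        by (simp add: V_def Inl sum_distrib_right mult.assoc)
      then show ?thesis using U by (simp add: v_eq L_def Inl \<xi>'_def)
    next
      case (Inr b')
      have "(\<Sum>j\<in>UNIV - {i}. a j *s V j) $ b = (\<Sum>j\<in>UNIV - {i}. if j = b' then \<eta> $ j else 0)"
        unfolding sum_component
      proof (rule sum.cong[OF refl])
        fix j
        show "(a j *s V j) $ b = (if j = b' then \<eta> $ j else 0)"
          using f1x k0[of j] by (auto simp: V_def Inr axis_def a_def)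
      qed
      also have "\<dots> = (if b' = i then 0 else \<eta> $ b')" by simp
      finally show ?thesis
        using U by (auto simp: v_eq L_def Inr dd_scale_vec[OF F] dd' axis_def)
    qed
    then show ?thesis by (simp add: vec_eq_iff)
  qed
  moreover have "L ((1 / ?U) *s \<xi>') \<in> ?S"
    by (intro L_tangent vec.subspace_scale subspace_tangent_space \<xi>')
  moreover have "(\<Sum>j\<in>UNIV - {i}. a j *s V j) \<in> ?S"
    by (intro vec.subspace_sum vec.subspace_scale span_S V)
  ultimately show "v \<in> ?S" using vec.subspace_add[OF span_S] by simp
qed

lemma reach_lift:
  assumes "reach X x q" "vjoin x w \<in> Y" and i: "\<kappa> i = 1" "cofactor \<kappa> i w \<noteq> 0"
  shows "\<exists>w'. reach Y (vjoin x w) (vjoin q w') \<and> cofactor \<kappa> i w' \<noteq> 0"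
  using assms(1) unfolding reach_def[of X]
proof (induction rule: rtranclp_induct)
  case base
  then show ?case using reach_refl i(2) by blast
next
  case (step y q)
  then obtain w' where w': "reach Y (vjoin x w) (vjoin y w')" "cofactor \<kappa> i w' \<noteq> 0" by blast
  obtain \<Phi> s where \<Phi>: "flow X \<Phi>" "q = \<Phi> s y" using step by blast
  obtain \<Psi> where \<Psi>: "flow Y \<Psi>" "\<And>s x w. vfst (\<Psi> s (vjoin x w)) = \<Phi> (s * cofactor \<kappa> i w) x"
    "\<And>s x w. cofactor \<kappa> i (vsnd (\<Psi> s (vjoin x w))) = cofactor \<kappa> i w"
    using unit_lift[OF \<Phi>(1) i(1)] by metis
  let ?z = "\<Psi> (s / cofactor \<kappa> i w') (vjoin y w')"
  have "vfst ?z = q" using w'(2) by (simp only: \<Psi>(2) \<Phi>(2)) simp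
  then have "?z = vjoin q (vsnd ?z)" by (metis vjoin_vfst_vsnd)
  then have "reach Y (vjoin x w) (vjoin q (vsnd ?z))"
    using reach_trans[OF w'(1) reach_flow[OF \<Psi>(1)]] by metis
  moreover have "cofactor \<kappa> i (vsnd ?z) \<noteq> 0" using w'(2) by (simp only: \<Psi>(3) not_False_eq_True)
  ultimately show ?case by blast
qed

lemma reach_in_fibre:
  assumes \<Phi>: "flow X \<Phi>" and f1: "f\<^sub>1 \<in> polyfun" and lin: "\<And>s x. x \<in> X \<Longrightarrow> F (\<Phi> s x) = F x + s * f\<^sub>1 x"
    and f1x: "f\<^sub>1 x \<noteq> 0" and z: "vjoin x w \<in> Y" and cof: "cofactor \<kappa> i w = 0"
  shows "reach Y (vjoin x w) (vjoin x (\<chi> j. if j = i then t else w $ j))"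
proof -
  obtain \<Psi> where \<Psi>: "flow Y \<Psi>" "\<And>s. \<Psi> s (vjoin x w) = vjoin x (w + axis i (s * f\<^sub>1 x / of_nat (\<kappa> i)))"
    using linear_lift[OF \<Phi> f1 lin, of i] z cof by metis
  define s where "s = (t - w $ i) * of_nat (\<kappa> i) / f\<^sub>1 x"
  have "s * f\<^sub>1 x / of_nat (\<kappa> i) = t - w $ i" using f1x \<kappa>[of i] by (simp add: s_def)
  then have "w + axis i (s * f\<^sub>1 x / of_nat (\<kappa> i)) = (\<chi> j. if j = i then t else w $ j)"
    by (simp add: vec_eq_iff axis_def)
  then show ?thesis using reach_flow[OF \<Psi>(1), of "vjoin x w" s] \<Psi>(2)[of s] by simp
qed

text \<open>
  First \<open>w\<^sub>i\<close> is made zero. Then all other cofactors vanish, so the other coordinates can be made \<open>1\<close> one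
  after the other without moving \<open>x\<close>.
\<close>

lemma reach_cofactor_nz:
  assumes \<Phi>: "flow X \<Phi>" and f1: "f\<^sub>1 \<in> polyfun" and lin: "\<And>s x. x \<in> X \<Longrightarrow> F (\<Phi> s x) = F x + s * f\<^sub>1 x"
    and f1x: "f\<^sub>1 x \<noteq> 0" and z: "vjoin x w \<in> Y" and cof: "cofactor \<kappa> i w = 0"
  shows "\<exists>w'. reach Y (vjoin x w) (vjoin x w') \<and> cofactor \<kappa> i w' \<noteq> 0"
proof -
  have "\<exists>w'. reach Y (vjoin x w) (vjoin x w') \<and> w' $ i = 0 \<and> (\<forall>j\<in>S. w' $ j = 1)" if "finite S" "i \<notin> S" for S
    using that
  proof (induction S)
    case empty
    show ?case using reach_in_fibre[OF \<Phi> f1 lin f1x z cof, of 0]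
      by (intro exI[of _ "\<chi> j. if j = i then 0 else w $ j"]) simp
  next
    case (insert k S)
    then obtain w' where w': "reach Y (vjoin x w) (vjoin x w')" "w' $ i = 0" "\<forall>j\<in>S. w' $ j = 1" by auto
    have ki: "k \<noteq> i" using insert.prems by auto
    have "cofactor \<kappa> k w' = 0" by (rule cofactor_zero[OF w'(2)]) (use \<kappa>[of i] ki in auto)
    then have "reach Y (vjoin x w) (vjoin x (\<chi> j. if j = k then 1 else w' $ j))"
      using reach_trans[OF w'(1)] reach_in_fibre[OF \<Phi> f1 lin f1x reach_in[OF w'(1) z]] by blast
    then show ?case
      by (intro exI[of _ "\<chi> j. if j = k then 1 else w' $ j"]) (use w' ki insert.hyps in auto)
  qed
  from this[of "UNIV - {i}"] obtain w' where w': "reach Y (vjoin x w) (vjoin x w')" "\<forall>j\<in>UNIV - {i}. w' $ j = 1"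
    by auto
  moreover have "cofactor \<kappa> i w' = 1" unfolding cofactor_def by (rule prod.neutral) (use w'(2) in auto)
  ultimately show ?thesis by (intro exI[of _ w']) simp
qed

text \<open>
  Every smooth point is moved to a point where \<open>F\<close> and the slope \<open>f\<^sub>1\<close> are nonzero. If some coordinate
  can be solved for, move along the base. Otherwise the differential of the monomial
  vanishes, so that of \<open>F\<close> does not, and by \<open>cond\<close> the function \<open>F\<close> has nonzero slope along some flow
  through \<open>x\<close>; then move within the fibre until some coordinate can be solved for.
\<close>

theorem flexible_at_smooth_points:
  assumes X_flex: "flexible X" and i: "\<kappa> i = 1"
    and \<Phi>: "flow X \<Phi>" and f1: "f\<^sub>1 \<in> polyfun" and lin: "\<And>s x. x \<in> X \<Longrightarrow> F (\<Phi> s x) = F x + s * f\<^sub>1 x"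
    and f1_nz: "\<not> vanishes_on f\<^sub>1 X"
    and cond: "\<And>x \<xi>. x \<in> smooth_locus X \<Longrightarrow> F x = 0 \<Longrightarrow> \<xi> \<in> tangent_space X x \<Longrightarrow> dd F x \<xi> \<noteq> 0 \<Longrightarrow>
      \<exists>\<Theta> g. flow X \<Theta> \<and> g \<in> polyfun \<and> (\<forall>s. \<forall>x\<in>X. F (\<Theta> s x) = F x + s * g x) \<and> g x \<noteq> 0"
    and z: "z \<in> smooth_locus Y"
  shows "flexible_at Y z"
proof -
  obtain x w where z_eq: "z = vjoin x w" by (rule vjoin_ex)
  have zY: "vjoin x w \<in> Y" using z by (simp add: smooth_locus_def z_eq)
  have good: "flexible_at Y (vjoin x w)"
    if zY: "vjoin x w \<in> Y" and x: "x \<in> smooth_locus X" and j: "\<kappa> j = 1" "cofactor \<kappa> j w \<noteq> 0" for x w j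
  proof -
    have "\<not> vanishes_on (\<lambda>x. F x * f\<^sub>1 x) X" using irreducible_prime[OF X F f1] F_nz f1_nz by blast
    then obtain q where q: "reach X x q" "F q * f\<^sub>1 q \<noteq> 0"
      using orbit_dense[OF X_flex x polyfun_mult[OF F f1]] by blast
    have xX: "x \<in> X" and dimx: "vec.dim (tangent_space X x) = var_dim X" using x by (auto simp: smooth_locus_def)
    obtain w' where w': "reach Y (vjoin x w) (vjoin q w')" "cofactor \<kappa> j w' \<noteq> 0"
      using reach_lift[OF q(1) zY j] by blast
    have "q \<in> smooth_locus X" using reach_in[OF q(1) xX] reach_dim[OF q(1) xX] dimx by (simp add: smooth_locus_def)
    then have "flexible_at Y (vjoin q w')"
      using flexible_at_general_point[OF X_flex _ reach_in[OF w'(1) zY] _ j(1) \<Phi> f1 lin] q(2) by auto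
    then show ?thesis by (rule reach_flexible_at[OF w'(1) zY])
  qed
  show ?thesis
  proof (cases "\<exists>j. \<kappa> j = 1 \<and> cofactor \<kappa> j w \<noteq> 0")
    case True
    then obtain j where j: "\<kappa> j = 1" "cofactor \<kappa> j w \<noteq> 0" by blast
    have "x \<in> smooth_locus X" using smooth_Y_if_cofactor_nz[OF _ j] z by (simp add: z_eq)
    then show ?thesis unfolding z_eq by (rule good[OF zY _ j])
  next
    case False
    then have cof: "\<And>j. \<kappa> j = 1 \<Longrightarrow> cofactor \<kappa> j w = 0" by blast
    have Fx: "F x = 0" using zY prod_eq_cofactor[of w \<kappa> i] cof[OF i] by (simp add: mem_Y)
    have x: "x \<in> smooth_locus X" and "\<exists>\<xi>\<in>tangent_space X x. dd F x \<xi> \<noteq> 0"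
      using smooth_Y_if_cofactors_zero[OF _ Fx cof] z by (auto simp: z_eq)
    then obtain \<Theta> g where \<Theta>: "flow X \<Theta>" "g \<in> polyfun" "\<And>s x. x \<in> X \<Longrightarrow> F (\<Theta> s x) = F x + s * g x" "g x \<noteq> 0"
      using cond[OF x Fx] by blast
    obtain w' where w': "reach Y (vjoin x w) (vjoin x w')" "cofactor \<kappa> i w' \<noteq> 0"
      using reach_cofactor_nz[OF \<Theta> zY cof[OF i]] by blast
    have "flexible_at Y (vjoin x w')" by (rule good[OF reach_in[OF w'(1) zY] x i w'(2)])
    then show ?thesis unfolding z_eq by (rule reach_flexible_at[OF w'(1) zY])
  qed
qed

end

section \<open>Slices and the loci of the theorem\<close>

lemma lnd_deg_eq_1_iff:
  fixes X :: "('k::field_char_0^'n) set"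
  assumes \<delta>: "\<delta> \<in> LND X" and a: "a \<in> coord_ring X"
  shows "lnd_deg \<delta> a = 1 \<longleftrightarrow> \<delta> a \<noteq> (\<lambda>_. 0) \<and> \<delta> (\<delta> a) = (\<lambda>_. 0)"
proof
  let ?P = "\<lambda>n. (\<delta> ^^ (n + 1)) a = (\<lambda>_. 0)"
  assume deg: "lnd_deg \<delta> a = 1"
  obtain n where "(\<delta> ^^ n) a = (\<lambda>_. 0)" using der_nilpotent[OF \<delta> a] by blast
  then have "?P n" using der_iter_zero[OF \<delta>, of n a "n + 1"] by simp
  then have "?P (LEAST n. ?P n)" by (rule LeastI)
  moreover have "\<not> ?P 0" using not_less_Least[of 0 ?P] deg by (simp add: lnd_deg_def)
  ultimately show "\<delta> a \<noteq> (\<lambda>_. 0) \<and> \<delta> (\<delta> a) = (\<lambda>_. 0)"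
    using deg by (simp add: lnd_deg_def)
next
  assume *: "\<delta> a \<noteq> (\<lambda>_. 0) \<and> \<delta> (\<delta> a) = (\<lambda>_. 0)"
  show "lnd_deg \<delta> a = 1"
    unfolding lnd_deg_def
  proof (rule Least_equality)
    show "(\<delta> ^^ (1 + 1)) a = (\<lambda>_. 0)" using * by simp
    fix n assume "(\<delta> ^^ (n + 1)) a = (\<lambda>_. 0)"
    then show "1 \<le> n" using * by (cases n) auto
  qed
qed

lemma D_locus_iff:
  fixes X :: "('k::field_char_0^'n) set"
  shows "x \<in> D_locus X f \<longleftrightarrow> x \<in> X \<and> f x = 0 \<and> (\<forall>\<delta>\<in>N1 X f. \<delta> f x = 0)"
proof -
  define S where "S = {f} \<union> {\<delta> f | \<delta>. \<delta> \<in> N1 X f}"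
  have "x \<in> D_locus X f \<longleftrightarrow> x \<in> X \<and> (\<forall>a\<in>S. a x = 0)"
  proof (intro iffI conjI ballI)
    assume x: "x \<in> D_locus X f"
    then show xX: "x \<in> X" by (simp add: D_locus_def zero_locus_def)
    fix a assume a: "a \<in> S"
    have one: "on_variety X (\<lambda>_. 1) \<in> coord_ring X" by (rule on_variety_coord_ring[OF polyfun_const])
    have "(\<lambda>y. \<Sum>b\<in>{a}. on_variety X (\<lambda>_. 1) y * b y) \<in> coord_ring_ideal X S"
      unfolding coord_ring_ideal_def
      by (rule CollectI, rule exI[of _ "{a}"], rule exI[of _ "\<lambda>_. on_variety X (\<lambda>_. 1)"]) (use a one in auto)
    moreover have "\<forall>b\<in>coord_ring_ideal X S. b x = 0"
      using x by (simp add: D_locus_def zero_locus_def S_def)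
    ultimately have "(\<Sum>b\<in>{a}. on_variety X (\<lambda>_. 1) x * b x) = 0"
      by (rule bspec[rotated])
    then show "a x = 0" using xX by (simp add: on_variety_def)
  next
    assume x: "x \<in> X \<and> (\<forall>a\<in>S. a x = 0)"
    have "b x = 0" if bS: "b \<in> coord_ring_ideal X S" for b
    proof -
      obtain G c where b: "b = (\<lambda>x. \<Sum>a\<in>G. c a x * a x)" and G: "G \<subseteq> S"
        using bS unfolding coord_ring_ideal_def by blast
      have "c a x * a x = 0" if "a \<in> G" for a using that x G by auto
      then show ?thesis unfolding b by (intro sum.neutral) blast
    qed
    then show "x \<in> D_locus X f" using x unfolding D_locus_def zero_locus_def S_def[symmetric] by blast
  qed
  then show ?thesis by (auto simp: S_def)
qed

lemma module_times: "module ((*) :: 'r::comm_ring_1 \<Rightarrow> 'r \<Rightarrow> 'r)"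
  by unfold_locales (simp_all add: algebra_simps)

text \<open>
  The rows coming from the ideal of \<open>X\<close> annihilate \<open>\<xi>\<close> and at a smooth point have rank equal to the
  codimension; the row of \<open>F\<close> does not annihilate \<open>\<xi>\<close>.
\<close>

lemma mem_Reg_zero_locus:
  fixes X :: "('k::field_char_0^'n) set"
  assumes x: "x \<in> smooth_locus X" and F: "F \<in> polyfun" "F x = 0"
    and \<xi>: "\<xi> \<in> tangent_space X x" "dd F x \<xi> \<noteq> 0"
  shows "x \<in> Reg_zero_locus X (on_variety X F)"
proof -
  have xX: "x \<in> X" and dimx: "vec.dim (tangent_space X x) = var_dim X" using x by (auto simp: smooth_locus_def)
  obtain P where P: "\<And>x. F x = mp_eval (($) x) P" using polyfunE[OF F(1)] by blast
  have grad: "gradient g x = grd (\<lambda>x. mp_eval (($) x) g) x" for g :: "('n, 'k) mpoly"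
    by (simp add: vec_eq_iff grd_def gradient_nth)
  define V where "V = {grd G x | G. G \<in> polyfun \<and> vanishes_on G X}"
  have V: "(\<lambda>g. gradient g x) ` vanishing_ideal X = V"
    by (auto simp: V_def grad vanishing_ideal_def vanishes_on_def polyfun_eq_range image_iff)
  have FP: "F = (\<lambda>x. mp_eval (($) x) P)" by (simp add: P fun_eq_iff)
  obtain \<Delta> and I :: "'n set" where "\<Delta> \<in> polyfun" "\<Delta> x \<noteq> 0" and I: "card I = vec.dim (tangent_space X x)"
    and "\<And>y v. \<Delta> y \<noteq> 0 \<Longrightarrow> v \<in> tangent_space X y \<Longrightarrow> (\<And>i. i \<in> I \<Longrightarrow> v $ i = 0) \<Longrightarrow> v = 0"
    and IV: "card I + vec.dim {grd F x | F. F \<in> polyfun \<and> vanishes_on F X} = CARD('n)"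
    using tangent_chart_rank[of x X] by blast
  have "(\<Sum>i\<in>UNIV. b $ i * \<xi> $ i) = 0" if "b \<in> vec.span V" for b
    using that
  proof (induction rule: vec.span_induct_alt)
    case (step c b b')
    then obtain G where "G \<in> polyfun" "vanishes_on G X" "b = grd G x" by (auto simp: V_def)
    then have "(\<Sum>i\<in>UNIV. b $ i * \<xi> $ i) = 0"
      using \<xi>(1) dd_grd[of G x \<xi>] by (auto simp: tangent_space_iff vanishes_on_def)
    then show ?case using step by (simp add: distrib_right sum.distrib mult.assoc flip: sum_distrib_left)
  qed simp
  then have "grd F x \<notin> vec.span V" using \<xi>(2) dd_grd[OF F(1), of x \<xi>] by auto
  then have "vec.dim (insert (gradient P x) V) = vec.dim V + 1"
    by (simp add: vec.dim_insert grad flip: FP)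
  also have "vec.dim V = CARD('n) - var_dim X" using IV I dimx by (simp add: V_def)
  finally have dim: "vec.dim (insert (gradient P x) ((\<lambda>g. gradient g x) ` vanishing_ideal X)) = CARD('n) - var_dim X + 1"
    by (simp add: V)
  interpret ring: module "(*) :: ('n, 'k) mpoly \<Rightarrow> _" by (rule module_times)
  have "ring.subspace (vanishing_ideal X)"
    by (auto simp: ring.subspace_def vanishing_ideal_def mp_eval_add mp_eval_mult)
  then have "ring.span (vanishing_ideal X) = vanishing_ideal X" by (simp add: ring.span_eq_iff)
  moreover have "regular_function X P = on_variety X F"
    by (simp add: regular_function_def on_variety_def P fun_eq_iff)
  ultimately show ?thesis
    unfolding Reg_zero_locus_def using xX F(2) dim
    by (intro CollectI conjI exI[of _ "vanishing_ideal X"] exI[of _ P]) (simp_all add: on_variety_def)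
qed

lemma R_locus_empty_if:
  fixes X :: "('k::field_char_0^'n) set"
  assumes "f \<in> coord_ring X" "\<delta> \<in> LND X" "\<delta> (\<delta> f) = (\<lambda>_. 0)" "\<delta> f \<noteq> (\<lambda>_. 0)"
    and "\<And>x. x \<in> X \<Longrightarrow> f x = 0 \<Longrightarrow> \<delta> f x \<noteq> 0"
  shows "R_locus X f = {}"
proof -
  have "\<delta> \<in> N1 X f" using assms lnd_deg_eq_1_iff[of \<delta> X f] by (simp add: N1_def)
  then have "x \<notin> D_locus X f" for x using assms(5) unfolding D_locus_iff by blast
  then show ?thesis by (auto simp: R_locus_def)
qed

lemma coord_ring_prime:
  fixes X :: "('k::field_char_0^'n) set"
  assumes X: "zariski_irreducible X" and ab: "a \<in> coord_ring X" "b \<in> coord_ring X"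
    and zero: "\<And>x. x \<in> X \<Longrightarrow> a x ^ m * b x = 0"
  shows "a = (\<lambda>_. 0) \<or> b = (\<lambda>_. 0)"
proof -
  obtain F G where FG: "F \<in> polyfun" "G \<in> polyfun" "a = on_variety X F" "b = on_variety X G"
    using ab by (auto simp: coord_ring_eq)
  have "vanishes_on (\<lambda>x. F x * G x) X"
    using zero by (auto simp: vanishes_on_def FG on_variety_def)
  then have "vanishes_on F X \<or> vanishes_on G X" by (rule irreducible_prime[OF X FG(1,2)])
  then show ?thesis by (auto simp: FG on_variety_def vanishes_on_def fun_eq_iff)
qed

lemma coord_ring_power:
  fixes X :: "('k::field_char_0^'n) set"
  assumes "a \<in> coord_ring X" shows "(\<lambda>x. a x ^ Suc n) \<in> coord_ring X"
proof (induction n)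
  case (Suc n)
  have "(\<lambda>x. a x * a x ^ Suc n) \<in> coord_ring X" by (rule coord_ring_mult[OF assms Suc])
  then show ?case by simp
qed (simp add: assms)

lemma der_power:
  fixes X :: "('k::field_char_0^'n) set"
  assumes "\<delta> \<in> LND X" "a \<in> coord_ring X"
  shows "\<delta> (\<lambda>x. a x ^ Suc n) = (\<lambda>x. of_nat (Suc n) * (a x ^ n * \<delta> a x))"
proof (induction n)
  case (Suc n)
  have "\<delta> (\<lambda>x. a x * a x ^ Suc n) = (\<lambda>x. \<delta> a x * a x ^ Suc n + a x * \<delta> (\<lambda>x. a x ^ Suc n) x)"
    by (rule der_mult[OF assms coord_ring_power[OF assms(2)]])
  then show ?case unfolding Suc by (simp add: fun_eq_iff algebra_simps)
qed simp

text \<open>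
  Along with its power \<open>\<delta> g\<close>, also \<open>p\<close> is in the kernel of \<open>\<delta>\<close>. So \<open>\<delta> f = h p\<^sup>n\<^sup>+\<^sup>1\<close> is in the kernel as
  well, and it can only vanish where \<open>f = c\<close>.
\<close>

lemma R_locus_empty_if_product:
  fixes X :: "('k::field_char_0^'n) set"
  assumes X: "zariski_irreducible X" and slice: "local_slice X f"
    and \<delta>: "\<delta> \<in> LND X" and h: "h \<in> coord_ring X" "\<delta> h = (\<lambda>_. 0)" and g: "g \<in> coord_ring X" "lnd_deg \<delta> g = 1"
    and p: "p \<in> coord_ring X" "n \<ge> 1" "\<And>x. x \<in> X \<Longrightarrow> p x ^ n = \<delta> g x" and c: "c \<noteq> 0"
    and f_eq: "\<And>x. x \<in> X \<Longrightarrow> f x = h x * g x * p x + c"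
  shows "R_locus X f = {}"
proof -
  have f: "f \<in> coord_ring X" using slice by (simp add: local_slice_def)
  have dg: "\<delta> g \<noteq> (\<lambda>_. 0)" "\<delta> (\<delta> g) = (\<lambda>_. 0)" using g lnd_deg_eq_1_iff[OF \<delta> g(1)] by auto
  obtain m where n: "n = Suc m" using p(2) by (cases n) auto
  have outside: "a x = 0" if "a \<in> coord_ring X" "x \<notin> X" for a x by (rule coord_ring_outside[OF that])
  have pn: "(\<lambda>x. p x ^ Suc m) = \<delta> g"
  proof
    fix x show "p x ^ Suc m = \<delta> g x"
      using p(3)[of x] outside[OF p(1), of x] outside[OF der_in[OF \<delta> g(1)], of x]
      by (cases "x \<in> X") (simp_all add: n)
  qed
  have p0: "p \<noteq> (\<lambda>_. 0)" using dg(1) pn by auto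
  have dp: "\<delta> p = (\<lambda>_. 0)"
  proof -
    have "(\<lambda>x. of_nat (Suc m) * (p x ^ m * \<delta> p x)) = (\<lambda>_. 0)"
      using der_power[OF \<delta> p(1), of m, symmetric] unfolding pn dg(2) .
    then have "p x ^ m * \<delta> p x = 0" for x
      by (metis (no_types, lifting) mult_eq_0_iff of_nat_neq_0)
    then show ?thesis using coord_ring_prime[OF X p(1) der_in[OF \<delta> p(1)]] p0 by blast
  qed
  let ?c = "on_variety X (\<lambda>_. c)"
  have cc: "?c \<in> coord_ring X" by (rule on_variety_coord_ring[OF polyfun_const])
  have gp: "(\<lambda>x. g x * p x) \<in> coord_ring X" by (rule coord_ring_mult[OF g(1) p(1)])
  have hgp: "(\<lambda>x. h x * (g x * p x)) \<in> coord_ring X" by (rule coord_ring_mult[OF h(1) gp])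
  have f_fun: "f = (\<lambda>x. h x * (g x * p x) + ?c x)"
  proof
    fix x show "f x = h x * (g x * p x) + ?c x"
      using f_eq[of x] outside[OF f, of x] outside[OF hgp, of x] by (cases "x \<in> X") (auto simp: on_variety_def)
  qed
  have df: "\<delta> f = (\<lambda>x. h x * p x ^ Suc (Suc m))"
    unfolding f_fun der_add[OF \<delta> hgp cc] der_const[OF \<delta>] der_mult[OF \<delta> h(1) gp] der_mult[OF \<delta> g(1) p(1)]
    by (simp add: h dp flip: pn) (simp add: algebra_simps)
  have "\<delta> (\<delta> f) = (\<lambda>_. 0)"
    unfolding df der_mult[OF \<delta> h(1) coord_ring_power[OF p(1)]] der_power[OF \<delta> p(1)] by (simp add: h dp)
  moreover have "\<delta> f x \<noteq> 0" if "x \<in> X" "f x = 0" for x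
    using f_eq[OF that(1)] that(2) c by (auto simp: df)
  moreover have "\<delta> f \<noteq> (\<lambda>_. 0)"
  proof
    assume "\<delta> f = (\<lambda>_. 0)"
    then have zero: "p x ^ Suc (Suc m) * h x = 0" for x using fun_cong[OF df, of x] by (simp add: mult.commute)
    have "p = (\<lambda>_. 0) \<or> h = (\<lambda>_. 0)" by (rule coord_ring_prime[OF X p(1) h(1) zero])
    then have "f = ?c" using f_fun p0 by auto
    moreover obtain \<epsilon> where "\<epsilon> \<in> LND X" "\<epsilon> f \<noteq> (\<lambda>_. 0)" using slice by (auto simp: local_slice_def)
    ultimately show False using der_const by metis
  qed
  ultimately show ?thesis by (intro R_locus_empty_if[OF f \<delta>])
qed

lemma R_locus_empty_if_slice:
  fixes X :: "('k::field_char_0^'n) set"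
  assumes X: "zariski_irreducible X" and slice: "slice X f"
  shows "R_locus X f = {}"
proof -
  obtain \<delta> where \<delta>: "\<delta> \<in> LND X" "\<And>x. x \<in> X \<Longrightarrow> \<delta> f x = 1" and f: "f \<in> coord_ring X"
    using slice by (auto simp: slice_def)
  have df: "\<delta> f = on_variety X (\<lambda>_. 1)"
    using \<delta>(2) coord_ring_outside[OF der_in[OF \<delta>(1) f]] by (auto simp: on_variety_def fun_eq_iff)
  obtain x where "x \<in> X" using X by (auto simp: zariski_irreducible_def)
  then have "\<delta> f \<noteq> (\<lambda>_. 0)" using \<delta>(2) by (metis zero_neq_one)
  moreover have "\<delta> (\<delta> f) = (\<lambda>_. 0)" by (simp only: df der_const[OF \<delta>(1)])
  ultimately show ?thesis
    using \<delta>(2) by (intro R_locus_empty_if[OF f \<delta>(1)]) auto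
qed

lemma zariski_closed_suspension:
  fixes X :: "('k::field_char_0^'n) set" and \<kappa> :: "'q::finite \<Rightarrow> nat"
  assumes X: "zariski_closed X" and F: "F \<in> polyfun"
  shows "zariski_closed (suspension X F \<kappa>)"
proof -
  let ?Y = "suspension X F \<kappa>"
  obtain S where S: "X = {x. \<forall>p\<in>S. mp_eval (($) x) p = 0}" using X by (auto simp: zariski_closed_def)
  have sub: "z \<in> ?Y" if "\<forall>p\<in>vanishing_ideal ?Y. mp_eval (($) z) p = 0" for z
  proof -
    have H: "H z = 0" if "H \<in> polyfun" "\<And>y. y \<in> ?Y \<Longrightarrow> H y = 0" for H
    proof -
      obtain P where "\<And>x. H x = mp_eval (($) x) P" using polyfunE[OF \<open>H \<in> polyfun\<close>] by blast
      then show ?thesis using \<open>\<forall>p\<in>vanishing_ideal ?Y. mp_eval (($) z) p = 0\<close> that(2) by (auto simp: vanishing_ideal_def)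
    qed
    have "mp_eval (($) (vfst z)) p = 0" if "p \<in> S" for p
      by (rule H[OF polyfun_vfst[OF polyfun_mp_eval]]) (use that S in \<open>auto simp: suspension_def\<close>)
    then have "vfst z \<in> X" by (subst S) blast
    moreover have "(\<Prod>i\<in>UNIV. vsnd z $ i ^ \<kappa> i) - F (vfst z) = 0"
      by (rule H) (auto simp: suspension_def intro!: polyfun_diff polyfun_prod polyfun_power polyfun_coord polyfun_vfst F)
    ultimately show ?thesis by (simp add: suspension_def)
  qed
  have "?Y = {z. \<forall>p\<in>vanishing_ideal ?Y. mp_eval (($) z) p = 0}"
  proof (intro equalityI subsetI CollectI)
    fix z assume "z \<in> ?Y"
    then show "\<forall>p\<in>vanishing_ideal ?Y. mp_eval (($) z) p = 0" unfolding vanishing_ideal_def by blast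
  qed (use sub in blast)
  then show ?thesis unfolding zariski_closed_def by blast
qed

lemma Y_variety_eq_suspension:
  fixes k :: "'l::finite \<Rightarrow> nat"
  shows "(Y_variety X (on_variety X F) k :: ('k::field_char_0^('n::finite + ('m::finite + 'l))) set) =
    suspension X F (case_sum (\<lambda>_. 1) k)"
proof -
  have prod: "(\<Prod>i\<in>UNIV. w $ i ^ case_sum (\<lambda>_. 1) k i) = (\<Prod>i\<in>UNIV. vfst w $ i) * (\<Prod>j\<in>UNIV. vsnd w $ j ^ k j)"
    for w :: "'k^('m + 'l)"
  proof -
    have "(\<Prod>i\<in>UNIV <+> UNIV. w $ i ^ case_sum (\<lambda>_. 1) k i) =
      (\<Prod>i\<in>UNIV. w $ Inl i ^ case_sum (\<lambda>_. 1) k (Inl i)) * (\<Prod>j\<in>UNIV. w $ Inr j ^ case_sum (\<lambda>_. 1) k (Inr j))"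
      by (subst prod.Plus) (simp_all add: comp_def)
    then show ?thesis by simp
  qed
  show ?thesis
  proof (intro equalityI subsetI)
    fix z assume "z \<in> (Y_variety X (on_variety X F) k :: ('k^('n + ('m + 'l))) set)"
    then show "z \<in> suspension X F (case_sum (\<lambda>_. 1) k)"
      unfolding Y_variety_def suspension_def mem_Collect_eq prod by (auto simp: on_variety_def simp del: vfst_nth vsnd_nth)
  next
    fix z :: "'k^('n + ('m + 'l))"
    assume z: "z \<in> suspension X F (case_sum (\<lambda>_. 1) k)"
    have "z = vjoin (vfst z) (vjoin (vfst (vsnd z)) (vsnd (vsnd z)))" by simp
    then show "z \<in> Y_variety X (on_variety X F) k"
      unfolding Y_variety_def using z unfolding suspension_def mem_Collect_eq prod
      by (intro CollectI exI[of _ "vfst z"] exI[of _ "vfst (vsnd z)"] exI[of _ "vsnd (vsnd z)"])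
        (simp add: on_variety_def del: vfst_nth vsnd_nth)
  qed
qed

theorem flexible_if_R_locus_empty:
  fixes X :: "('k::{alg_closed_field, field_char_0} ^ 'n) set"
    and f :: "'k ^ 'n \<Rightarrow> 'k"
    and k :: "'l::finite \<Rightarrow> nat"
    and Y :: "('k ^ ('n + ('m::finite + 'l))) set"
  assumes Y_eq: "Y = Y_variety X f k" and X_flex: "flexible X" and slice: "local_slice X f"
    and k: "\<forall>j. k j > 1" and irrY: "zariski_irreducible Y" and R: "R_locus X f = {}"
  shows "flexible Y"
proof -
  have irrX: "zariski_irreducible X" and closedX: "zariski_closed X"
    using X_flex by (auto simp: flexible_def irreducible_affine_variety_def)
  have "f \<in> coord_ring X" using slice by (simp add: local_slice_def)
  then obtain F where F: "F \<in> polyfun" and f: "f = on_variety X F" by (auto simp: coord_ring_eq)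
  define \<kappa> :: "'m + 'l \<Rightarrow> nat" where "\<kappa> = case_sum (\<lambda>_. 1) k"
  have Y_susp: "Y = suspension X F \<kappa>" by (simp add: Y_eq f Y_variety_eq_suspension \<kappa>_def)
  have lift: "\<exists>\<Phi> g. flow X \<Phi> \<and> g \<in> polyfun \<and> (\<forall>s. \<forall>x\<in>X. F (\<Phi> s x) = F x + s * g x) \<and> (\<forall>x\<in>X. g x = \<delta> f x)"
    if \<delta>: "\<delta> \<in> LND X" "\<delta> (\<delta> f) = (\<lambda>_. 0)" for \<delta>
  proof -
    obtain \<Phi> where \<Phi>: "flow X \<Phi>" "\<And>s x. x \<in> X \<Longrightarrow> f (\<Phi> s x) = f x + s * \<delta> f x"
      using LND_flow[OF closedX \<delta>(1) \<open>f \<in> coord_ring X\<close> \<delta>(2)] by blast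
    obtain g where g: "g \<in> polyfun" "\<delta> f = on_variety X g"
      using der_in[OF \<delta>(1) \<open>f \<in> coord_ring X\<close>] by (auto simp: coord_ring_eq)
    have "F (\<Phi> s x) = F x + s * g x" if "x \<in> X" for s x
      using \<Phi>(2)[OF that, of s] that flow_in[OF \<Phi>(1) that, of s] by (simp add: g(2)) (simp add: f on_variety_def)
    then show ?thesis using \<Phi>(1) g by (intro exI[of _ \<Phi>] exI[of _ g]) (simp add: on_variety_def)
  qed
  obtain \<delta> where \<delta>: "\<delta> \<in> LND X" "\<delta> f \<noteq> (\<lambda>_. 0)" "\<delta> (\<delta> f) = (\<lambda>_. 0)"
    using slice by (auto simp: local_slice_def)
  have F_nz: "\<not> vanishes_on F X"
  proof
    assume "vanishes_on F X"
    then have "f = (\<lambda>_. 0)" by (auto simp: f on_variety_def vanishes_on_def)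
    then show False using \<delta>(2) der_zero[OF \<delta>(1)] by simp
  qed
  have \<kappa>: "\<kappa> i > 0" for i using k by (cases i) (auto simp: \<kappa>_def intro: less_trans[OF zero_less_one])
  interpret irreducible_suspension X F \<kappa> Y
    by unfold_locales (use irrX F F_nz \<kappa> irrY Y_susp in auto)
  obtain \<Phi> g where \<Phi>: "flow X \<Phi>" "g \<in> polyfun" "\<And>s x. x \<in> X \<Longrightarrow> F (\<Phi> s x) = F x + s * g x" "\<And>x. x \<in> X \<Longrightarrow> g x = \<delta> f x"
    using lift[OF \<delta>(1,3)] by blast
  have g_nz: "\<not> vanishes_on g X"
    using \<delta>(2) \<Phi>(4) coord_ring_outside[OF der_in[OF \<delta>(1) \<open>f \<in> coord_ring X\<close>]] by (auto simp: vanishes_on_def fun_eq_iff)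
  have cond: "\<exists>\<Theta> g. flow X \<Theta> \<and> g \<in> polyfun \<and> (\<forall>s. \<forall>x\<in>X. F (\<Theta> s x) = F x + s * g x) \<and> g x \<noteq> 0"
    if x: "x \<in> smooth_locus X" "F x = 0" "\<xi> \<in> tangent_space X x" "dd F x \<xi> \<noteq> 0" for x \<xi>
  proof -
    have xX: "x \<in> X" using x(1) by (simp add: smooth_locus_def)
    have "x \<in> Reg_zero_locus X f" unfolding f by (rule mem_Reg_zero_locus[OF x(1) F x(2-4)])
    then have "x \<notin> D_locus X f" using R by (auto simp: R_locus_def)
    then obtain \<epsilon> where \<epsilon>: "\<epsilon> \<in> N1 X f" "\<epsilon> f x \<noteq> 0" using x(2) xX by (auto simp: D_locus_iff f on_variety_def)
    then have "\<epsilon> \<in> LND X" "\<epsilon> (\<epsilon> f) = (\<lambda>_. 0)"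
      using lnd_deg_eq_1_iff[OF _ \<open>f \<in> coord_ring X\<close>, of \<epsilon>] by (auto simp: N1_def)
    from lift[OF this] show ?thesis using \<epsilon>(2) xX by metis
  qed
  have i: "\<kappa> (Inl undefined) = 1" by (simp add: \<kappa>_def)
  have "flexible_at Y z" if "z \<in> smooth_locus Y" for z
    by (rule flexible_at_smooth_points[OF X_flex i \<Phi>(1,2,3) g_nz cond that])
  then show ?thesis
    using zariski_closed_suspension[OF closedX F, of \<kappa>] irrY
    by (simp add: flexible_iff irreducible_affine_variety_def Y_susp)
qed

theorem corollary4p1:
  fixes X :: "('k::{alg_closed_field, field_char_0} ^ 'n) set"
    and f :: "'k ^ 'n \<Rightarrow> 'k"
    and k :: "'l::finite \<Rightarrow> nat"
    and Y :: "('k ^ ('n + ('m::finite + 'l))) set"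
  defines "Y \<equiv> Y_variety X f k"
  assumes "flexible X"
    and "local_slice X f"
    and "\<forall>j. k j > 1"
    and "zariski_irreducible Y"
  shows "(R_locus X f = {} \<longrightarrow> flexible Y) \<and>
    (slice X f \<longrightarrow> flexible Y) \<and>
    ((\<exists>c. \<exists>\<delta>\<^sub>0\<in>LND X. \<exists>h\<in>coord_ring X. \<exists>g\<in>coord_ring X.
        c \<noteq> 0 \<and> lnd_deg \<delta>\<^sub>0 g = 1 \<and> \<delta>\<^sub>0 h = (\<lambda>_. 0) \<and>
        (\<forall>x\<in>X. f x = h x * g x * \<delta>\<^sub>0 g x + c)) \<longrightarrow> flexible Y) \<and>
    ((\<exists>c. \<exists>\<delta>\<^sub>0\<in>LND X. \<exists>h\<in>coord_ring X. \<exists>g\<in>coord_ring X. \<exists>p\<in>coord_ring X. \<exists>n\<ge>1.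
        c \<noteq> 0 \<and> lnd_deg \<delta>\<^sub>0 g = 1 \<and> \<delta>\<^sub>0 h = (\<lambda>_. 0) \<and>
        (\<forall>x\<in>X. p x ^ n = \<delta>\<^sub>0 g x) \<and>
        (\<forall>x\<in>X. f x = h x * g x * p x + c)) \<longrightarrow> flexible Y)"
proof -
  have X: "zariski_irreducible X"
    using assms(2) by (simp add: flexible_def irreducible_affine_variety_def)
  have main: "flexible Y" if "R_locus X f = {}"
    by (rule flexible_if_R_locus_empty[OF _ assms(2-5) that]) (simp add: Y_def)
  show ?thesis
  proof (intro conjI impI)
    show "flexible Y" if "R_locus X f = {}" by (rule main[OF that])
    show "flexible Y" if "slice X f" by (rule main[OF R_locus_empty_if_slice[OF X that]])
    show "flexible Y" if ex: "\<exists>c. \<exists>\<delta>\<^sub>0\<in>LND X. \<exists>h\<in>coord_ring X. \<exists>g\<in>coord_ring X.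
        c \<noteq> 0 \<and> lnd_deg \<delta>\<^sub>0 g = 1 \<and> \<delta>\<^sub>0 h = (\<lambda>_. 0) \<and> (\<forall>x\<in>X. f x = h x * g x * \<delta>\<^sub>0 g x + c)"
    proof -
      obtain c \<delta>\<^sub>0 h g where *: "\<delta>\<^sub>0 \<in> LND X" "h \<in> coord_ring X" "g \<in> coord_ring X" "c \<noteq> 0"
        "lnd_deg \<delta>\<^sub>0 g = 1" "\<delta>\<^sub>0 h = (\<lambda>_. 0)" "\<And>x. x \<in> X \<Longrightarrow> f x = h x * g x * \<delta>\<^sub>0 g x + c"
        using ex by blast
      show ?thesis
        by (rule main, rule R_locus_empty_if_product[where n = 1, OF X assms(3) *(1,2,6,3,5) der_in[OF *(1,3)] _ _ *(4) *(7)])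
          simp_all
    qed
    show "flexible Y" if ex: "\<exists>c. \<exists>\<delta>\<^sub>0\<in>LND X. \<exists>h\<in>coord_ring X. \<exists>g\<in>coord_ring X. \<exists>p\<in>coord_ring X. \<exists>n\<ge>1.
        c \<noteq> 0 \<and> lnd_deg \<delta>\<^sub>0 g = 1 \<and> \<delta>\<^sub>0 h = (\<lambda>_. 0) \<and> (\<forall>x\<in>X. p x ^ n = \<delta>\<^sub>0 g x) \<and>
        (\<forall>x\<in>X. f x = h x * g x * p x + c)"
    proof -
      obtain c \<delta>\<^sub>0 h g p n where *: "\<delta>\<^sub>0 \<in> LND X" "h \<in> coord_ring X" "g \<in> coord_ring X" "p \<in> coord_ring X" "1 \<le> n" "c \<noteq> 0"
        "lnd_deg \<delta>\<^sub>0 g = 1" "\<delta>\<^sub>0 h = (\<lambda>_. 0)" "\<And>x. x \<in> X \<Longrightarrow> p x ^ n = \<delta>\<^sub>0 g x" "\<And>x. x \<in> X \<Longrightarrow> f x = h x * g x * p x + c"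
        using ex by blast
      show ?thesis
        by (rule main, rule R_locus_empty_if_product[OF X assms(3) *(1,2,8,3,7,4,5) _ *(6,10)]) (rule *(9))
    qed
  qed
qed

end
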